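(* Let $G(\mathcal{Y})=(G_\sigma,\psi_a,g_{a,b})$ be a complex of groups over a connected scwol $\mathcal{Y}$. Then $G(\mathcal{Y})$ is developable if and only if for all $\gamma\in V(\mathcal{Y})$ the morphism of complexes of groups $\Sigma:L(\mathcal{Y}(\gamma))\to G(\mathcal{Y})$ (defined in the context) is $\pi_1$-injective, i.e. the induced homomorphism $\Sigma_*:\pi_1(L(\mathcal{Y}(\gamma)),\gamma)\to\pi_1(G(\mathcal{Y}),\gamma)$ is injective.
   Context: **Scwols.** A small category without loops (scwol) $\mathcal{Y}$ is a small category in which the only morphism from any object to itself is the identity. $V(\mathcal{Y})$ is its set of objects, $E(\mathcal{Y})$ its set of non-identity morphisms; $a\in E(\mathcal{Y})$ is a morphism from $i(a)$ to $t(a)$. $E^{(k)}(\mathcal{Y})$ is the set of $k$-tuples $(a_1,\dots,a_k)$ in $E(\mathcal{Y})$ with $i(a_j)=t(a_{j+1})$ for $1\le j<k$; for $(a,b)\in E^{(2)}(\mathcal{Y})$ the composite is $ab$, with $i(ab)=i(b)$, $t(ab)=t(a)$. The geometric realization $|\mathcal{Y}|$ is the complex with vertex set $V(\mathcal{Y})$ and one $k$-simplex for each element of $E^{(k)}(\mathcal{Y})$, glued in the obvious way. $\mathcal{Y}$ is connected (simply connected) if $|\mathcal{Y}|$ is. **Complexes of groups.** A complex of groups $G(\mathcal{Y})=(G_\sigma,\psi_a,g_{a,b})$ over $\mathcal{Y}$ consists of a local group $G_\sigma$ for each $\sigma\in V(\mathcal{Y})$, an injective homomorphism $\psi_a:G_{i(a)}\to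 G_{t(a)}$ for each $a\in E(\mathcal{Y})$, and a twisting element $g_{a,b}\in G_{t(a)}$ for each $(a,b)\in E^{(2)}(\mathcal{Y})$, such that $\mathrm{Ad}(g_{a,b})\psi_{ab}=\psi_a\psi_b$ (where $\mathrm{Ad}(g)(h)=ghg^{-1}$) and $\psi_a(g_{b,c})g_{a,bc}=g_{a,b}g_{ab,c}$ for all $(a,b,c)\in E^{(3)}(\mathcal{Y})$. **Morphisms.** A morphism $\phi:H(\mathcal{Y})\to G(\mathcal{X})$ of complexes of groups over a functor $f:\mathcal{Y}\to\mathcal{X}$ sending $E(\mathcal{Y})$ to $E(\mathcal{X})$ consists of homomorphisms $\phi_\sigma:H_\sigma\to G_{f(\sigma)}$ and elements $\phi(a)\in G_{t(f(a))}$ with $\mathrm{Ad}(\phi(a))\psi_{f(a)}\phi_{i(a)}=\phi_{t(a)}\psi_a$ and $\phi_{t(a)}(h_{a,b})\phi(ab)=\phi(a)\psi_{f(a)}(\phi(b))g_{f(a),f(b)}$. It is an isomorphism if $f$ is an isomorphism and all $\phi_\sigma$ are isomorphisms. **Developability.** An action of a group $G$ on a scwol $\mathcal{X}$ is a homomorphism $G\to\mathrm{Aut}(\mathcal{X})$ such that for all $a\in E(\mathcal{X})$, $g\in G$: $g.i(a)\ne t(a)$, and $g.i(a)=i(a)$ implies $g.a=a$. Let $\mathcal{Y}=G\backslash\mathcal{X}$ be the quotient scwol. Choose a lift $\bar\sigma\in V(\mathcal{X})$ of each $\sigma\in V(\mathcal{Y})$; for $a\in E(\mathcal{Y})$ let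 $\bar a$ be the unique lift of $a$ with $i(\bar a)=\overline{i(a)}$ and choose $h_a\in G$ with $h_a.t(\bar a)=\overline{t(a)}$. The complex of groups associated to the action has local groups $\mathrm{Stab}_G(\bar\sigma)$, homomorphisms $\psi_a=\mathrm{Ad}(h_a)$ and twisting elements $g_{a,b}=h_ah_bh_{ab}^{-1}$. A complex of groups is developable if it arises in this way (up to isomorphism) from an action of a group on a simply connected scwol. **Fundamental group.** Let $FG(\mathcal{Y})$ be the group generated by $\bigsqcup_\sigma G_\sigma\sqcup\{a^+,a^-:a\in E(\mathcal{Y})\}$ subject to: the relations of each $G_\sigma$; $(a^\pm)^{-1}=a^\mp$; $a^+b^+=g_{a,b}(ab)^+$ for $(a,b)\in E^{(2)}(\mathcal{Y})$; $\psi_a(g)=a^+ga^-$ for $g\in G_{i(a)}$. Put $i(a^+)=t(a)=t(a^-)$ and $t(a^+)=i(a)=i(a^-)$. For $\sigma\in V(\mathcal{Y})$, $\pi_1(G(\mathcal{Y}),\sigma)$ is the subgroup of $FG(\mathcal{Y})$ of elements represented by words $g_0e_1g_1\cdots e_kg_k$ ($k\ge0$) with $e_j\in\{a^\pm\}$, $i(e_1)=\sigma$, $t(e_j)=i(e_{j+1})$, $t(e_k)=\sigma$, $g_0\in G_\sigma$, $g_j\in G_{t(e_j)}$. A morphism $\phi$ over $f$ induces $FH(\mathcal{Y})\to FG(\mathcal{X})$, $h\mapsto\phi_\sigma(h)$ for $h\in H_\sigma$, $a^+\mapsto\phi(a)f(a)^+$, which restricts to $\phi_*:\pi_1(H(\mathcal{Y}),\sigma)\to\pi_1(G(\mathcal{X}),f(\sigma))$.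 **The scwol $\mathcal{Y}(\gamma)$.** The upper link $\mathrm{Lk}_\gamma$ has objects $\{c\in E(\mathcal{Y}):t(c)=\gamma\}$ and morphisms $\{(c,d)\in E^{(2)}(\mathcal{Y}):t(c)=\gamma\}$, with $(c,d)$ going from $cd$ to $c$ and composition $(c,d)(cd,d')=(c,dd')$. The lower link $\mathrm{Lk}^\gamma$ has objects $\{b\in E(\mathcal{Y}):i(b)=\gamma\}$ and morphisms $\{(a,b)\in E^{(2)}(\mathcal{Y}):i(b)=\gamma\}$, with $(a,b)$ going from $b$ to $ab$ and composition $(a',ab)(a,b)=(a'a,b)$. $\mathcal{Y}(\gamma)$ has objects $V(\mathrm{Lk}_\gamma)\sqcup\{\gamma\}\sqcup V(\mathrm{Lk}^\gamma)$ and non-identity morphisms: those of $\mathrm{Lk}_\gamma$ and $\mathrm{Lk}^\gamma$; $\gamma*c$ from $c$ to $\gamma$; $b*c$ from $c$ to $b$; $b*\gamma$ from $\gamma$ to $b$ (for $c\in V(\mathrm{Lk}_\gamma)$, $b\in V(\mathrm{Lk}^\gamma)$). The remaining compositions are $(\gamma*c)(c,d)=\gamma*cd$, $(b*c)(c,d)=b*cd$, $(a,b)(b*c)=ab*c$, $(b*\gamma)(\gamma*c)=b*c$, $(a,b)(b*\gamma)=ab*\gamma$. **Local complex of groups $L(\mathcal{Y}(\gamma))$.** It is the complex of groups $(L_\mu,\lambda_u,l_{u,v})$ over $\mathcal{Y}(\gamma)$ with: $L_c=G_{i(c)}$ for $c\in V(\mathrm{Lk}_\gamma)$, $L_\gamma=G_\gamma$,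 $L_b=G_\gamma$ for $b\in V(\mathrm{Lk}^\gamma)$; $\lambda_{(c,d)}=\psi_d$, $\lambda_{\gamma*c}=\psi_c$, $\lambda_{b*c}=\psi_c$, $\lambda_{b*\gamma}=\mathrm{id}_{G_\gamma}$, $\lambda_{(a,b)}=\mathrm{id}_{G_\gamma}$ for $(a,b)\in E(\mathrm{Lk}^\gamma)$; $l_{(c_1,d_1),(c_2,d_2)}=g_{d_1,d_2}$ for $((c_1,d_1),(c_2,d_2))\in E^{(2)}(\mathrm{Lk}_\gamma)$, $l_{\gamma*c,(c,d)}=g_{c,d}$, $l_{b*c,(c,d)}=g_{c,d}$, and all other twisting elements (for the pairs $((a,b),b*c)$, $(b*\gamma,\gamma*c)$, $((a,b),b*\gamma)$ and pairs in $E^{(2)}(\mathrm{Lk}^\gamma)$) trivial. **The morphism $\Sigma$.** Let $h:\mathcal{Y}(\gamma)\to\mathcal{Y}$ be the functor given on objects by $c\mapsto i(c)$ ($c\in V(\mathrm{Lk}_\gamma)$), $\gamma\mapsto\gamma$, $b\mapsto t(b)$ ($b\in V(\mathrm{Lk}^\gamma)$), and on morphisms by $(c,d)\mapsto d$ ($(c,d)\in E(\mathrm{Lk}_\gamma)$), $\gamma*c\mapsto c$, $b*c\mapsto bc$, $b*\gamma\mapsto b$, $(a,b)\mapsto a$ ($(a,b)\in E(\mathrm{Lk}^\gamma)$). $\Sigma:L(\mathcal{Y}(\gamma))\to G(\mathcal{Y})$ is the morphism of complexes of groups over $h$ with local homomorphisms $\Sigma_c=\mathrm{id}_{G_{i(c)}}$,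 $\Sigma_\gamma=\mathrm{id}_{G_\gamma}$, $\Sigma_b=\psi_b$ and elements $\Sigma((c,d))=e$, $\Sigma(\gamma*c)=e$, $\Sigma(b*c)=g_{b,c}$, $\Sigma(b*\gamma)=e$, $\Sigma((a,b))=g_{a,b}^{-1}$ for $(a,b)\in E(\mathrm{Lk}^\gamma)$. *)

theory Defs
  imports "HOL-Homology.Homology" "HOL-Algebra.Group_Action"
begin

section \<open>Small categories without loops\<close>

text \<open>
  A small category without loops is given by its objects and its non-identity morphisms.
  Composites of non-identity morphisms are non-identity morphisms (otherwise the homomorphism
  attached to a composite edge would make no sense), so identities never have to be mentioned.
  As in the category, cmp X a b is the composite of b followed by a.
\<close>

record ('v, 'e) scwol =
  verts :: "'v set"
  edges :: "'e set"
  src :: "'e \<Rightarrow> 'v"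
  tgt :: "'e \<Rightarrow> 'v"
  cmp :: "'e \<Rightarrow> 'e \<Rightarrow> 'e"

definition composable :: "('v, 'e) scwol \<Rightarrow> 'e \<Rightarrow> 'e \<Rightarrow> bool" where
  "composable X a b \<longleftrightarrow> a \<in> edges X \<and> b \<in> edges X \<and> src X a = tgt X b"

locale scwol =
  fixes X :: "('v, 'e) scwol"
  assumes src_in: "a \<in> edges X \<Longrightarrow> src X a \<in> verts X"
    and tgt_in: "a \<in> edges X \<Longrightarrow> tgt X a \<in> verts X"
    and cmp_in: "composable X a b \<Longrightarrow> cmp X a b \<in> edges X"
    and src_cmp: "composable X a b \<Longrightarrow> src X (cmp X a b) = src X b"
    and tgt_cmp: "composable X a b \<Longrightarrow> tgt X (cmp X a b) = tgt X a"
    and cmp_assoc: "composable X a b \<Longrightarrow> composable X b c \<Longrightarrow>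
          cmp X (cmp X a b) c = cmp X a (cmp X b c)"
    and no_loops: "a \<in> edges X \<Longrightarrow> src X a \<noteq> tgt X a"

definition scwol_functor ::
    "('v, 'e) scwol \<Rightarrow> ('w, 'd) scwol \<Rightarrow> ('v \<Rightarrow> 'w) \<Rightarrow> ('e \<Rightarrow> 'd) \<Rightarrow> bool" where
  "scwol_functor Y X fv fe \<longleftrightarrow>
     fv \<in> verts Y \<rightarrow> verts X \<and> fe \<in> edges Y \<rightarrow> edges X \<and>
     (\<forall>a\<in>edges Y. src X (fe a) = fv (src Y a) \<and> tgt X (fe a) = fv (tgt Y a)) \<and>
     (\<forall>a b. composable Y a b \<longrightarrow> fe (cmp Y a b) = cmp X (fe a) (fe b))"

definition scwol_isomorphism ::
    "('v, 'e) scwol \<Rightarrow> ('w, 'd) scwol \<Rightarrow> ('v \<Rightarrow> 'w) \<Rightarrow> ('e \<Rightarrow> 'd) \<Rightarrow> bool" where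
  "scwol_isomorphism Y X fv fe \<longleftrightarrow>
     scwol_functor Y X fv fe \<and> bij_betw fv (verts Y) (verts X) \<and> bij_betw fe (edges Y) (edges X)"


section \<open>Geometric realization\<close>

text \<open>
  The simplex Chain [a1, ..., ak] has the vertices tgt a1, src a1 = tgt a2, ..., src ak, numbered
  from 0 to k; face X i is the face opposite to the vertex number i.
\<close>

datatype ('v, 'e) simplex = Vertex 'v | Chain "'e list"

fun simplex_dim :: "('v, 'e) simplex \<Rightarrow> nat" where
  "simplex_dim (Vertex v) = 0"
| "simplex_dim (Chain as) = length as"

definition simplices :: "('v, 'e) scwol \<Rightarrow> ('v, 'e) simplex set" where
  "simplices X = Vertex ` verts X \<union>
     Chain ` {as. as \<noteq> [] \<and> set as \<subseteq> edges X \<and>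
                  (\<forall>j. Suc j < length as \<longrightarrow> src X (as ! j) = tgt X (as ! Suc j))}"

fun face :: "('v, 'e) scwol \<Rightarrow> nat \<Rightarrow> ('v, 'e) simplex \<Rightarrow> ('v, 'e) simplex" where
  "face X i (Vertex v) = Vertex v"
| "face X i (Chain as) =
     (if length as = 1 then Vertex (if i = 0 then src X (hd as) else tgt X (hd as))
      else if i = 0 then Chain (tl as)
      else if i = length as then Chain (butlast as)
      else Chain (take (i - 1) as @ [cmp X (as ! (i - 1)) (as ! i)] @ drop (Suc i) as))"

definition simplex_space :: "('v, 'e) scwol \<Rightarrow> (('v, 'e) simplex \<times> (nat \<Rightarrow> real)) topology" where
  "simplex_space X =
     sum_topology (\<lambda>s. subtopology (powertop_real UNIV) (standard_simplex (simplex_dim s)))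
       (simplices X)"

inductive glue :: "('v, 'e) scwol \<Rightarrow>
    ('v, 'e) simplex \<times> (nat \<Rightarrow> real) \<Rightarrow> ('v, 'e) simplex \<times> (nat \<Rightarrow> real) \<Rightarrow> bool" for X where
  "s \<in> simplices X \<Longrightarrow> simplex_dim s \<ge> 1 \<Longrightarrow> i \<le> simplex_dim s \<Longrightarrow>
   x \<in> standard_simplex (simplex_dim s - 1) \<Longrightarrow>
   glue X (s, simplical_face i x) (face X i s, x)"

definition glue_class :: "('v, 'e) scwol \<Rightarrow>
    ('v, 'e) simplex \<times> (nat \<Rightarrow> real) \<Rightarrow> (('v, 'e) simplex \<times> (nat \<Rightarrow> real)) set" where
  "glue_class X p = {q. equivclp (glue X) p q}"

definition realization ::
    "('v, 'e) scwol \<Rightarrow> (('v, 'e) simplex \<times> (nat \<Rightarrow> real)) set topology" where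
  "realization X =
     topology (\<lambda>U. U \<subseteq> glue_class X ` topspace (simplex_space X) \<and>
       openin (simplex_space X) {p \<in> topspace (simplex_space X). glue_class X p \<in> U})"

lemma openin_realization:
  "openin (realization X) U \<longleftrightarrow> U \<subseteq> glue_class X ` topspace (simplex_space X) \<and>
     openin (simplex_space X) {p \<in> topspace (simplex_space X). glue_class X p \<in> U}"
proof -
  let ?S = "simplex_space X" and ?q = "glue_class X"
  have "istopology (\<lambda>U. U \<subseteq> ?q ` topspace ?S \<and> openin ?S {p \<in> topspace ?S. ?q p \<in> U})"
    unfolding istopology_def
  proof (intro conjI allI impI; (elim conjE)?)
    fix U V
    assume "openin ?S {p \<in> topspace ?S. ?q p \<in> U}" "openin ?S {p \<in> topspace ?S. ?q p \<in> V}"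
    then have "openin ?S ({p \<in> topspace ?S. ?q p \<in> U} \<inter> {p \<in> topspace ?S. ?q p \<in> V})"
      by blast
    also have "{p \<in> topspace ?S. ?q p \<in> U} \<inter> {p \<in> topspace ?S. ?q p \<in> V}
        = {p \<in> topspace ?S. ?q p \<in> U \<inter> V}" by blast
    finally show "openin ?S {p \<in> topspace ?S. ?q p \<in> U \<inter> V}" .
  next
    fix \<K>
    assume *: "\<forall>K\<in>\<K>. K \<subseteq> ?q ` topspace ?S \<and> openin ?S {p \<in> topspace ?S. ?q p \<in> K}"
    then have "openin ?S (\<Union>K\<in>\<K>. {p \<in> topspace ?S. ?q p \<in> K})" by blast
    also have "(\<Union>K\<in>\<K>. {p \<in> topspace ?S. ?q p \<in> K}) = {p \<in> topspace ?S. ?q p \<in> \<Union>\<K>}" by blast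
    finally show "openin ?S {p \<in> topspace ?S. ?q p \<in> \<Union>\<K>}" .
    show "\<Union>\<K> \<subseteq> ?q ` topspace ?S" using * by blast
  qed blast
  then show ?thesis unfolding realization_def by simp
qed

lemma quotient_map_realization: "quotient_map (simplex_space X) (realization X) (glue_class X)"
proof -
  have "{p \<in> topspace (simplex_space X). glue_class X p \<in> glue_class X ` topspace (simplex_space X)}
      = topspace (simplex_space X)" by blast
  then have "openin (realization X) (glue_class X ` topspace (simplex_space X))"
    by (simp add: openin_realization)
  then have "topspace (realization X) = glue_class X ` topspace (simplex_space X)"
    using openin_realization[of X "topspace (realization X)"] openin_subset by blast
  then show ?thesis by (simp add: quotient_map_def openin_realization)
qed

definition connected_scwol :: "('v, 'e) scwol \<Rightarrow> bool" where
  "connected_scwol X \<longleftrightarrow> connected_space (realization X)"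

text \<open>
  The analogue for abstract topologies of simply_connected: any two loops, in particular any
  two constant ones, are freely homotopic.
\<close>

definition simply_connected_space :: "'a topology \<Rightarrow> bool" where
  "simply_connected_space T \<longleftrightarrow>
     (\<forall>p q. pathin T p \<and> p 1 = p 0 \<and> pathin T q \<and> q 1 = q 0 \<longrightarrow>
        homotopic_with (\<lambda>r. r 1 = r 0) (top_of_set {0..1}) T p q)"

definition simply_connected_scwol :: "('v, 'e) scwol \<Rightarrow> bool" where
  "simply_connected_scwol X \<longleftrightarrow> simply_connected_space (realization X)"


section \<open>Complexes of groups\<close>

record ('v, 'e, 'g) cog =
  lgrp :: "'v \<Rightarrow> 'g monoid"
  psi :: "'e \<Rightarrow> 'g \<Rightarrow> 'g"
  twist :: "'e \<Rightarrow> 'e \<Rightarrow> 'g"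

definition Ad :: "('g, 'm) monoid_scheme \<Rightarrow> 'g \<Rightarrow> 'g \<Rightarrow> 'g" where
  "Ad M g h = g \<otimes>\<^bsub>M\<^esub> h \<otimes>\<^bsub>M\<^esub> inv\<^bsub>M\<^esub> g"

lemma (in group) Ad_one: "x \<in> carrier G \<Longrightarrow> Ad G \<one> x = x"
  by (simp add: Ad_def)

locale complex_of_groups = scwol Y
  for Y :: "('v, 'e) scwol" +
  fixes G :: "('v, 'e, 'g) cog"
  assumes lgrp_group: "\<sigma> \<in> verts Y \<Longrightarrow> group (lgrp G \<sigma>)"
    and psi_hom: "a \<in> edges Y \<Longrightarrow> psi G a \<in> hom (lgrp G (src Y a)) (lgrp G (tgt Y a))"
    and psi_inj: "a \<in> edges Y \<Longrightarrow> inj_on (psi G a) (carrier (lgrp G (src Y a)))"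
    and twist_in: "composable Y a b \<Longrightarrow> twist G a b \<in> carrier (lgrp G (tgt Y a))"
    and Ad_twist: "composable Y a b \<Longrightarrow> g \<in> carrier (lgrp G (src Y b)) \<Longrightarrow>
          Ad (lgrp G (tgt Y a)) (twist G a b) (psi G (cmp Y a b) g) = psi G a (psi G b g)"
    and cocycle: "composable Y a b \<Longrightarrow> composable Y b c \<Longrightarrow>
          psi G a (twist G b c) \<otimes>\<^bsub>lgrp G (tgt Y a)\<^esub> twist G a (cmp Y b c)
          = twist G a b \<otimes>\<^bsub>lgrp G (tgt Y a)\<^esub> twist G (cmp Y a b) c"

text \<open>
  A morphism carries its underlying functor (on_vert, on_edge), its homomorphisms of local groups
  (loc) and its elements (elt).
\<close>

record ('v, 'e, 'g, 'w, 'd, 'k) cog_mor =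
  on_vert :: "'v \<Rightarrow> 'w"
  on_edge :: "'e \<Rightarrow> 'd"
  loc :: "'v \<Rightarrow> 'g \<Rightarrow> 'k"
  elt :: "'e \<Rightarrow> 'k"

definition cog_morphism ::
    "('v, 'e) scwol \<Rightarrow> ('v, 'e, 'g) cog \<Rightarrow> ('w, 'd) scwol \<Rightarrow> ('w, 'd, 'k) cog \<Rightarrow>
     ('v, 'e, 'g, 'w, 'd, 'k) cog_mor \<Rightarrow> bool" where
  "cog_morphism Y H X G \<phi> \<longleftrightarrow>
     scwol_functor Y X (on_vert \<phi>) (on_edge \<phi>) \<and>
     (\<forall>\<sigma>\<in>verts Y. loc \<phi> \<sigma> \<in> hom (lgrp H \<sigma>) (lgrp G (on_vert \<phi> \<sigma>))) \<and>
     (\<forall>a\<in>edges Y. elt \<phi> a \<in> carrier (lgrp G (tgt X (on_edge \<phi> a)))) \<and>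
     (\<forall>a\<in>edges Y. \<forall>g\<in>carrier (lgrp H (src Y a)).
        Ad (lgrp G (tgt X (on_edge \<phi> a))) (elt \<phi> a) (psi G (on_edge \<phi> a) (loc \<phi> (src Y a) g))
        = loc \<phi> (tgt Y a) (psi H a g)) \<and>
     (\<forall>a b. composable Y a b \<longrightarrow>
        loc \<phi> (tgt Y a) (twist H a b) \<otimes>\<^bsub>lgrp G (tgt X (on_edge \<phi> a))\<^esub> elt \<phi> (cmp Y a b)
        = elt \<phi> a \<otimes>\<^bsub>lgrp G (tgt X (on_edge \<phi> a))\<^esub> psi G (on_edge \<phi> a) (elt \<phi> b)
            \<otimes>\<^bsub>lgrp G (tgt X (on_edge \<phi> a))\<^esub> twist G (on_edge \<phi> a) (on_edge \<phi> b))"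

definition cog_isomorphism ::
    "('v, 'e) scwol \<Rightarrow> ('v, 'e, 'g) cog \<Rightarrow> ('w, 'd) scwol \<Rightarrow> ('w, 'd, 'k) cog \<Rightarrow>
     ('v, 'e, 'g, 'w, 'd, 'k) cog_mor \<Rightarrow> bool" where
  "cog_isomorphism Y H X G \<phi> \<longleftrightarrow>
     cog_morphism Y H X G \<phi> \<and> scwol_isomorphism Y X (on_vert \<phi>) (on_edge \<phi>) \<and>
     (\<forall>\<sigma>\<in>verts Y. loc \<phi> \<sigma> \<in> iso (lgrp H \<sigma>) (lgrp G (on_vert \<phi> \<sigma>)))"


section \<open>The fundamental group\<close>

datatype ('v, 'e, 'g) letter = Loc 'v 'g | Pos 'e | Neg 'e

type_synonym ('v, 'e, 'g) fg_word = "('v, 'e, 'g) letter list"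

definition fg_letters :: "('v, 'e) scwol \<Rightarrow> ('v, 'e, 'g) cog \<Rightarrow> ('v, 'e, 'g) letter set" where
  "fg_letters Y G =
     {Loc \<sigma> g | \<sigma> g. \<sigma> \<in> verts Y \<and> g \<in> carrier (lgrp G \<sigma>)} \<union> Pos ` edges Y \<union> Neg ` edges Y"

text \<open>
  FG is presented as a monoid: the relations make every generator invertible, so the presented
  monoid is the presented group.
\<close>

inductive fg_rel ::
    "('v, 'e) scwol \<Rightarrow> ('v, 'e, 'g) cog \<Rightarrow> ('v, 'e, 'g) fg_word \<Rightarrow> ('v, 'e, 'g) fg_word \<Rightarrow> bool"
  for Y G where
  rel_mult: "\<sigma> \<in> verts Y \<Longrightarrow> g \<in> carrier (lgrp G \<sigma>) \<Longrightarrow> h \<in> carrier (lgrp G \<sigma>) \<Longrightarrow>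
    fg_rel Y G [Loc \<sigma> g, Loc \<sigma> h] [Loc \<sigma> (g \<otimes>\<^bsub>lgrp G \<sigma>\<^esub> h)]"
| rel_one: "\<sigma> \<in> verts Y \<Longrightarrow> fg_rel Y G [Loc \<sigma> \<one>\<^bsub>lgrp G \<sigma>\<^esub>] []"
| rel_pos_neg: "a \<in> edges Y \<Longrightarrow> fg_rel Y G [Pos a, Neg a] []"
| rel_neg_pos: "a \<in> edges Y \<Longrightarrow> fg_rel Y G [Neg a, Pos a] []"
| rel_twist: "composable Y a b \<Longrightarrow>
    fg_rel Y G [Pos a, Pos b] [Loc (tgt Y a) (twist G a b), Pos (cmp Y a b)]"
| rel_psi: "a \<in> edges Y \<Longrightarrow> g \<in> carrier (lgrp G (src Y a)) \<Longrightarrow>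
    fg_rel Y G [Loc (tgt Y a) (psi G a g)] [Pos a, Loc (src Y a) g, Neg a]"

inductive fg_step ::
    "('v, 'e) scwol \<Rightarrow> ('v, 'e, 'g) cog \<Rightarrow> ('v, 'e, 'g) fg_word \<Rightarrow> ('v, 'e, 'g) fg_word \<Rightarrow> bool"
  for Y G where
  "fg_rel Y G l r \<Longrightarrow> fg_step Y G (u @ l @ v) (u @ r @ v)"

definition fg_eq ::
    "('v, 'e) scwol \<Rightarrow> ('v, 'e, 'g) cog \<Rightarrow> ('v, 'e, 'g) fg_word \<Rightarrow> ('v, 'e, 'g) fg_word \<Rightarrow> bool" where
  "fg_eq Y G = equivclp (fg_step Y G)"

type_synonym ('v, 'e, 'g) fg = "('v, 'e, 'g) fg_word set"

definition fg_class ::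
    "('v, 'e) scwol \<Rightarrow> ('v, 'e, 'g) cog \<Rightarrow> ('v, 'e, 'g) fg_word \<Rightarrow> ('v, 'e, 'g) fg" where
  "fg_class Y G w = {w'. fg_eq Y G w w'}"

definition FG :: "('v, 'e) scwol \<Rightarrow> ('v, 'e, 'g) cog \<Rightarrow> ('v, 'e, 'g) fg monoid" where
  "FG Y G =
     \<lparr>carrier = fg_class Y G ` lists (fg_letters Y G),
      mult = (\<lambda>A B. \<Union>u\<in>A. \<Union>v\<in>B. fg_class Y G (u @ v)),
      one = fg_class Y G []\<rparr>"

lemma fg_eq_refl [simp]: "fg_eq Y G w w"
  by (simp add: fg_eq_def)
lemma fg_eq_sym: "fg_eq Y G u w \<Longrightarrow> fg_eq Y G w u"
  by (simp add: fg_eq_def equivclp_sym)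
lemma fg_eq_trans: "fg_eq Y G u v \<Longrightarrow> fg_eq Y G v w \<Longrightarrow> fg_eq Y G u w"
  unfolding fg_eq_def by (rule equivclp_trans)

lemma fg_eq_context:
  assumes "fg_eq Y G l r"
  shows "fg_eq Y G (u @ l @ v) (u @ r @ v)"
  using assms unfolding fg_eq_def
proof (induction rule: equivclp_induct)
  case base then show ?case by simp
next
  case (step y z)
  have "fg_step Y G (u @ p @ v) (u @ q @ v)" if "fg_step Y G p q" for p q
    using that
  proof cases
    case (1 l r u' v')
    then show ?thesis using fg_step.intros[of Y G l r "u @ u'" "v' @ v"] by simp
  qed
  then have "equivclp (fg_step Y G) (u @ y @ v) (u @ z @ v)"
    using step(2) by (metis equivclp_sym r_into_equivclp)
  with step(3) show ?case by (rule equivclp_trans)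
qed

lemma fg_eq_append:
  assumes "fg_eq Y G u u'" "fg_eq Y G v v'"
  shows "fg_eq Y G (u @ v) (u' @ v')"
  using fg_eq_context[OF assms(1), of "[]" v] fg_eq_context[OF assms(2), of u' "[]"]
  unfolding append_Nil append_Nil2 by (rule fg_eq_trans)

lemma fg_class_eq_iff: "fg_class Y G u = fg_class Y G v \<longleftrightarrow> fg_eq Y G u v"
proof
  assume "fg_class Y G u = fg_class Y G v"
  moreover have "v \<in> fg_class Y G v" by (simp add: fg_class_def)
  ultimately show "fg_eq Y G u v" by (simp add: fg_class_def set_eq_iff)
next
  assume "fg_eq Y G u v"
  then show "fg_class Y G u = fg_class Y G v"
    unfolding fg_class_def by (blast intro: fg_eq_trans fg_eq_sym)
qed

lemma fg_mult: "fg_class Y G u \<otimes>\<^bsub>FG Y G\<^esub> fg_class Y G v = fg_class Y G (u @ v)"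
proof -
  have "fg_class Y G (u' @ v') = fg_class Y G (u @ v)"
    if "u' \<in> fg_class Y G u" "v' \<in> fg_class Y G v" for u' v'
    unfolding fg_class_eq_iff
    by (rule fg_eq_append; rule fg_eq_sym) (use that in \<open>simp_all add: fg_class_def\<close>)
  then have "(\<Union>u'\<in>fg_class Y G u. \<Union>v'\<in>fg_class Y G v. fg_class Y G (u' @ v'))
      = (\<Union>u'\<in>fg_class Y G u. \<Union>v'\<in>fg_class Y G v. fg_class Y G (u @ v))"
    by simp
  moreover have "u \<in> fg_class Y G u" "v \<in> fg_class Y G v"
    by (simp_all add: fg_class_def)
  ultimately show ?thesis by (auto simp: FG_def)
qed

lemma fg_rel_eq: "fg_rel Y G l r \<Longrightarrow> fg_eq Y G l r"
  unfolding fg_eq_def using fg_step.intros[of Y G l r "[]" "[]"] by (simp add: r_into_equivclp)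

lemma group_FG:
  assumes "complex_of_groups Y G"
  shows "group (FG Y G)"
proof (rule groupI)
  interpret complex_of_groups Y G by fact
  let ?L = "lists (fg_letters Y G)"
  have carr: "carrier (FG Y G) = fg_class Y G ` ?L" and one: "\<one>\<^bsub>FG Y G\<^esub> = fg_class Y G []"
    by (simp_all add: FG_def)
  show "\<one>\<^bsub>FG Y G\<^esub> \<in> carrier (FG Y G)" by (auto simp: FG_def)
  fix x assume "x \<in> carrier (FG Y G)"
  then obtain u where u: "x = fg_class Y G u" "u \<in> ?L" by (auto simp: carr)
  show "\<one>\<^bsub>FG Y G\<^esub> \<otimes>\<^bsub>FG Y G\<^esub> x = x" by (simp add: u one fg_mult)
  have "\<exists>v\<in>?L. fg_eq Y G (v @ w) []" if "w \<in> ?L" for w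
    using that
  proof (induction w rule: lists.induct)
    case Nil then show ?case by (intro bexI[of _ "[]"]) auto
  next
    case (Cons a w)
    then obtain v where v: "v \<in> ?L" "fg_eq Y G (v @ w) []" by auto
    have "\<exists>b\<in>fg_letters Y G. fg_eq Y G [b, a] []"
    proof (cases a)
      case (Loc \<sigma> g)
      with Cons.hyps have *: "\<sigma> \<in> verts Y" "g \<in> carrier (lgrp G \<sigma>)" by (auto simp: fg_letters_def)
      then interpret M: group "lgrp G \<sigma>" using lgrp_group by blast
      have "fg_eq Y G [Loc \<sigma> (inv\<^bsub>lgrp G \<sigma>\<^esub> g), Loc \<sigma> g] []"
        using fg_rel_eq[OF rel_mult[OF *(1) M.inv_closed[OF *(2)] *(2)]]
          fg_rel_eq[OF rel_one[OF *(1), of G]] unfolding M.l_inv[OF *(2)] by (rule fg_eq_trans)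
      then show ?thesis using Loc * by (auto simp: fg_letters_def intro!: bexI[of _ "Loc \<sigma> (inv\<^bsub>lgrp G \<sigma>\<^esub> g)"])
    next
      case (Pos e)
      then show ?thesis using Cons.hyps fg_rel_eq[OF rel_neg_pos[of e Y G]]
        by (intro bexI[of _ "Neg e"]) (auto simp: fg_letters_def)
    next
      case (Neg e)
      then show ?thesis using Cons.hyps fg_rel_eq[OF rel_pos_neg[of e Y G]]
        by (intro bexI[of _ "Pos e"]) (auto simp: fg_letters_def)
    qed
    then obtain b where b: "b \<in> fg_letters Y G" "fg_eq Y G [b, a] []" by blast
    have "fg_eq Y G ((v @ [b]) @ (a # w)) (v @ w)" using fg_eq_context[OF b(2), of v w] by simp
    then have "fg_eq Y G ((v @ [b]) @ (a # w)) []" using v(2) by (rule fg_eq_trans)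
    then show ?case using v(1) b(1) by (intro bexI[of _ "v @ [b]"]) auto
  qed
  then obtain v where v: "v \<in> ?L" "fg_eq Y G (v @ u) []" using u by blast
  then show "\<exists>y\<in>carrier (FG Y G). y \<otimes>\<^bsub>FG Y G\<^esub> x = \<one>\<^bsub>FG Y G\<^esub>"
    by (intro bexI[of _ "fg_class Y G v"]) (auto simp: u one fg_mult fg_class_eq_iff carr)
  fix y assume "y \<in> carrier (FG Y G)"
  then obtain v where v: "y = fg_class Y G v" "v \<in> ?L" by (auto simp: carr)
  show "x \<otimes>\<^bsub>FG Y G\<^esub> y \<in> carrier (FG Y G)" using u v by (auto simp: fg_mult carr)
  fix z assume "z \<in> carrier (FG Y G)"
  then obtain w where w: "z = fg_class Y G w" by (auto simp: carr)
  show "x \<otimes>\<^bsub>FG Y G\<^esub> y \<otimes>\<^bsub>FG Y G\<^esub> z = x \<otimes>\<^bsub>FG Y G\<^esub> (y \<otimes>\<^bsub>FG Y G\<^esub> z)"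
    by (simp add: u v w fg_mult)
qed

text \<open>The words g0 e1 g1 ... ek gk along edge paths from \<open>\<sigma>\<close> to \<open>\<tau>\<close>; note that the edge path
  e = Pos a runs from tgt a to src a.\<close>

inductive gpath :: "('v, 'e) scwol \<Rightarrow> ('v, 'e, 'g) cog \<Rightarrow> 'v \<Rightarrow> ('v, 'e, 'g) fg_word \<Rightarrow> 'v \<Rightarrow> bool"
  for Y G where
  gpath_Loc: "\<sigma> \<in> verts Y \<Longrightarrow> g \<in> carrier (lgrp G \<sigma>) \<Longrightarrow> gpath Y G \<sigma> [Loc \<sigma> g] \<sigma>"
| gpath_Pos: "a \<in> edges Y \<Longrightarrow> g \<in> carrier (lgrp G (tgt Y a)) \<Longrightarrow> gpath Y G (src Y a) w \<tau> \<Longrightarrow>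
    gpath Y G (tgt Y a) (Loc (tgt Y a) g # Pos a # w) \<tau>"
| gpath_Neg: "a \<in> edges Y \<Longrightarrow> g \<in> carrier (lgrp G (src Y a)) \<Longrightarrow> gpath Y G (tgt Y a) w \<tau> \<Longrightarrow>
    gpath Y G (src Y a) (Loc (src Y a) g # Neg a # w) \<tau>"

definition pi1 :: "('v, 'e) scwol \<Rightarrow> ('v, 'e, 'g) cog \<Rightarrow> 'v \<Rightarrow> ('v, 'e, 'g) fg monoid" where
  "pi1 Y G \<sigma> = (FG Y G)\<lparr>carrier := fg_class Y G ` {w. gpath Y G \<sigma> w \<sigma>}\<rparr>"

fun letter_map :: "('w, 'd) scwol \<Rightarrow> ('w, 'd, 'k) cog \<Rightarrow> ('v, 'e, 'g, 'w, 'd, 'k) cog_mor \<Rightarrow>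
    ('v, 'e, 'g) letter \<Rightarrow> ('w, 'd, 'k) fg_word" where
  "letter_map X G \<phi> (Loc \<sigma> g) = [Loc (on_vert \<phi> \<sigma>) (loc \<phi> \<sigma> g)]"
| "letter_map X G \<phi> (Pos a) = [Loc (tgt X (on_edge \<phi> a)) (elt \<phi> a), Pos (on_edge \<phi> a)]"
| "letter_map X G \<phi> (Neg a) = [Neg (on_edge \<phi> a),
     Loc (tgt X (on_edge \<phi> a)) (inv\<^bsub>lgrp G (tgt X (on_edge \<phi> a))\<^esub> (elt \<phi> a))]"

definition fg_map :: "('w, 'd) scwol \<Rightarrow> ('w, 'd, 'k) cog \<Rightarrow> ('v, 'e, 'g, 'w, 'd, 'k) cog_mor \<Rightarrow>
    ('v, 'e, 'g) fg \<Rightarrow> ('w, 'd, 'k) fg" where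
  "fg_map X G \<phi> A = (\<Union>w\<in>A. fg_class X G (concat (map (letter_map X G \<phi>) w)))"

lemma fg_eq_concat_map:
  assumes "\<And>l r. fg_rel Y H l r \<Longrightarrow> fg_eq X G (concat (map f l)) (concat (map f r))"
    and "fg_eq Y H u v"
  shows "fg_eq X G (concat (map f u)) (concat (map f v))"
  using assms(2) unfolding fg_eq_def[of Y]
proof (induction rule: equivclp_induct)
  case base then show ?case by simp
next
  case (step y z)
  have "fg_eq X G (concat (map f p)) (concat (map f q))" if "fg_step Y H p q" for p q
    using that by cases (simp add: assms(1) fg_eq_context)
  with step show ?case by (blast intro: fg_eq_trans fg_eq_sym)
qed

lemma fg_eq_letter_map:
  assumes "complex_of_groups Y H" "complex_of_groups X G" "cog_morphism Y H X G \<phi>"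
    and "fg_eq Y H u v"
  shows "fg_eq X G (concat (map (letter_map X G \<phi>) u)) (concat (map (letter_map X G \<phi>) v))"
proof (rule fg_eq_concat_map[OF _ assms(4)])
  interpret H: complex_of_groups Y H by fact
  interpret G: complex_of_groups X G by fact
  let ?f = "on_edge \<phi>" let ?v = "on_vert \<phi>"
  note m = assms(3)[unfolded cog_morphism_def scwol_functor_def]
  have v: "\<sigma> \<in> verts Y \<Longrightarrow> ?v \<sigma> \<in> verts X" for \<sigma> using m by blast
  have e: "a \<in> edges Y \<Longrightarrow> ?f a \<in> edges X" for a using m by blast
  have st: "src X (?f a) = ?v (src Y a)" "tgt X (?f a) = ?v (tgt Y a)" if "a \<in> edges Y" for a using m that by blast+
  have cm: "composable Y a b \<Longrightarrow> ?f (cmp Y a b) = cmp X (?f a) (?f b)" for a b using m by blast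
  have cp: "composable Y a b \<Longrightarrow> composable X (?f a) (?f b)" for a b using e st by (auto simp: composable_def)
  have lh: "\<sigma> \<in> verts Y \<Longrightarrow> loc \<phi> \<sigma> \<in> hom (lgrp H \<sigma>) (lgrp G (?v \<sigma>))" for \<sigma> using m by blast
  have lc: "\<sigma> \<in> verts Y \<Longrightarrow> g \<in> carrier (lgrp H \<sigma>) \<Longrightarrow> loc \<phi> \<sigma> g \<in> carrier (lgrp G (?v \<sigma>))" for \<sigma> g
    using hom_in_carrier[OF lh] .
  have el: "a \<in> edges Y \<Longrightarrow> elt \<phi> a \<in> carrier (lgrp G (?v (tgt Y a)))" for a using m st by metis
  define Q where "Q = (\<lambda>w. fg_class X G w)"
  interpret F: group "FG X G" by (rule group_FG) fact
  let ?m = "\<lambda>x y. x \<otimes>\<^bsub>FG X G\<^esub> y"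
  have eqI: "fg_eq X G p q" if "Q p = Q q" for p q using that by (simp add: Q_def fg_class_eq_iff)
  have Qm: "Q (p @ q) = ?m (Q p) (Q q)" for p q by (simp add: Q_def fg_mult)
  have Qc: "Q (x # y # q) = ?m (Q [x]) (Q (y # q))" for x y q using Qm[of "[x]" "y # q"] by simp
  have Q1: "Q [] = \<one>\<^bsub>FG X G\<^esub>" by (simp add: Q_def FG_def)
  have Ql: "Q [x] \<in> carrier (FG X G)" if "x \<in> fg_letters X G" for x using that by (auto simp: Q_def FG_def)
  have LL: "Q [Loc \<sigma> g] \<in> carrier (FG X G)" if "\<sigma> \<in> verts X" "g \<in> carrier (lgrp G \<sigma>)" for \<sigma> g
    using that by (intro Ql) (auto simp: fg_letters_def)
  have LP: "Q [Pos a] \<in> carrier (FG X G)" "Q [Neg a] \<in> carrier (FG X G)" if "a \<in> edges X" for a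
    using that by (auto intro!: Ql simp: fg_letters_def)
  have R: "Q l = Q r" if "fg_rel X G l r" for l r using fg_rel_eq[OF that] by (simp add: Q_def fg_class_eq_iff)
  have Rm: "?m (Q [Loc \<sigma> g]) (Q [Loc \<sigma> h]) = Q [Loc \<sigma> (g \<otimes>\<^bsub>lgrp G \<sigma>\<^esub> h)]"
    if "\<sigma> \<in> verts X" "g \<in> carrier (lgrp G \<sigma>)" "h \<in> carrier (lgrp G \<sigma>)" for \<sigma> g h
    using R[OF rel_mult[OF that]] by (simp add: Qc)
  have Rpn: "?m (Q [Pos a]) (Q [Neg a]) = \<one>\<^bsub>FG X G\<^esub>" "?m (Q [Neg a]) (Q [Pos a]) = \<one>\<^bsub>FG X G\<^esub>"
     if "a \<in> edges X" for a
    using R[OF rel_pos_neg[OF that]] R[OF rel_neg_pos[OF that]] by (simp_all add: Qc Q1)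
  have R1: "Q [Loc \<sigma> \<one>\<^bsub>lgrp G \<sigma>\<^esub>] = \<one>\<^bsub>FG X G\<^esub>" if "\<sigma> \<in> verts X" for \<sigma> using R[OF rel_one[OF that]] by (simp add: Q1)
  have Ri: "Q [Loc \<sigma> (inv\<^bsub>lgrp G \<sigma>\<^esub> g)] = inv\<^bsub>FG X G\<^esub> Q [Loc \<sigma> g]"
    if "\<sigma> \<in> verts X" "g \<in> carrier (lgrp G \<sigma>)" for \<sigma> g
  proof -
    interpret M: group "lgrp G \<sigma>" by (rule G.lgrp_group) fact
    show ?thesis using that by (intro F.inv_equality[symmetric]) (simp_all add: Rm LL R1)
  qed
  have Rn: "Q [Neg a] = inv\<^bsub>FG X G\<^esub> Q [Pos a]" if "a \<in> edges X" for a
    using that by (intro F.inv_equality[symmetric]) (simp_all add: Rpn LP)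
  have Rt: "?m (Q [Pos a]) (Q [Pos b]) = ?m (Q [Loc (tgt X a) (twist G a b)]) (Q [Pos (cmp X a b)])"
    if "composable X a b" for a b
    using R[OF rel_twist[OF that]] by (simp add: Qc)
  have Rp: "Q [Loc (tgt X a) (psi G a g)] = ?m (?m (Q [Pos a]) (Q [Loc (src X a) g])) (inv\<^bsub>FG X G\<^esub> (Q [Pos a]))"
    if "a \<in> edges X" "g \<in> carrier (lgrp G (src X a))" for a g
    using R[OF rel_psi[OF that]] that G.src_in by (simp add: Qc Rn F.m_assoc LL LP)
  fix l r :: "('a, 'b, 'c) fg_word" assume "fg_rel Y H l r"
  then show "fg_eq X G (concat (map (letter_map X G \<phi>) l)) (concat (map (letter_map X G \<phi>) r))"
  proof (cases, goal_cases)
    case (1 \<sigma> g h)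
    then show ?case by (intro eqI) (simp add: Qc Rm v lc hom_mult[OF lh])
  next
    case (2 \<sigma>)
    then show ?case using hom_one[OF lh H.lgrp_group G.lgrp_group] by (intro eqI) (simp add: Q1 R1 v)
  next
    case (3 a)
    let ?i = "inv\<^bsub>lgrp G (?v (tgt Y a))\<^esub> (elt \<phi> a)"
    have "?i \<in> carrier (lgrp G (?v (tgt Y a)))" "\<And>x. elt \<phi> a \<otimes>\<^bsub>lgrp G (?v (tgt Y a))\<^esub> ?i = \<one>\<^bsub>lgrp G (?v (tgt Y a))\<^esub>"
      using 3 G.lgrp_group el v H.tgt_in group.inv_closed group.r_inv by metis+
    have "?m (Q [Loc (?v (tgt Y a)) (elt \<phi> a)]) (?m (Q [Pos (?f a)]) (?m (Q [Neg (?f a)]) (Q [Loc (?v (tgt Y a)) ?i]))) = \<one>\<^bsub>FG X G\<^esub>"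
      using 3 el[of a] v H.tgt_in e by (simp add: Ri Rn LL LP F.m_assoc[symmetric])
    then show ?case using 3 by (intro eqI) (simp add: Qc Q1 st)
  next
    case (4 a)
    have "?m (Q [Neg (?f a)]) (?m (Q [Loc (?v (tgt Y a)) (inv\<^bsub>lgrp G (?v (tgt Y a))\<^esub> (elt \<phi> a))]) (?m (Q [Loc (?v (tgt Y a)) (elt \<phi> a)])  (Q [Pos (?f a)]))) = \<one>\<^bsub>FG X G\<^esub>"
      using 4 el[of a] v H.tgt_in e by (simp add: Ri Rn LL LP F.m_assoc[symmetric])
    then show ?case using 4 by (intro eqI) (simp add: Qc Q1 st)
  next
    case (5 a b)
    let ?a = "?f a" and ?b = "?f b" and ?t = "?v (tgt Y a)"
    have E: "a \<in> edges Y" "b \<in> edges Y" "src Y a = tgt Y b" using 5(3) by (auto simp: composable_def)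
    then have E': "?a \<in> edges X" "?b \<in> edges X" "src X ?a = tgt X ?b" "tgt X ?a = ?t" "?t \<in> verts X"
      "src X ?a \<in> verts X" "src X ?a = ?v (tgt Y b)" "tgt X ?b = ?v (tgt Y b)"
      using e st v H.tgt_in G.src_in by auto
    interpret T: group "lgrp G ?t" using E' G.lgrp_group by blast
    have ab: "?a \<in> edges X" "tgt Y (cmp Y a b) = tgt Y a" "cmp Y a b \<in> edges Y" "cmp X ?a ?b \<in> edges X"
      using E' 5(3) H.tgt_cmp H.cmp_in G.cmp_in cp by auto
    have m1: "elt \<phi> a \<in> carrier (lgrp G ?t)" "elt \<phi> b \<in> carrier (lgrp G (src X ?a))"
        "elt \<phi> (cmp Y a b) \<in> carrier (lgrp G ?t)"
      using E E' el[of a] el[of b] el[of "cmp Y a b"] ab by auto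
    have m2: "psi G ?a (elt \<phi> b) \<in> carrier (lgrp G ?t)"
      using hom_in_carrier[OF G.psi_hom[OF E'(1)] m1(2)] E' by simp
    have m3: "twist G ?a ?b \<in> carrier (lgrp G ?t)" using G.twist_in[OF cp[OF 5(3)]] E' by simp
    have m4: "loc \<phi> (tgt Y a) (twist H a b) \<in> carrier (lgrp G ?t)"
      using lc H.twist_in[OF 5(3)] H.tgt_in E by blast
    have eq: "loc \<phi> (tgt Y a) (twist H a b) \<otimes>\<^bsub>lgrp G ?t\<^esub> elt \<phi> (cmp Y a b)
        = elt \<phi> a \<otimes>\<^bsub>lgrp G ?t\<^esub> psi G ?a (elt \<phi> b) \<otimes>\<^bsub>lgrp G ?t\<^esub> twist G ?a ?b"
      using m 5(3) E'(4) by metis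
    have P: "?m (Q [Pos ?a]) (Q [Loc (src X ?a) (elt \<phi> b)]) = ?m (Q [Loc ?t (psi G ?a (elt \<phi> b))]) (Q [Pos ?a])"
      using Rp[OF E'(1) m1(2)] E' m1 by (simp add: F.m_assoc LL LP del: E'(3,7))
    have "?m (Q [Loc ?t (elt \<phi> a)]) (?m (Q [Pos ?a]) (?m (Q [Loc (src X ?a) (elt \<phi> b)]) (Q [Pos ?b])))
        = ?m (Q [Loc ?t (elt \<phi> a)]) (?m (?m (Q [Pos ?a]) (Q [Loc (src X ?a) (elt \<phi> b)])) (Q [Pos ?b]))"
      using E'(1,2,6) m1 by (simp add: F.m_assoc LL LP)
    also have "\<dots> = ?m (?m (Q [Loc ?t (elt \<phi> a)]) (Q [Loc ?t (psi G ?a (elt \<phi> b))])) (?m (Q [Pos ?a]) (Q [Pos ?b]))"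
      unfolding P using E'(1,2,5) m1 m2 by (simp add: F.m_assoc LL LP)
    also have "\<dots> = ?m (?m (Q [Loc ?t (elt \<phi> a)]) (Q [Loc ?t (psi G ?a (elt \<phi> b))]))
          (?m (Q [Loc ?t (twist G ?a ?b)]) (Q [Pos (cmp X ?a ?b)]))"
      using Rt[OF cp[OF 5(3)]] E'(4) by simp
    also have "\<dots> = ?m (?m (?m (Q [Loc ?t (elt \<phi> a)]) (Q [Loc ?t (psi G ?a (elt \<phi> b))]))
          (Q [Loc ?t (twist G ?a ?b)])) (Q [Pos (cmp X ?a ?b)])"
      using E'(1,2,5) m1 m2 m3 ab by (simp add: F.m_assoc LL LP)
    also have "\<dots> = ?m (?m (Q [Loc ?t (loc \<phi> (tgt Y a) (twist H a b))]) (Q [Loc ?t (elt \<phi> (cmp Y a b))])) (Q [Pos (cmp X ?a ?b)])"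
      using E'(5) m1 m2 m3 m4 by (simp add: Rm eq)
    also have "\<dots> = ?m (Q [Loc ?t (loc \<phi> (tgt Y a) (twist H a b))]) (?m (Q [Loc ?t (elt \<phi> (cmp Y a b))]) (Q [Pos (cmp X ?a ?b)]))"
      using E'(5) m1 m4 ab by (simp add: F.m_assoc LL LP)
    finally show ?case
      using 5 E' E ab st(2)[OF ab(3)] by (intro eqI) (simp add: Qc cm)
  next
    case (6 a g)
    let ?a = "?f a" and ?t = "?v (tgt Y a)"
    have E': "?a \<in> edges X" "tgt X ?a = ?t" "src X ?a = ?v (src Y a)" "?t \<in> verts X" "src X ?a \<in> verts X"
      using 6 e st v H.tgt_in H.src_in by auto
    interpret T: group "lgrp G ?t" using E' G.lgrp_group by blast
    have m1: "elt \<phi> a \<in> carrier (lgrp G ?t)" "loc \<phi> (src Y a) g \<in> carrier (lgrp G (src X ?a))"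
      using 6 el lc H.src_in E' by auto
    have m2: "psi G ?a (loc \<phi> (src Y a) g) \<in> carrier (lgrp G ?t)"
      using hom_in_carrier[OF G.psi_hom[OF E'(1)] m1(2)] E' by simp
    have eq: "loc \<phi> (tgt Y a) (psi H a g) =
        elt \<phi> a \<otimes>\<^bsub>lgrp G ?t\<^esub> psi G ?a (loc \<phi> (src Y a) g) \<otimes>\<^bsub>lgrp G ?t\<^esub> inv\<^bsub>lgrp G ?t\<^esub> elt \<phi> a"
      using m 6(3,4) E'(2) unfolding Ad_def by metis
    have "Q [Loc ?t (loc \<phi> (tgt Y a) (psi H a g))] =
        ?m (?m (Q [Loc ?t (elt \<phi> a)]) (Q [Loc ?t (psi G ?a (loc \<phi> (src Y a) g))])) (Q [Loc ?t (inv\<^bsub>lgrp G ?t\<^esub> elt \<phi> a)])"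
      using E'(4) m1 m2 by (simp add: Rm eq)
    also have "\<dots> = ?m (?m (Q [Loc ?t (elt \<phi> a)]) (?m (?m (Q [Pos ?a]) (Q [Loc (src X ?a) (loc \<phi> (src Y a) g)])) (Q [Neg ?a])))
         (Q [Loc ?t (inv\<^bsub>lgrp G ?t\<^esub> elt \<phi> a)])"
      using Rp[OF E'(1) m1(2)] E'(1,2) by (simp add: Rn)
    also have "\<dots> = ?m (Q [Loc ?t (elt \<phi> a)]) (?m (Q [Pos ?a]) (?m (Q [Loc (src X ?a) (loc \<phi> (src Y a) g)]) (?m (Q [Neg ?a])
         (Q [Loc ?t (inv\<^bsub>lgrp G ?t\<^esub> elt \<phi> a)]))))"
      using E'(1,4,5) m1 by (simp add: F.m_assoc LL LP)
    finally show ?case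
      using 6 E' by (intro eqI) (simp add: Qc)
  qed
qed

lemma fg_map_class:
  assumes "complex_of_groups Y H" "complex_of_groups X G" "cog_morphism Y H X G \<phi>"
  shows "fg_map X G \<phi> (fg_class Y H w) = fg_class X G (concat (map (letter_map X G \<phi>) w))"
proof -
  have "fg_class X G (concat (map (letter_map X G \<phi>) u)) = fg_class X G (concat (map (letter_map X G \<phi>) w))"
    if "u \<in> fg_class Y H w" for u
  proof -
    have "fg_eq Y H u w" using that by (simp add: fg_class_def fg_eq_sym)
    then show ?thesis unfolding fg_class_eq_iff by (rule fg_eq_letter_map[OF assms])
  qed
  moreover have "w \<in> fg_class Y H w" by (simp add: fg_class_def)
  ultimately show ?thesis unfolding fg_map_def by blast
qed

definition pi1_injective ::
    "('v, 'e) scwol \<Rightarrow> ('v, 'e, 'g) cog \<Rightarrow> ('w, 'd) scwol \<Rightarrow> ('w, 'd, 'k) cog \<Rightarrow>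
     ('v, 'e, 'g, 'w, 'd, 'k) cog_mor \<Rightarrow> 'v \<Rightarrow> bool" where
  "pi1_injective Y H X G \<phi> \<sigma> \<longleftrightarrow> inj_on (fg_map X G \<phi>) (carrier (pi1 Y H \<sigma>))"


section \<open>Developability\<close>

locale scwol_action = scwol X + verts: group_action H "verts X" av + edges: group_action H "edges X" ae
  for H :: "'h monoid" and X :: "('w, 'd) scwol"
    and av :: "'h \<Rightarrow> 'w \<Rightarrow> 'w" and ae :: "'h \<Rightarrow> 'd \<Rightarrow> 'd" +
  assumes functorial: "g \<in> carrier H \<Longrightarrow> scwol_functor X X (av g) (ae g)"
    and no_inversion: "g \<in> carrier H \<Longrightarrow> a \<in> edges X \<Longrightarrow> av g (src X a) \<noteq> tgt X a"
    and fixes_edge: "g \<in> carrier H \<Longrightarrow> a \<in> edges X \<Longrightarrow> av g (src X a) = src X a \<Longrightarrow> ae g a = a"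

text \<open>
  Since the action respects src and tgt, the image of an orbit of edges is an orbit of vertices.
  The composites of composable representatives of two orbits of edges form a single orbit.
\<close>

definition quotient_scwol ::
    "'h monoid \<Rightarrow> ('w, 'd) scwol \<Rightarrow> ('h \<Rightarrow> 'w \<Rightarrow> 'w) \<Rightarrow> ('h \<Rightarrow> 'd \<Rightarrow> 'd) \<Rightarrow>
     ('w set, 'd set) scwol" where
  "quotient_scwol H X av ae =
     \<lparr>verts = orbits H (verts X) av,
      edges = orbits H (edges X) ae,
      src = image (src X),
      tgt = image (tgt X),
      cmp = (\<lambda>A B. {cmp X a b | a b. a \<in> A \<and> b \<in> B \<and> composable X a b})\<rparr>"

definition lift_choice ::
    "'h monoid \<Rightarrow> ('w, 'd) scwol \<Rightarrow> ('h \<Rightarrow> 'w \<Rightarrow> 'w) \<Rightarrow> ('h \<Rightarrow> 'd \<Rightarrow> 'd) \<Rightarrow>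
     ('w set \<Rightarrow> 'w) \<Rightarrow> ('d set \<Rightarrow> 'd) \<Rightarrow> ('d set \<Rightarrow> 'h) \<Rightarrow> bool" where
  "lift_choice H X av ae vlift elift h \<longleftrightarrow>
     (let Q = quotient_scwol H X av ae in
       (\<forall>\<sigma>\<in>verts Q. vlift \<sigma> \<in> \<sigma>) \<and>
       (\<forall>a\<in>edges Q. elift a \<in> a \<and> src X (elift a) = vlift (src Q a) \<and>
          h a \<in> carrier H \<and> av (h a) (tgt X (elift a)) = vlift (tgt Q a)))"

definition associated_cog ::
    "'h monoid \<Rightarrow> ('w, 'd) scwol \<Rightarrow> ('h \<Rightarrow> 'w \<Rightarrow> 'w) \<Rightarrow> ('h \<Rightarrow> 'd \<Rightarrow> 'd) \<Rightarrow>
     ('w set \<Rightarrow> 'w) \<Rightarrow> ('d set \<Rightarrow> 'h) \<Rightarrow> ('w set, 'd set, 'h) cog" where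
  "associated_cog H X av ae vlift h =
     \<lparr>lgrp = (\<lambda>\<sigma>. H\<lparr>carrier := stabilizer H av (vlift \<sigma>)\<rparr>),
      psi = (\<lambda>a. Ad H (h a)),
      twist = (\<lambda>a b. h a \<otimes>\<^bsub>H\<^esub> h b \<otimes>\<^bsub>H\<^esub> inv\<^bsub>H\<^esub> (h (cmp (quotient_scwol H X av ae) a b)))\<rparr>"

context scwol_action
begin

interpretation H: group H by (rule group_hom.axioms(1)[OF verts.group_hom])

lemma act_in: "g \<in> carrier H \<Longrightarrow> v \<in> verts X \<Longrightarrow> av g v \<in> verts X"
    "g \<in> carrier H \<Longrightarrow> a \<in> edges X \<Longrightarrow> ae g a \<in> edges X"
  by (simp_all add: verts.element_image edges.element_image)

lemma act_src: "g \<in> carrier H \<Longrightarrow> a \<in> edges X \<Longrightarrow> src X (ae g a) = av g (src X a)"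
  and act_tgt: "g \<in> carrier H \<Longrightarrow> a \<in> edges X \<Longrightarrow> tgt X (ae g a) = av g (tgt X a)"
  and act_cmp: "g \<in> carrier H \<Longrightarrow> composable X a b \<Longrightarrow> ae g (cmp X a b) = cmp X (ae g a) (ae g b)"
  using functorial by (auto simp: scwol_functor_def)

lemma act_composable: "g \<in> carrier H \<Longrightarrow> composable X a b \<Longrightarrow> composable X (ae g a) (ae g b)"
  by (simp add: composable_def act_in act_src act_tgt)

abbreviation "Q \<equiv> quotient_scwol H X av ae"

lemma src_orbit: "a \<in> edges X \<Longrightarrow> src X ` orbit H ae a = orbit H av (src X a)"
  and tgt_orbit: "a \<in> edges X \<Longrightarrow> tgt X ` orbit H ae a = orbit H av (tgt X a)"
  by (force simp: orbit_def act_src act_tgt)+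

lemma orbit_self: "v \<in> verts X \<Longrightarrow> v \<in> orbit H av v" "a \<in> edges X \<Longrightarrow> a \<in> orbit H ae a"
  using verts.orbit_refl edges.orbit_refl by auto

lemma orbit_act:
  assumes "g \<in> carrier H" "a \<in> edges X" shows "orbit H ae (ae g a) = orbit H ae a"
proof -
  have "ae g a \<in> orbit H ae a" using assms by (auto simp: orbit_def)
  then show ?thesis
    using edges.disjoint_union[of "orbit H ae (ae g a)" "orbit H ae a"] assms orbit_self(2)[of "ae g a"] act_in(2)[of g a]
    by (auto simp: orbits_def)
qed

lemma Q_composableE:
  assumes "composable Q A B"
  obtains a b where "composable X a b" "A = orbit H ae a" "B = orbit H ae b"
proof -
  from assms obtain a b where ab: "a \<in> edges X" "A = orbit H ae a" "b \<in> edges X" "B = orbit H ae b"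
    "src X ` A = tgt X ` B"
    by (auto simp: composable_def quotient_scwol_def orbits_def)
  then have "src X a \<in> tgt X ` B" using orbit_self(2)[of a] by blast
  then obtain b' where b': "b' \<in> B" "src X a = tgt X b'" by blast
  then obtain g where g: "g \<in> carrier H" "b' = ae g b" using ab by (auto simp: orbit_def)
  show thesis using that[of a b'] ab b' g orbit_act[of g b] act_in by (auto simp: composable_def)
qed

lemma Q_composable: "composable X a b \<Longrightarrow> composable Q (orbit H ae a) (orbit H ae b)"
  by (auto simp: composable_def quotient_scwol_def orbits_def src_orbit tgt_orbit)

lemma Q_cmp:
  assumes "composable X a b"
  shows "cmp Q (orbit H ae a) (orbit H ae b) = orbit H ae (cmp X a b)"
proof -
  have E: "a \<in> edges X" "b \<in> edges X" "src X a = tgt X b" using assms by (auto simp: composable_def)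
  have "cmp X a' b' \<in> orbit H ae (cmp X a b)"
    if ab': "a' \<in> orbit H ae a" "b' \<in> orbit H ae b" "composable X a' b'" for a' b'
  proof -
    from ab' obtain g k where g: "g \<in> carrier H" "a' = ae g a" and k: "k \<in> carrier H" "b' = ae k b" by (auto simp: orbit_def)
    have "av g (src X a) = av k (src X a)"
      using ab'(3) g k E by (simp add: composable_def act_src act_tgt)
    moreover have "av (inv\<^bsub>H\<^esub> k \<otimes>\<^bsub>H\<^esub> g) (src X a) = av (inv\<^bsub>H\<^esub> k) (av g (src X a))"
      using verts.composition_rule[of "src X a" "inv\<^bsub>H\<^esub> k" g] g k E src_in[of a] by simp
    moreover have "av (inv\<^bsub>H\<^esub> k) (av k (src X a)) = src X a"
      using verts.orbit_sym_aux[of k "src X a"] k E src_in[of a] by simp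
    ultimately have "ae (inv\<^bsub>H\<^esub> k \<otimes>\<^bsub>H\<^esub> g) a = a" using fixes_edge[of "inv\<^bsub>H\<^esub> k \<otimes>\<^bsub>H\<^esub> g" a] g k E by simp
    then have "ae k a = ae (k \<otimes>\<^bsub>H\<^esub> (inv\<^bsub>H\<^esub> k \<otimes>\<^bsub>H\<^esub> g)) a"
      using edges.composition_rule[of a k "inv\<^bsub>H\<^esub> k \<otimes>\<^bsub>H\<^esub> g"] g k E by simp
    then have "a' = ae k a" using g k by (simp add: H.m_assoc[symmetric])
    then have "cmp X a' b' = ae k (cmp X a b)" using act_cmp[OF k(1) assms] k by simp
    then show ?thesis using k by (auto simp: orbit_def)
  qed
  moreover have "\<exists>a' b'. x = cmp X a' b' \<and> a' \<in> orbit H ae a \<and> b' \<in> orbit H ae b \<and> composable X a' b'"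
    if x: "x \<in> orbit H ae (cmp X a b)" for x
  proof -
    obtain g where g: "g \<in> carrier H" "x = ae g (cmp X a b)" using x by (auto simp: orbit_def)
    then show ?thesis using act_cmp[OF g(1) assms] act_composable[OF g(1) assms]
      by (intro exI[of _ "ae g a"] exI[of _ "ae g b"]) (auto simp: orbit_def)
  qed
  ultimately have "{cmp X a' b' | a' b'. a' \<in> orbit H ae a \<and> b' \<in> orbit H ae b \<and> composable X a' b'}
      = orbit H ae (cmp X a b)" by blast
  then show ?thesis by (simp add: quotient_scwol_def)
qed

lemma scwol_quotient_scwol: "scwol Q"
proof (rule scwol.intro, goal_cases)
  case (1 A)
  then obtain a where a: "a \<in> edges X" "A = orbit H ae a" by (auto simp: quotient_scwol_def orbits_def)
  then have "src Q A = orbit H av (src X a)" by (simp add: quotient_scwol_def src_orbit)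
  then show ?case using src_in[OF a(1)] by (auto simp: quotient_scwol_def orbits_def)
next
  case (2 A)
  then obtain a where a: "a \<in> edges X" "A = orbit H ae a" by (auto simp: quotient_scwol_def orbits_def)
  then have "tgt Q A = orbit H av (tgt X a)" by (simp add: quotient_scwol_def tgt_orbit)
  then show ?case using tgt_in[OF a(1)] by (auto simp: quotient_scwol_def orbits_def)
next
  case (3 A B) then obtain a b where ab: "composable X a b" "A = orbit H ae a" "B = orbit H ae b" by (rule Q_composableE)
  with cmp_in[OF ab(1)] show ?case
    by (simp only: Q_cmp) (auto simp: quotient_scwol_def orbits_def)
next
  case (4 A B) then obtain a b where ab: "composable X a b" "A = orbit H ae a" "B = orbit H ae b" by (rule Q_composableE)
  then have "a \<in> edges X" "b \<in> edges X" by (auto simp: composable_def)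
  with ab show ?case by (simp add: Q_cmp) (simp add: quotient_scwol_def src_orbit cmp_in src_cmp)
next
  case (5 A B) then obtain a b where ab: "composable X a b" "A = orbit H ae a" "B = orbit H ae b" by (rule Q_composableE)
  then have "a \<in> edges X" "b \<in> edges X" by (auto simp: composable_def)
  with ab show ?case by (simp add: Q_cmp) (simp add: quotient_scwol_def tgt_orbit cmp_in tgt_cmp)
next
  case (6 A B C)
  obtain a b where ab: "composable X a b" "A = orbit H ae a" "B = orbit H ae b" using 6(1) by (rule Q_composableE)
  obtain b' c where bc: "composable X b' c" "B = orbit H ae b'" "C = orbit H ae c" using 6(2) by (rule Q_composableE)
  have E: "b \<in> edges X" "b' \<in> edges X" "c \<in> edges X" using ab bc by (auto simp: composable_def)
  have "b \<in> orbit H ae b'" using ab bc E orbit_self(2) by blast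
  then obtain g where g: "g \<in> carrier H" "b = ae g b'" by (auto simp: orbit_def)
  have c: "composable X b (ae g c)" "C = orbit H ae (ae g c)" using act_composable[OF g(1) bc(1)] g E bc orbit_act by auto
  have "composable X a (cmp X b (ae g c))" "composable X (cmp X a b) (ae g c)"
    using ab(1) c(1) cmp_in tgt_cmp src_cmp by (auto simp: composable_def)
  then show ?case unfolding ab(2,3) c(2) using ab(1) c(1) by (simp add: Q_cmp[unfolded ab(2,3)] Q_cmp cmp_assoc)
next
  case (7 A)
  then obtain a where a: "a \<in> edges X" "A = orbit H ae a" by (auto simp: quotient_scwol_def orbits_def)
  have "tgt X a \<in> orbit H av (tgt X a)" using a tgt_in orbit_self by blast
  moreover have "tgt X a \<notin> orbit H av (src X a)" using no_inversion[OF _ a(1)] by (fastforce simp: orbit_def)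
  ultimately show ?case using a by (auto simp: quotient_scwol_def src_orbit tgt_orbit)
qed

lemma lift_unique:
  assumes "a \<in> edges X" "b \<in> orbit H ae a" "src X b = src X a" shows "b = a"
  using assms fixes_edge by (auto simp: orbit_def act_src)

lemma complex_of_groups_associated_cog:
  assumes "lift_choice H X av ae vlift elift h"
  shows "complex_of_groups Q (associated_cog H X av ae vlift h)"
proof -
  interpret Q: scwol Q by (rule scwol_quotient_scwol)
  have vl: "vlift \<sigma> \<in> \<sigma>" if "\<sigma> \<in> verts Q" for \<sigma> using assms that by (simp add: lift_choice_def Let_def)
  have vV: "vlift \<sigma> \<in> verts X" if "\<sigma> \<in> verts Q" for \<sigma>
    using vl[OF that] that by (auto simp: quotient_scwol_def orbits_def orbit_def act_in)
  have el: "elift A \<in> A" "src X (elift A) = vlift (src Q A)" "h A \<in> carrier H" "av (h A) (tgt X (elift A)) = vlift (tgt Q A)"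
     if "A \<in> edges Q" for A using assms that by (simp_all add: lift_choice_def Let_def)
  have eE: "elift A \<in> edges X" "A = orbit H ae (elift A)" if A: "A \<in> edges Q" for A
  proof -
    obtain a where a: "a \<in> edges X" "A = orbit H ae a" using A by (auto simp: quotient_scwol_def orbits_def)
    then obtain g where "g \<in> carrier H" "elift A = ae g a" using el(1)[OF A] by (auto simp: orbit_def)
    with a show "elift A \<in> edges X" "A = orbit H ae (elift A)" using act_in orbit_act by auto
  qed
  let ?S = "\<lambda>\<sigma>. stabilizer H av (vlift \<sigma>)"
  have sub: "subgroup (?S \<sigma>) H" if "\<sigma> \<in> verts Q" for \<sigma> using verts.stabilizer_subgroup vV[OF that] by blast
  have SH: "g \<in> carrier H" if "g \<in> ?S \<sigma>" for g \<sigma> using that by (simp add: stabilizer_def)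
  have sel: "lgrp (associated_cog H X av ae vlift h) = (\<lambda>\<sigma>. H\<lparr>carrier := ?S \<sigma>\<rparr>)"
    "psi (associated_cog H X av ae vlift h) = (\<lambda>A. Ad H (h A))"
    "twist (associated_cog H X av ae vlift h) = (\<lambda>A B. h A \<otimes>\<^bsub>H\<^esub> h B \<otimes>\<^bsub>H\<^esub> inv\<^bsub>H\<^esub> (h (cmp Q A B)))"
    by (simp_all add: associated_cog_def)
  have Adin: "Ad H (h A) g \<in> ?S (tgt Q A)" if A: "A \<in> edges Q" and g: "g \<in> ?S (src Q A)" for A g
  proof -
    have "av g (src X (elift A)) = src X (elift A)" using g el(2)[OF A] by (simp add: stabilizer_def)
    then have "ae g (elift A) = elift A" using fixes_edge SH[OF g] eE(1)[OF A] by blast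
    then have t: "av g (tgt X (elift A)) = tgt X (elift A)" using act_tgt SH[OF g] eE(1)[OF A] by metis
    have T: "tgt X (elift A) \<in> verts X" using eE[OF A] tgt_in by blast
    have i: "av (inv\<^bsub>H\<^esub> h A) (vlift (tgt Q A)) = tgt X (elift A)"
      using verts.orbit_sym_aux[OF el(3)[OF A] T] el(4)[OF A] by simp
    have V: "vlift (tgt Q A) \<in> verts X" using vV Q.tgt_in A by blast
    have "av (h A \<otimes>\<^bsub>H\<^esub> g \<otimes>\<^bsub>H\<^esub> inv\<^bsub>H\<^esub> h A) (vlift (tgt Q A)) = av (h A) (av g (av (inv\<^bsub>H\<^esub> h A) (vlift (tgt Q A))))"
      using verts.composition_rule V T el(3)[OF A] SH[OF g] i by simp
    then show ?thesis using i t el(3,4)[OF A] SH[OF g] by (simp add: Ad_def stabilizer_def)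
  qed
  have tw: "h A \<otimes>\<^bsub>H\<^esub> h B \<otimes>\<^bsub>H\<^esub> inv\<^bsub>H\<^esub> (h (cmp Q A B)) \<in> ?S (tgt Q A)" if AB: "composable Q A B" for A B
  proof -
    have A: "A \<in> edges Q" and B: "B \<in> edges Q" and ST: "src Q A = tgt Q B" using AB by (auto simp: composable_def)
    have C: "cmp Q A B \<in> edges Q" using Q.cmp_in AB by blast
    let ?a = "elift A" and ?b = "elift B" and ?c = "elift (cmp Q A B)"
    let ?a' = "ae (inv\<^bsub>H\<^esub> h B) ?a"
    have T: "tgt X ?b \<in> verts X" "tgt X ?a \<in> verts X" using eE A B tgt_in by blast+
    have "src X ?a' = tgt X ?b" using act_src[of "inv\<^bsub>H\<^esub> h B" ?a] el(2)[OF A] el(3,4)[OF B] ST eE[OF A]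
       verts.orbit_sym_aux[OF el(3)[OF B] T(1)] by simp
    then have co: "composable X ?a' ?b" using eE[OF A] eE[OF B] el(3)[OF B] act_in by (simp add: composable_def)
    have "orbit H ae ?a' = A" using orbit_act[of "inv\<^bsub>H\<^esub> h B" ?a] eE[OF A] el(3)[OF B] by simp
    then have "cmp Q A B = orbit H ae (cmp X ?a' ?b)" using Q_cmp[OF co] eE(2)[OF B] by simp
    then have "?c \<in> orbit H ae (cmp X ?a' ?b)" using el(1)[OF C] by simp
    moreover have "src X ?c = src X (cmp X ?a' ?b)" using el(2)[OF C] el(2)[OF B] src_cmp[OF co] Q.src_cmp[OF AB] by simp
    ultimately have c: "?c = cmp X ?a' ?b" using lift_unique cmp_in[OF co] by blast
    have tc: "tgt X ?c = av (inv\<^bsub>H\<^esub> h B) (tgt X ?a)" using c tgt_cmp[OF co] act_tgt eE[OF A] el(3)[OF B] by simp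
    have V: "vlift (tgt Q A) \<in> verts X" using vV Q.tgt_in A by blast
    have hc: "av (inv\<^bsub>H\<^esub> h (cmp Q A B)) (vlift (tgt Q A)) = tgt X ?c"
      using verts.orbit_sym_aux[OF el(3)[OF C], of "tgt X ?c"] el(4)[OF C] tgt_in eE[OF C] Q.tgt_cmp[OF AB] by simp
    have TC: "tgt X ?c \<in> verts X" using eE[OF C] tgt_in by blast
    have "av (h B) (tgt X ?c) = tgt X ?a"
      using verts.orbit_sym_aux[of "inv\<^bsub>H\<^esub> h B" "tgt X ?a"] T el(3)[OF B] tc by simp
    moreover have "av (h A \<otimes>\<^bsub>H\<^esub> h B \<otimes>\<^bsub>H\<^esub> inv\<^bsub>H\<^esub> (h (cmp Q A B))) (vlift (tgt Q A))
       = av (h A) (av (h B) (av (inv\<^bsub>H\<^esub> (h (cmp Q A B))) (vlift (tgt Q A))))"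
      using verts.composition_rule V TC el(3)[OF A] el(3)[OF B] el(3)[OF C] hc by simp
    ultimately show ?thesis using el(3,4)[OF A] el(3)[OF B] el(3)[OF C] hc by (simp add: stabilizer_def)
  qed
  have invS: "inv\<^bsub>H\<lparr>carrier := ?S \<sigma>\<rparr>\<^esub> x = inv\<^bsub>H\<^esub> x" if "\<sigma> \<in> verts Q" "x \<in> ?S \<sigma>" for \<sigma> x
    using H.m_inv_consistent[OF sub[OF that(1)] that(2)] by simp
  have c1: "inv\<^bsub>H\<^esub> x \<otimes>\<^bsub>H\<^esub> (x \<otimes>\<^bsub>H\<^esub> y) = y" "x \<otimes>\<^bsub>H\<^esub> (inv\<^bsub>H\<^esub> x \<otimes>\<^bsub>H\<^esub> y) = y"
    if "x \<in> carrier H" "y \<in> carrier H" for x y using that by (simp_all add: H.m_assoc[symmetric])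
  show ?thesis
  proof (intro complex_of_groups.intro complex_of_groups_axioms.intro scwol_quotient_scwol, unfold sel, goal_cases)
    case (1 \<sigma>) then show ?case using subgroup.subgroup_is_group[OF sub H.group_axioms] by blast
  next
    case (2 A)
    then have "Ad H (h A) (x \<otimes>\<^bsub>H\<^esub> y) = Ad H (h A) x \<otimes>\<^bsub>H\<^esub> Ad H (h A) y"
      if "x \<in> carrier H" "y \<in> carrier H" for x y using that el(3)[OF 2] by (simp add: Ad_def H.m_assoc c1)
    then show ?case using Adin[OF 2] SH by (auto simp: hom_def)
  next
    case (3 A) then show ?case using el(3)[OF 3] SH by (auto simp: inj_on_def Ad_def)
  next
    case (4 A B) then show ?case using tw by simp
  next
    case (5 A B g)
    then have A: "A \<in> edges Q" and B: "B \<in> edges Q" and C: "cmp Q A B \<in> edges Q"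
      using Q.cmp_in by (auto simp: composable_def)
    have "g \<in> carrier H" using 5 SH by auto
    then show ?case unfolding Ad_def[of "H\<lparr>carrier := _\<rparr>"] invS[OF Q.tgt_in[OF A] tw[OF 5(1)]]
      using el(3)[OF A] el(3)[OF B] el(3)[OF C] by (simp add: Ad_def H.m_assoc H.inv_mult_group c1)
  next
    case (6 A B C)
    then have E: "A \<in> edges Q" "B \<in> edges Q" "C \<in> edges Q" "cmp Q A B \<in> edges Q" "cmp Q B C \<in> edges Q"
      using Q.cmp_in by (auto simp: composable_def)
    have "composable Q A (cmp Q B C)" using 6 E Q.tgt_cmp[OF 6(2)] by (simp add: composable_def)
    then have D: "cmp Q A (cmp Q B C) \<in> edges Q" by (rule Q.cmp_in)
    show ?case using E[THEN el(3)] D[THEN el(3)] Q.cmp_assoc[OF 6] by (simp add: Ad_def H.m_assoc H.inv_mult_group c1)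
  qed
qed

end

text \<open>
  A formula cannot quantify over the types of the elements of the acting group and of the simply
  connected scwol; here they are arguments, passed as one element of an itself type.
\<close>

definition developable_over ::
    "('h \<times> 'w \<times> 'd) itself \<Rightarrow> ('v, 'e) scwol \<Rightarrow> ('v, 'e, 'g) cog \<Rightarrow> bool" where
  "developable_over T Y G \<longleftrightarrow>
     (\<exists>(H :: 'h monoid) (X :: ('w, 'd) scwol) av ae vlift elift h \<phi>.
        simply_connected_scwol X \<and> scwol_action H X av ae \<and>
        lift_choice H X av ae vlift elift h \<and>
        cog_isomorphism Y G (quotient_scwol H X av ae) (associated_cog H X av ae vlift h) \<phi>)"

text \<open>
  If Y is connected and G is developable over some types, then the acting group is isomorphic to
  \<open>\<pi>\<^sub>1(G(Y))\<close>, a subgroup of FG, and the vertices (edges) over a given vertex (edge) of Y correspond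
  to the cosets of a subgroup; hence the following types are large enough for any development.
\<close>

definition developable :: "('v, 'e) scwol \<Rightarrow> ('v, 'e, 'g) cog \<Rightarrow> bool" where
  "developable Y G \<longleftrightarrow>
     developable_over
       TYPE(('v, 'e, 'g) fg \<times> (('v, 'e, 'g) fg set \<times> 'v) \<times> (('v, 'e, 'g) fg set \<times> 'e)) Y G"


section \<open>The local complexes of groups\<close>

text \<open>
  In the scwol \<open>\<Y>(\<gamma>)\<close>, Upper c and Lower b are the objects c and b of the upper and lower link,
  UpperE c d = (c, d), ToCone c = \<open>\<gamma> * c\<close>, Join b c = \<open>b * c\<close>, FromCone b = \<open>b * \<gamma>\<close> and
  LowerE a b = (a, b).
\<close>

datatype 'e local_vert = Upper 'e | Cone | Lower 'e

datatype 'e local_edge =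
  UpperE 'e 'e | ToCone 'e | Join 'e 'e | FromCone 'e | LowerE 'e 'e

fun local_src :: "('v, 'e) scwol \<Rightarrow> 'e local_edge \<Rightarrow> 'e local_vert" where
  "local_src Y (UpperE c d) = Upper (cmp Y c d)"
| "local_src Y (ToCone c) = Upper c"
| "local_src Y (Join b c) = Upper c"
| "local_src Y (FromCone b) = Cone"
| "local_src Y (LowerE a b) = Lower b"

fun local_tgt :: "('v, 'e) scwol \<Rightarrow> 'e local_edge \<Rightarrow> 'e local_vert" where
  "local_tgt Y (UpperE c d) = Upper c"
| "local_tgt Y (ToCone c) = Cone"
| "local_tgt Y (Join b c) = Lower b"
| "local_tgt Y (FromCone b) = Lower b"
| "local_tgt Y (LowerE a b) = Lower (cmp Y a b)"

fun local_cmp :: "('v, 'e) scwol \<Rightarrow> 'e local_edge \<Rightarrow> 'e local_edge \<Rightarrow> 'e local_edge" where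
  "local_cmp Y (UpperE c d) (UpperE c' d') = UpperE c (cmp Y d d')"
| "local_cmp Y (ToCone c) (UpperE c' d) = ToCone (cmp Y c d)"
| "local_cmp Y (Join b c) (UpperE c' d) = Join b (cmp Y c d)"
| "local_cmp Y (LowerE a b) (Join b' c) = Join (cmp Y a b) c"
| "local_cmp Y (FromCone b) (ToCone c) = Join b c"
| "local_cmp Y (LowerE a b) (FromCone b') = FromCone (cmp Y a b)"
| "local_cmp Y (LowerE a' b') (LowerE a b) = LowerE (cmp Y a' a) b"
| "local_cmp Y _ _ = undefined"

definition local_scwol :: "('v, 'e) scwol \<Rightarrow> 'v \<Rightarrow> ('e local_vert, 'e local_edge) scwol" where
  "local_scwol Y \<gamma> =
     \<lparr>verts = Upper ` {c \<in> edges Y. tgt Y c = \<gamma>} \<union> {Cone} \<union> Lower ` {b \<in> edges Y. src Y b = \<gamma>},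
      edges = {UpperE c d | c d. composable Y c d \<and> tgt Y c = \<gamma>}
        \<union> ToCone ` {c \<in> edges Y. tgt Y c = \<gamma>}
        \<union> {Join b c | b c. b \<in> edges Y \<and> src Y b = \<gamma> \<and> c \<in> edges Y \<and> tgt Y c = \<gamma>}
        \<union> FromCone ` {b \<in> edges Y. src Y b = \<gamma>}
        \<union> {LowerE a b | a b. composable Y a b \<and> src Y b = \<gamma>},
      src = local_src Y,
      tgt = local_tgt Y,
      cmp = local_cmp Y\<rparr>"

lemma local_scwol_simps [simp]:
  "Upper c \<in> verts (local_scwol Y \<gamma>) \<longleftrightarrow> c \<in> edges Y \<and> tgt Y c = \<gamma>"
  "Cone \<in> verts (local_scwol Y \<gamma>)"
  "Lower b \<in> verts (local_scwol Y \<gamma>) \<longleftrightarrow> b \<in> edges Y \<and> src Y b = \<gamma>"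
  "UpperE c d \<in> edges (local_scwol Y \<gamma>) \<longleftrightarrow>
     c \<in> edges Y \<and> d \<in> edges Y \<and> src Y c = tgt Y d \<and> tgt Y c = \<gamma>"
  "ToCone c \<in> edges (local_scwol Y \<gamma>) \<longleftrightarrow> c \<in> edges Y \<and> tgt Y c = \<gamma>"
  "Join b c \<in> edges (local_scwol Y \<gamma>) \<longleftrightarrow>
     b \<in> edges Y \<and> src Y b = \<gamma> \<and> c \<in> edges Y \<and> tgt Y c = \<gamma>"
  "FromCone b \<in> edges (local_scwol Y \<gamma>) \<longleftrightarrow> b \<in> edges Y \<and> src Y b = \<gamma>"
  "LowerE a b \<in> edges (local_scwol Y \<gamma>) \<longleftrightarrow>
     a \<in> edges Y \<and> b \<in> edges Y \<and> src Y a = tgt Y b \<and> src Y b = \<gamma>"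
  "src (local_scwol Y \<gamma>) = local_src Y"
  "tgt (local_scwol Y \<gamma>) = local_tgt Y"
  "cmp (local_scwol Y \<gamma>) = local_cmp Y"
  by (auto simp: local_scwol_def composable_def)

lemma scwol_local_scwol:
  assumes "scwol Y"
  shows "scwol (local_scwol Y \<gamma>)"
proof -
  interpret scwol Y by fact
  note [simp] = composable_def src_in tgt_in cmp_in src_cmp tgt_cmp cmp_assoc
  have ne: "cmp Y a b \<noteq> a" "cmp Y a b \<noteq> b"
    if "a \<in> edges Y" "b \<in> edges Y" "src Y a = tgt Y b" for a b
    using that by (metis composable_def no_loops src_cmp tgt_cmp)+
  show ?thesis
  proof (unfold_locales, goal_cases)
    case (1 a) then show ?case by (cases a) auto
  next
    case (2 a) then show ?case by (cases a) auto
  next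
    case (3 a b) then show ?case by (cases a; cases b) auto
  next
    case (4 a b) then show ?case by (cases a; cases b) auto
  next
    case (5 a b) then show ?case by (cases a; cases b) auto
  next
    case (6 a b c) then show ?case by (cases a; cases b; cases c) auto
  next
    case (7 a) then show ?case by (cases a) (auto simp: ne ne[symmetric])
  qed
qed

fun local_grp :: "('v, 'e) scwol \<Rightarrow> ('v, 'e, 'g) cog \<Rightarrow> 'v \<Rightarrow> 'e local_vert \<Rightarrow> 'g monoid" where
  "local_grp Y G \<gamma> (Upper c) = lgrp G (src Y c)"
| "local_grp Y G \<gamma> Cone = lgrp G \<gamma>"
| "local_grp Y G \<gamma> (Lower b) = lgrp G \<gamma>"

fun local_psi :: "('v, 'e, 'g) cog \<Rightarrow> 'e local_edge \<Rightarrow> 'g \<Rightarrow> 'g" where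
  "local_psi G (UpperE c d) = psi G d"
| "local_psi G (ToCone c) = psi G c"
| "local_psi G (Join b c) = psi G c"
| "local_psi G (FromCone b) = id"
| "local_psi G (LowerE a b) = id"

fun local_twist :: "('v, 'e, 'g) cog \<Rightarrow> 'v \<Rightarrow> 'e local_edge \<Rightarrow> 'e local_edge \<Rightarrow> 'g" where
  "local_twist G \<gamma> (UpperE c d) (UpperE c' d') = twist G d d'"
| "local_twist G \<gamma> (ToCone c) (UpperE c' d) = twist G c d"
| "local_twist G \<gamma> (Join b c) (UpperE c' d) = twist G c d"
| "local_twist G \<gamma> _ _ = \<one>\<^bsub>lgrp G \<gamma>\<^esub>"

definition local_cog ::
    "('v, 'e) scwol \<Rightarrow> ('v, 'e, 'g) cog \<Rightarrow> 'v \<Rightarrow> ('e local_vert, 'e local_edge, 'g) cog" where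
  "local_cog Y G \<gamma> =
     \<lparr>lgrp = local_grp Y G \<gamma>, psi = local_psi G, twist = local_twist G \<gamma>\<rparr>"

lemma complex_of_groups_local_cog:
  assumes "complex_of_groups Y G" "\<gamma> \<in> verts Y"
  shows "complex_of_groups (local_scwol Y \<gamma>) (local_cog Y G \<gamma>)"
proof -
  interpret complex_of_groups Y G by fact
  interpret L: scwol "local_scwol Y \<gamma>" using scwol_local_scwol scwol_axioms .
  note [simp] = composable_def src_in tgt_in cmp_in src_cmp tgt_cmp cmp_assoc assms(2)
  have gr [simp]: "v \<in> verts Y \<Longrightarrow> group (lgrp G v)" for v by (rule lgrp_group)
  have mo [simp]: "v \<in> verts Y \<Longrightarrow> Group.monoid (lgrp G v)" for v using gr by (rule group.is_monoid)
  have psic [simp]: "a \<in> edges Y \<Longrightarrow> g \<in> carrier (lgrp G (src Y a)) \<Longrightarrow> psi G a g \<in> carrier (lgrp G (tgt Y a))" for a g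
    using psi_hom hom_in_carrier[OF psi_hom] by (meson | metis)
  have psi1 [simp]: "a \<in> edges Y \<Longrightarrow> psi G a (\<one>\<^bsub>lgrp G (src Y a)\<^esub>) = \<one>\<^bsub>lgrp G (tgt Y a)\<^esub>" for a
    using hom_one[OF psi_hom] by simp
  note [simp] = psi_hom psi_inj twist_in monoid.l_one monoid.r_one group.Ad_one monoid.one_closed
  have tw: "composable Y a b \<Longrightarrow> v = src Y b \<Longrightarrow> w = tgt Y a \<Longrightarrow> g \<in> carrier (lgrp G v) \<Longrightarrow>
     Ad (lgrp G w) (twist G a b) (psi G (cmp Y a b) g) = psi G a (psi G b g)" for a b v w g
     using Ad_twist by blast
  have co: "composable Y a b \<Longrightarrow> composable Y b c \<Longrightarrow> w = tgt Y a \<Longrightarrow>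
          psi G a (twist G b c) \<otimes>\<^bsub>lgrp G w\<^esub> twist G a (cmp Y b c)
          = twist G a b \<otimes>\<^bsub>lgrp G w\<^esub> twist G (cmp Y a b) c" for a b c w
     using cocycle by blast
  have sel: "lgrp (local_cog Y G \<gamma>) = local_grp Y G \<gamma>" "psi (local_cog Y G \<gamma>) = local_psi G"
    "twist (local_cog Y G \<gamma>) = local_twist G \<gamma>" by (simp_all add: local_cog_def)
  have tw' [simp]: "composable Y a b \<Longrightarrow> v = tgt Y a \<Longrightarrow> twist G a b \<in> carrier (lgrp G v)" for a b v
    using twist_in by blast
  have psi1' [simp]: "a \<in> edges Y \<Longrightarrow> src Y a = v \<Longrightarrow> psi G a (\<one>\<^bsub>lgrp G v\<^esub>) = \<one>\<^bsub>lgrp G (tgt Y a)\<^esub>" for a v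
    using psi1 by auto
  have psic' [simp]: "a \<in> edges Y \<Longrightarrow> src Y a = v \<Longrightarrow> g \<in> carrier (lgrp G v) \<Longrightarrow> w = tgt Y a \<Longrightarrow> psi G a g \<in> carrier (lgrp G w)" for a g v w
    using psic by auto
  have h: "a \<in> edges Y \<Longrightarrow> src Y a = v \<Longrightarrow> tgt Y a = w \<Longrightarrow> psi G a \<in> hom (lgrp G v) (lgrp G w)" for a v w
    using psi_hom by blast
  have i: "a \<in> edges Y \<Longrightarrow> src Y a = v \<Longrightarrow> inj_on (psi G a) (carrier (lgrp G v))" for a v
    using psi_inj by blast
  have idh: "id \<in> hom (lgrp G \<gamma>) (lgrp G \<gamma>)" by (simp add: hom_def)
  show ?thesis
  proof (intro complex_of_groups.intro complex_of_groups_axioms.intro, goal_cases)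
    case 1 show ?case by (rule L.scwol_axioms)
  next
    case (2 a) then show ?case by (cases a) (auto simp: sel)
  next
    case (3 a) then show ?case by (cases a) (auto simp: sel h idh)
  next
    case (4 a) then show ?case by (cases a) (auto simp: sel i)
  next
    case (5 a b) then show ?case by (cases a; cases b) (auto simp: sel)
  next
    case (6 a b g) then show ?case by (cases a; cases b) (auto simp: sel tw)
  next
    case (7 a b c) then show ?case
      by (cases a; cases b; cases c) (auto simp: sel co)
  qed
qed

fun Sigma_vert :: "('v, 'e) scwol \<Rightarrow> 'v \<Rightarrow> 'e local_vert \<Rightarrow> 'v" where
  "Sigma_vert Y \<gamma> (Upper c) = src Y c"
| "Sigma_vert Y \<gamma> Cone = \<gamma>"
| "Sigma_vert Y \<gamma> (Lower b) = tgt Y b"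

fun Sigma_edge :: "('v, 'e) scwol \<Rightarrow> 'e local_edge \<Rightarrow> 'e" where
  "Sigma_edge Y (UpperE c d) = d"
| "Sigma_edge Y (ToCone c) = c"
| "Sigma_edge Y (Join b c) = cmp Y b c"
| "Sigma_edge Y (FromCone b) = b"
| "Sigma_edge Y (LowerE a b) = a"

fun Sigma_loc :: "('v, 'e, 'g) cog \<Rightarrow> 'e local_vert \<Rightarrow> 'g \<Rightarrow> 'g" where
  "Sigma_loc G (Upper c) = id"
| "Sigma_loc G Cone = id"
| "Sigma_loc G (Lower b) = psi G b"

fun Sigma_elt :: "('v, 'e) scwol \<Rightarrow> ('v, 'e, 'g) cog \<Rightarrow> 'e local_edge \<Rightarrow> 'g" where
  "Sigma_elt Y G (UpperE c d) = \<one>\<^bsub>lgrp G (tgt Y d)\<^esub>"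
| "Sigma_elt Y G (ToCone c) = \<one>\<^bsub>lgrp G (tgt Y c)\<^esub>"
| "Sigma_elt Y G (Join b c) = twist G b c"
| "Sigma_elt Y G (FromCone b) = \<one>\<^bsub>lgrp G (tgt Y b)\<^esub>"
| "Sigma_elt Y G (LowerE a b) = inv\<^bsub>lgrp G (tgt Y a)\<^esub> (twist G a b)"

definition Sigma_mor :: "('v, 'e) scwol \<Rightarrow> ('v, 'e, 'g) cog \<Rightarrow> 'v \<Rightarrow>
    ('e local_vert, 'e local_edge, 'g, 'v, 'e, 'g) cog_mor" where
  "Sigma_mor Y G \<gamma> =
     \<lparr>on_vert = Sigma_vert Y \<gamma>, on_edge = Sigma_edge Y, loc = Sigma_loc G, elt = Sigma_elt Y G\<rparr>"

lemma inv_eq_of_mult_eq: fixes G (structure) assumes G: "group G" and "x \<in> carrier G" "y \<in> carrier G"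
 "x' \<in> carrier G" "y' \<in> carrier G" and e: "x \<otimes>\<^bsub>G\<^esub> y = x' \<otimes>\<^bsub>G\<^esub> y'"
 shows "inv\<^bsub>G\<^esub> y' = inv\<^bsub>G\<^esub> y \<otimes>\<^bsub>G\<^esub> inv\<^bsub>G\<^esub> x \<otimes>\<^bsub>G\<^esub> x'"
proof -
  interpret group G by fact
  have "inv y \<otimes> inv x = inv y' \<otimes> inv x'" using e assms inv_mult_group by metis
  then show ?thesis using assms by (simp add: m_assoc)
qed

lemma cog_morphism_Sigma_mor:
  assumes "complex_of_groups Y G" "\<gamma> \<in> verts Y"
  shows "cog_morphism (local_scwol Y \<gamma>) (local_cog Y G \<gamma>) Y G (Sigma_mor Y G \<gamma>)"
proof -
  interpret complex_of_groups Y G by fact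
  interpret L: scwol "local_scwol Y \<gamma>" using scwol_local_scwol scwol_axioms .
  note [simp] = composable_def src_in tgt_in cmp_in src_cmp tgt_cmp cmp_assoc assms(2)
  have gr [simp]: "v \<in> verts Y \<Longrightarrow> group (lgrp G v)" for v by (rule lgrp_group)
  have mo [simp]: "v \<in> verts Y \<Longrightarrow> Group.monoid (lgrp G v)" for v using gr by (rule group.is_monoid)
  have psic [simp]: "a \<in> edges Y \<Longrightarrow> src Y a = v \<Longrightarrow> g \<in> carrier (lgrp G v) \<Longrightarrow> psi G a g \<in> carrier (lgrp G (tgt Y a))" for a g v
    using psi_hom hom_in_carrier[OF psi_hom] by (meson | metis)
  have psi1 [simp]: "a \<in> edges Y \<Longrightarrow> src Y a = v \<Longrightarrow> psi G a (\<one>\<^bsub>lgrp G v\<^esub>) = \<one>\<^bsub>lgrp G (tgt Y a)\<^esub>" for a v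
    using hom_one[OF psi_hom] by auto
  have psiinv [simp]: "a \<in> edges Y \<Longrightarrow> src Y a = v \<Longrightarrow> g \<in> carrier (lgrp G v) \<Longrightarrow> psi G a (inv\<^bsub>lgrp G v\<^esub> g) = inv\<^bsub>lgrp G (tgt Y a)\<^esub> (psi G a g)" for a v g
    using psi_hom[of a] group_hom.hom_inv group_hom.intro group_hom_axioms.intro gr src_in tgt_in by metis
  have tw' [simp]: "composable Y a b \<Longrightarrow> v = tgt Y a \<Longrightarrow> twist G a b \<in> carrier (lgrp G v)" for a b v
    using twist_in by blast
  note [simp] = psi_hom psi_inj monoid.l_one monoid.r_one group.Ad_one monoid.one_closed group.inv_closed
  have tw: "composable Y a b \<Longrightarrow> v = src Y b \<Longrightarrow> w = tgt Y a \<Longrightarrow> g \<in> carrier (lgrp G v) \<Longrightarrow>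
     Ad (lgrp G w) (twist G a b) (psi G (cmp Y a b) g) = psi G a (psi G b g)" for a b v w g
     using Ad_twist by blast
  have tw2: "composable Y a b \<Longrightarrow> v = src Y b \<Longrightarrow> w = tgt Y a \<Longrightarrow> g \<in> carrier (lgrp G v) \<Longrightarrow>
     Ad (lgrp G w) (inv\<^bsub>lgrp G w\<^esub> (twist G a b)) (psi G a (psi G b g)) = psi G (cmp Y a b) g" for a b v w g
  proof -
    assume A: "composable Y a b" "v = src Y b" "w = tgt Y a" "g \<in> carrier (lgrp G v)"
    then interpret W: group "lgrp G w" by simp
    have "twist G a b \<in> carrier (lgrp G w)" "psi G (cmp Y a b) g \<in> carrier (lgrp G w)"
      using A psic[of "cmp Y a b" v g] by auto
    then show ?thesis unfolding tw[OF A, symmetric] by (simp add: Ad_def W.m_assoc) (simp flip: W.m_assoc)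
  qed
  have co: "composable Y a b \<Longrightarrow> composable Y b c \<Longrightarrow> w = tgt Y a \<Longrightarrow>
          psi G a (twist G b c) \<otimes>\<^bsub>lgrp G w\<^esub> twist G a (cmp Y b c)
          = twist G a b \<otimes>\<^bsub>lgrp G w\<^esub> twist G (cmp Y a b) c" for a b c w
     using cocycle by blast
  have sel: "lgrp (local_cog Y G \<gamma>) = local_grp Y G \<gamma>" "psi (local_cog Y G \<gamma>) = local_psi G"
    "twist (local_cog Y G \<gamma>) = local_twist G \<gamma>"
    "on_vert (Sigma_mor Y G \<gamma>) = Sigma_vert Y \<gamma>"
    "on_edge (Sigma_mor Y G \<gamma>) = Sigma_edge Y"
    "loc (Sigma_mor Y G \<gamma>) = Sigma_loc G"
    "elt (Sigma_mor Y G \<gamma>) = Sigma_elt Y G"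
    by (simp_all add: local_cog_def Sigma_mor_def)
  have h: "a \<in> edges Y \<Longrightarrow> src Y a = v \<Longrightarrow> tgt Y a = w \<Longrightarrow> psi G a \<in> hom (lgrp G v) (lgrp G w)" for a v w
    using psi_hom by blast
  have idh: "id \<in> hom (lgrp G v) (lgrp G v)" for v by (simp add: hom_def)
  have co1: "inv\<^bsub>lgrp G (tgt Y a)\<^esub> (twist G (cmp Y a b) c) =
    inv\<^bsub>lgrp G (tgt Y a)\<^esub> (twist G a (cmp Y b c)) \<otimes>\<^bsub>lgrp G (tgt Y a)\<^esub> inv\<^bsub>lgrp G (tgt Y a)\<^esub> (psi G a (twist G b c)) \<otimes>\<^bsub>lgrp G (tgt Y a)\<^esub> twist G a b"
    if "a \<in> edges Y" "b \<in> edges Y" "c \<in> edges Y" "src Y a = tgt Y b" "src Y b = tgt Y c" for a b c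
    using that co[of a b c] by (intro inv_eq_of_mult_eq) auto
  show ?thesis
    unfolding cog_morphism_def scwol_functor_def sel
  proof (intro conjI ballI allI impI, goal_cases)
    case 1 show ?case apply (intro funcsetI) subgoal for v by (cases v) auto done
  next
    case 2 show ?case apply (intro funcsetI) subgoal for v by (cases v) auto done
  next
    case (3 a) then show ?case by (cases a) auto
  next
    case (4 a) then show ?case by (cases a) auto
  next
    case (5 a b) then show ?case by (cases a; cases b) auto
  next
    case (6 v) then show ?case by (cases v) (auto simp: h idh)
  next
    case (7 a) then show ?case by (cases a) auto
  next
    case (8 a g) then show ?case by (cases a) (auto simp: tw tw2)
  next
    case (9 a b)
    then have C: "a \<in> edges (local_scwol Y \<gamma>)" "b \<in> edges (local_scwol Y \<gamma>)" "local_src Y a = local_tgt Y b"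
      by (simp_all only: composable_def local_scwol_simps)
    have one: "x \<otimes>\<^bsub>lgrp G v\<^esub> \<one>\<^bsub>lgrp G v\<^esub> = \<one>\<^bsub>lgrp G v\<^esub> \<otimes>\<^bsub>lgrp G v\<^esub> \<one>\<^bsub>lgrp G v\<^esub> \<otimes>\<^bsub>lgrp G v\<^esub> x"
      if "v \<in> verts Y" "x \<in> carrier (lgrp G v)" for v x using that by simp
    have r1: "twist G d d' \<otimes>\<^bsub>lgrp G (tgt Y d)\<^esub> \<one>\<^bsub>lgrp G (tgt Y (cmp Y d d'))\<^esub> =
       \<one>\<^bsub>lgrp G (tgt Y d)\<^esub> \<otimes>\<^bsub>lgrp G (tgt Y d)\<^esub> psi G d \<one>\<^bsub>lgrp G (tgt Y d')\<^esub> \<otimes>\<^bsub>lgrp G (tgt Y d)\<^esub> twist G d d'"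
       if "d \<in> edges Y" "d' \<in> edges Y" "src Y d = tgt Y d'" for d d' using that by simp
    have r5: "twist G (cmp Y a b) c = inv\<^bsub>lgrp G (tgt Y a)\<^esub> twist G a b \<otimes>\<^bsub>lgrp G (tgt Y a)\<^esub> psi G a (twist G b c) \<otimes>\<^bsub>lgrp G (tgt Y a)\<^esub> twist G a (cmp Y b c)"
      if "a \<in> edges Y" "b \<in> edges Y" "c \<in> edges Y" "src Y a = tgt Y b" "src Y b = tgt Y c" for a b c
    proof -
      interpret W: group "lgrp G (tgt Y a)" using that by simp
      have m: "twist G (cmp Y a b) c \<in> carrier (lgrp G (tgt Y a))" "twist G a b \<in> carrier (lgrp G (tgt Y a))"
         "twist G a (cmp Y b c) \<in> carrier (lgrp G (tgt Y a))" "psi G a (twist G b c) \<in> carrier (lgrp G (tgt Y a))"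
        using that by auto
      show ?thesis using m co[of a b c "tgt Y a"] that by (simp add: W.m_assoc W.inv_solve_left)
    qed
    from C show ?case
      apply (cases a; cases b; simp only: local_scwol_simps local_src.simps local_tgt.simps local_vert.inject
        local_vert.distinct local_cmp.simps local_twist.simps Sigma_elt.simps Sigma_loc.simps Sigma_edge.simps id_def; (elim conjE)?; hypsubst?)
      subgoal by (rule r1; simp)
      subgoal by (rule r1; simp)
      subgoal for b c d by (simp add: co)
      subgoal by simp
      subgoal for a b c
        by (simp, simp add: r5)
      subgoal by (simp add: group.l_inv)
      subgoal for a' b a
       by (simp, simp add: co1)
       done
  qed
qed

end

theory Submission
  imports Defs "HOL-Analysis.Abstract_Topological_Spaces"
begin

text \<open>
  Since \<open>\<gamma>\<close> is a cone point of \<open>\<Y>(\<gamma>)\<close>, the inclusion of \<open>G\<^sub>\<gamma>\<close> into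
  \<open>\<pi>\<^sub>1(L(\<Y>(\<gamma>)), \<gamma>)\<close> is an isomorphism (its inverse is induced by the \<open>\<psi>\<^sub>c\<close> on the upper
  link), so \<open>\<Sigma>\<close> is \<open>\<pi>\<^sub>1\<close>-injective if and only if \<open>G\<^sub>\<gamma>\<close> injects into \<open>FG(\<Y>)\<close>.

  If \<open>G(\<Y>)\<close> comes from an action of \<open>H\<close>, then sending \<open>a\<^sup>+\<close> to \<open>h\<^sub>a\<close> maps \<open>FG(\<Y>)\<close> to \<open>H\<close> and
  restricts to injections of the stabilizers, hence the local groups inject.
  Conversely, if they inject, \<open>\<pi>\<^sub>1(G(\<Y>), \<sigma>\<^sub>0)\<close> acts on the scwol of cosets \<open>x G\<^sub>\<sigma>\<close>, where \<open>x\<close> runs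
  through the classes of paths from \<open>\<sigma>\<^sub>0\<close> to \<open>\<sigma>\<close>, and induces \<open>G(\<Y>)\<close>. To see that this scwol is simply
  connected, transport elements of a local system of sets along words: the result depends only on
  the class of the word in \<open>FG(\<Y>)\<close>. For the local system of homotopy classes of paths from the base
  point this gives a path to each vertex of the realization that is compatible with all edges; as open
  stars of vertices contract to the vertex, every path is homotopic to the chosen path to its end point.
\<close>

section \<open>Homotopies of paths in abstract topologies\<close>

text \<open>Simple connectivity of the development is the hard point. It is reached through sections
  of local systems with values in an arbitrary type, because the system that matters consists of
  sets of paths in the realization. The obstacle is that an equality in \<open>FG\<close> may pass
  through words that are not edge paths, and even through letters outside the alphabet, along which
  nothing can be transported. On the topological side, gluing is an equivalence closure without
  normal forms. Functions on the realization therefore come from functions invariant under a single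
  gluing, such as the barycentric coordinate at a vertex; absence of loops makes a vertex occur only
  once in a simplex, so that there is a definite corner to contract to. Injectivity of the local
  groups in \<open>FG\<close> does not mention the types of a development, which is why a
  development over any types yields one over the types fixed in \<open>developable\<close>. The
  empty scwol is connected but has no base vertex, so it is treated apart.\<close>

abbreviation unit_top :: "real topology" where
  "unit_top \<equiv> top_of_set {0..1}"

definition pjoin :: "(real \<Rightarrow> 'a) \<Rightarrow> (real \<Rightarrow> 'a) \<Rightarrow> real \<Rightarrow> 'a" where
  "pjoin p q = (\<lambda>t. if t \<le> 1/2 then p (2 * t) else q (2 * t - 1))"

definition preverse :: "(real \<Rightarrow> 'a) \<Rightarrow> real \<Rightarrow> 'a" where
  "preverse p = (\<lambda>t. p (1 - t))"

text \<open>Homotopy relative to the end points: the property is imposed on every stage of the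
  homotopy.\<close>

definition hpath :: "'a topology \<Rightarrow> (real \<Rightarrow> 'a) \<Rightarrow> (real \<Rightarrow> 'a) \<Rightarrow> bool" where
  "hpath T p q \<longleftrightarrow> homotopic_with (\<lambda>r. r 0 = p 0 \<and> r 1 = p 1) unit_top T p q"

lemma pjoin_ends [simp]: "pjoin p q 0 = p 0" "pjoin p q 1 = q 1"
  by (simp_all add: pjoin_def)

lemma preverse_ends [simp]: "preverse p 0 = p 1" "preverse p 1 = p 0"
  by (simp_all add: preverse_def)

lemma comp_pjoin: "F \<circ> pjoin p q = pjoin (F \<circ> p) (F \<circ> q)"
  by (auto simp: pjoin_def)

lemma comp_preverse: "F \<circ> preverse p = preverse (F \<circ> p)"
  by (auto simp: preverse_def)

lemma preverse_preverse [simp]: "preverse (preverse p) = p"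
  by (simp add: preverse_def)

lemma pathin_pjoin:
  assumes "pathin T p" "pathin T q" "p 1 = q 0"
  shows "pathin T (pjoin p q)"
  unfolding pathin_def pjoin_def
proof (rule continuous_map_cases_le)
  show "continuous_map (subtopology unit_top {x \<in> topspace unit_top. x \<le> 1/2}) T (\<lambda>t. p (2 * t))"
    using assms(1) unfolding pathin_def
    by (rule continuous_map_compose[unfolded o_def, rotated])
      (auto simp: continuous_map_in_subtopology subtopology_subtopology intro!: continuous_intros)
  show "continuous_map (subtopology unit_top {x \<in> topspace unit_top. 1/2 \<le> x}) T (\<lambda>t. q (2 * t - 1))"
    using assms(2) unfolding pathin_def
    by (rule continuous_map_compose[unfolded o_def, rotated])
      (auto simp: continuous_map_in_subtopology subtopology_subtopology intro!: continuous_intros)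
  show "p (2 * t) = q (2 * t - 1)" if "t \<in> topspace unit_top" "t = 1/2" for t
    using assms(3) unfolding that(2) by simp
qed auto

lemma pathin_preverse: "pathin T p \<Longrightarrow> pathin T (preverse p)"
  unfolding pathin_def preverse_def
  by (rule continuous_map_compose[unfolded o_def, rotated])
    (auto simp: continuous_map_in_subtopology intro!: continuous_intros)

lemma hpath_imp_ends: "hpath T p q \<Longrightarrow> q 0 = p 0 \<and> q 1 = p 1"
  unfolding hpath_def by (drule homotopic_with_imp_property) auto

lemma hpath_imp_pathin: "hpath T p q \<Longrightarrow> pathin T p \<and> pathin T q"
  unfolding hpath_def pathin_def by (rule homotopic_with_imp_continuous_maps)

lemma hpath_refl [simp]: "hpath T p p \<longleftrightarrow> pathin T p"
  unfolding hpath_def pathin_def by simp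

text \<open>Paths are functions on all reals. This makes their values outside the unit interval
  irrelevant, so identities that hold only on {0..1} suffice later.\<close>

lemma hpath_eqI: "pathin T p \<Longrightarrow> (\<And>t. t \<in> {0..1} \<Longrightarrow> p t = p' t) \<Longrightarrow> hpath T p p'"
  unfolding hpath_def pathin_def by (intro homotopic_with_equal) auto

lemma hpath_sym: "hpath T p q \<Longrightarrow> hpath T q p"
  using hpath_imp_ends[of T p q] unfolding hpath_def by (simp add: homotopic_with_sym)

lemma hpath_trans [trans]: "hpath T p q \<Longrightarrow> hpath T q r \<Longrightarrow> hpath T p r"
  using hpath_imp_ends[of T p q] unfolding hpath_def by (auto intro: homotopic_with_trans)

text \<open>The two homotopies can be pasted along parameter 1/2 because both keep the common point
  \<open>p 1 = q 0\<close> fixed at every stage.\<close>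

lemma hpath_join:
  assumes "hpath T p p'" "hpath T q q'" "p 1 = q 0"
  shows "hpath T (pjoin p q) (pjoin p' q')"
proof -
  obtain h k where h: "continuous_map (prod_topology unit_top unit_top) T h"
      "\<And>x. h (0, x) = p x" "\<And>x. h (1, x) = p' x" "\<And>t. t \<in> {0..1} \<Longrightarrow> h (t, 0) = p 0 \<and> h (t, 1) = p 1"
    and k: "continuous_map (prod_topology unit_top unit_top) T k"
      "\<And>x. k (0, x) = q x" "\<And>x. k (1, x) = q' x" "\<And>t. t \<in> {0..1} \<Longrightarrow> k (t, 0) = q 0 \<and> k (t, 1) = q 1"
    using assms(1,2) unfolding hpath_def homotopic_with_def by auto
  let ?P = "prod_topology unit_top unit_top"
  let ?g = "\<lambda>z. if snd z \<le> 1/2 then h (fst z, 2 * snd z) else k (fst z, 2 * snd z - 1)"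
  have "continuous_map ?P T ?g"
  proof (rule continuous_map_cases_le)
    show "continuous_map ?P euclideanreal snd" "continuous_map ?P euclideanreal (\<lambda>z. 1/2)"
      by (auto intro!: continuous_intros simp: continuous_map_in_subtopology continuous_map_snd
          intro: continuous_map_into_fulltopology[OF continuous_map_snd])
    show "continuous_map (subtopology ?P {z \<in> topspace ?P. snd z \<le> 1/2}) T (\<lambda>z. h (fst z, 2 * snd z))"
      by (rule continuous_map_compose[unfolded o_def, OF _ h(1)])
        (auto simp: continuous_map_in_subtopology subtopology_subtopology intro!: continuous_intros)
    show "continuous_map (subtopology ?P {z \<in> topspace ?P. 1/2 \<le> snd z}) T (\<lambda>z. k (fst z, 2 * snd z - 1))"
      by (rule continuous_map_compose[unfolded o_def, OF _ k(1)])
        (auto simp: continuous_map_in_subtopology subtopology_subtopology intro!: continuous_intros)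
    show "h (fst z, 2 * snd z) = k (fst z, 2 * snd z - 1)" if "z \<in> topspace ?P" "snd z = 1/2" for z
    proof -
      have "fst z \<in> {0..1}" using that(1) by auto
      moreover have e: "2 * snd z = 1" using that(2) by simp
      ultimately show ?thesis unfolding e using h(4)[of "fst z"] k(4)[of "fst z"] assms(3) by simp
    qed
  qed
  then show ?thesis
    unfolding hpath_def homotopic_with_def
    by (intro exI[of _ ?g]) (auto simp: h k pjoin_def)
qed

lemma pathin_comp:
  fixes \<alpha> :: "real \<Rightarrow> 'b::real_normed_vector"
  assumes "continuous_map (top_of_set C) T F" "continuous_on {0..1} \<alpha>" "\<alpha> \<in> {0..1} \<rightarrow> C"
  shows "pathin T (F \<circ> \<alpha>)"
  unfolding pathin_def
  by (rule continuous_map_compose[OF _ assms(1)])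
    (use assms(2,3) in \<open>auto simp: continuous_map_in_subtopology\<close>)

text \<open>Every homotopy of paths constructed below is the image of a linear one in a convex set.\<close>

lemma hpath_convex:
  fixes \<alpha> \<beta> :: "real \<Rightarrow> 'b::real_normed_vector"
  assumes C: "convex C" and F: "continuous_map (top_of_set C) T F"
    and \<alpha>: "continuous_on {0..1} \<alpha>" "\<alpha> \<in> {0..1} \<rightarrow> C" and \<beta>: "continuous_on {0..1} \<beta>" "\<beta> \<in> {0..1} \<rightarrow> C"
    and ends: "\<alpha> 0 = \<beta> 0" "\<alpha> 1 = \<beta> 1"
  shows "hpath T (F \<circ> \<alpha>) (F \<circ> \<beta>)"
proof -
  have "homotopic_paths C \<alpha> \<beta>"
  proof (rule homotopic_paths_linear)
    show "closed_segment (\<alpha> t) (\<beta> t) \<subseteq> C" if "t \<in> {0..1}" for t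
      using that \<alpha> \<beta> C by (intro closed_segment_subset) auto
  qed (use \<alpha> \<beta> ends in \<open>auto simp: path_def pathstart_def pathfinish_def\<close>)
  then have "homotopic_with_canon (\<lambda>r. r 0 = \<alpha> 0 \<and> r 1 = \<alpha> 1) {0..1} C \<alpha> \<beta>"
    by (simp add: homotopic_paths_def pathstart_def pathfinish_def)
  then show ?thesis
    unfolding hpath_def
    by (rule homotopic_with_compose_continuous_map_left[OF _ F]) auto
qed

lemma pjoin_continuous_on:
  fixes p q :: "real \<Rightarrow> 'b::topological_space"
  assumes "continuous_on {0..1} p" "continuous_on {0..1} q" "p 1 = q 0"
  shows "continuous_on {0..1} (pjoin p q)"
  using pathin_pjoin[of euclidean p q] assms by (simp add: pathin_def)

lemma pjoin_funcset: "p \<in> {0..1} \<rightarrow> C \<Longrightarrow> q \<in> {0..1} \<rightarrow> C \<Longrightarrow> pjoin p q \<in> {0..1} \<rightarrow> C"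
  by (auto simp: pjoin_def Pi_iff)

text \<open>The straight-line homotopy between \<open>f\<close> and \<open>g\<close> stays in the
  unit interval. The groupoid laws below are instances: both sides are one path precomposed with two
  self-maps of the interval.\<close>

lemma hpath_reparametrize:
  assumes p: "pathin T p" and f: "continuous_on {0..1} f" "f \<in> {0..1} \<rightarrow> {0..1}"
    and g: "continuous_on {0..1} g" "g \<in> {0..1} \<rightarrow> {0..1::real}" and ends: "f 0 = g 0" "f 1 = g 1"
  shows "hpath T (p \<circ> f) (p \<circ> g)"
  by (rule hpath_convex[of "{0..1}"]) (use assms in \<open>auto simp: pathin_def\<close>)

lemma hpath_assoc:
  assumes "pathin T p" "pathin T q" "pathin T r" "p 1 = q 0" "q 1 = r 0"
  shows "hpath T (pjoin (pjoin p q) r) (pjoin p (pjoin q r))"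
proof -
  \<comment> \<open>The change of parameter maps the break points 1/4 and 1/2 of the left bracketing
    to the break points 1/2 and 3/4 of the right one.\<close>
  let ?f = "\<lambda>t::real. if t \<le> 1/2 then (if t \<le> 1/4 then 2 * t else t + 1/4) else t / 2 + 1/2"
  let ?P = "pjoin p (pjoin q r)"
  have c: "continuous_on {0..1} ?f"
    unfolding split_01
    by (rule continuous_on_cases; (rule continuous_on_subset[of UNIV], (intro continuous_on_cases_le continuous_intros)?)?) 
     (auto intro!: continuous_intros continuous_on_cases_le)
  have "hpath T (?P \<circ> ?f) (?P \<circ> (\<lambda>t. t))"
    by (rule hpath_reparametrize[OF _ c]) (use assms in \<open>auto intro!: pathin_pjoin\<close>)
  moreover have "?P \<circ> ?f = pjoin (pjoin p q) r"
    by (rule ext) (auto simp: pjoin_def field_simps intro!: arg_cong[of _ _ q])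
  ultimately show ?thesis by (simp add: o_def)
qed

lemma hpath_const_join:
  assumes "pathin T p" shows "hpath T (pjoin (\<lambda>_. p 0) p) p" "hpath T (pjoin p (\<lambda>_. p 1)) p"
proof -
  have "hpath T (p \<circ> pjoin (\<lambda>_. 0) (\<lambda>t. t)) (p \<circ> (\<lambda>t. t))"
    by (rule hpath_reparametrize[OF assms pjoin_continuous_on pjoin_funcset]) auto
  then show "hpath T (pjoin (\<lambda>_. p 0) p) p" by (simp add: comp_pjoin) (simp add: o_def)
  have "hpath T (p \<circ> pjoin (\<lambda>t. t) (\<lambda>_. 1)) (p \<circ> (\<lambda>t. t))"
    by (rule hpath_reparametrize[OF assms pjoin_continuous_on pjoin_funcset]) auto
  then show "hpath T (pjoin p (\<lambda>_. p 1)) p" by (simp add: comp_pjoin) (simp add: o_def)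
qed

text \<open>Going along \<open>p\<close> and back is \<open>p\<close> after a map of the interval
  that runs to the far end and returns; that map deforms linearly to a constant.\<close>

lemma hpath_join_reverse:
  assumes "pathin T p"
  shows "hpath T (pjoin p (preverse p)) (\<lambda>_. p 0)" "hpath T (pjoin (preverse p) p) (\<lambda>_. p 1)"
proof -
  have "hpath T (p \<circ> pjoin (\<lambda>t. t) (preverse (\<lambda>t. t))) (p \<circ> (\<lambda>t. 0))"
    by (rule hpath_reparametrize[OF assms pjoin_continuous_on pjoin_funcset])
      (auto simp: preverse_def intro!: continuous_intros)
  then show "hpath T (pjoin p (preverse p)) (\<lambda>_. p 0)"
    by (simp add: comp_pjoin comp_preverse) (simp add: o_def)
  have "hpath T (p \<circ> pjoin (preverse (\<lambda>t. t)) (\<lambda>t. t)) (p \<circ> (\<lambda>t. 1))"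
    by (rule hpath_reparametrize[OF assms pjoin_continuous_on pjoin_funcset])
      (auto simp: preverse_def intro!: continuous_intros)
  then show "hpath T (pjoin (preverse p) p) (\<lambda>_. p 1)"
    by (simp add: comp_pjoin comp_preverse) (simp add: o_def)
qed

lemma hpath_cancel_left:
  assumes "hpath T (pjoin a p) (pjoin a q)" "pathin T a" "pathin T p" "pathin T q" "a 1 = p 0" "a 1 = q 0"
  shows "hpath T p q"
proof -
  have *: "hpath T (pjoin (preverse a) (pjoin a r)) r" if "pathin T r" "a 1 = r 0" for r
  proof -
    have "hpath T (pjoin (preverse a) (pjoin a r)) (pjoin (pjoin (preverse a) a) r)"
      by (rule hpath_sym[OF hpath_assoc]) (use assms that in \<open>auto intro: pathin_preverse\<close>)
    also have "hpath T \<dots> (pjoin (\<lambda>_. r 0) r)"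
      using hpath_join_reverse(2)[OF assms(2)] that by (intro hpath_join) auto
    also have "hpath T \<dots> r" by (rule hpath_const_join) fact
    finally show ?thesis .
  qed
  have "hpath T p (pjoin (preverse a) (pjoin a p))" using assms by (intro hpath_sym[OF *]) auto
  also have "hpath T \<dots> (pjoin (preverse a) (pjoin a q))"
    using assms by (intro hpath_join[OF _ assms(1)]) (auto intro: pathin_preverse)
  also have "hpath T \<dots> q" using assms by (intro *) auto
  finally show ?thesis .
qed

lemma hpath_join_reverse_cancel:
  assumes "pathin T a" "pathin T p" "p 1 = a 0"
  shows "hpath T (pjoin (pjoin p a) (preverse a)) p"
proof -
  have "hpath T (pjoin (pjoin p a) (preverse a)) (pjoin p (pjoin a (preverse a)))"
    by (rule hpath_assoc) (use assms in \<open>auto intro: pathin_preverse\<close>)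
  also have "hpath T \<dots> (pjoin p (\<lambda>_. p 1))"
    using hpath_join_reverse(1)[OF assms(1)] assms by (intro hpath_join) auto
  also have "hpath T \<dots> p" by (rule hpath_const_join) fact
  finally show ?thesis .
qed

lemma hpath_cancel_right:
  assumes "hpath T (pjoin p a) (pjoin q a)" "pathin T a" "pathin T p" "pathin T q" "p 1 = a 0" "q 1 = a 0"
  shows "hpath T p q"
proof -
  have "hpath T p (pjoin (pjoin p a) (preverse a))"
    using assms by (intro hpath_sym[OF hpath_join_reverse_cancel]) auto
  also have "hpath T \<dots> (pjoin (pjoin q a) (preverse a))"
    using assms by (intro hpath_join[OF assms(1)]) (auto intro: pathin_preverse)
  also have "hpath T \<dots> q" using assms by (intro hpath_join_reverse_cancel) auto
  finally show ?thesis .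
qed

text \<open>No order between \<open>s\<close> and \<open>t\<close> is assumed; a piece traversed
  backwards is needed when a property is carried from one parameter to an arbitrary nearby
  one.\<close>

definition psub :: "(real \<Rightarrow> 'a) \<Rightarrow> real \<Rightarrow> real \<Rightarrow> real \<Rightarrow> 'a" where
  "psub p s t = p \<circ> linepath s t"

lemma linepath_01: "s \<in> {0..1} \<Longrightarrow> t \<in> {0..1} \<Longrightarrow> linepath s t \<in> {0..1} \<rightarrow> {0..1::real}"
  by (smt (verit, best) Pi_I' closed_segment_subset convex_real_interval(5) in_mono linepath_in_path)

lemma pathin_psub: "pathin T p \<Longrightarrow> s \<in> {0..1} \<Longrightarrow> t \<in> {0..1} \<Longrightarrow> pathin T (psub p s t)"
  unfolding psub_def by (rule pathin_comp[OF _ _ linepath_01]) (auto simp: pathin_def)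

lemma psub_ends [simp]: "psub p s t 0 = p s" "psub p s t 1 = p t"
  by (simp_all add: psub_def linepath_def)

lemma hpath_psub_join:
  assumes "pathin T p" "s \<in> {0..1}" "t \<in> {0..1}" "u \<in> {0..1}"
  shows "hpath T (pjoin (psub p s t) (psub p t u)) (psub p s u)"
  unfolding psub_def comp_pjoin[symmetric]
  by (rule hpath_reparametrize[OF assms(1) pjoin_continuous_on pjoin_funcset])
     (use assms linepath_01 in \<open>auto simp: linepath_0' linepath_1'\<close>)

section \<open>The geometric realization\<close>

fun simplex_vert :: "('v, 'e) scwol \<Rightarrow> ('v, 'e) simplex \<Rightarrow> nat \<Rightarrow> 'v" where
  "simplex_vert X (Vertex v) i = v"
| "simplex_vert X (Chain as) i = (if i = 0 then tgt X (hd as) else src X (as ! (i - 1)))"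

text \<open>The increasing injection that omits the value \<open>i\<close>. Points of a face are
  pushed forward by \<open>simplical_face\<close>, vertex numbers by this map.\<close>

definition coface :: "nat \<Rightarrow> nat \<Rightarrow> nat" where
  "coface i j = (if j < i then j else Suc j)"

definition corner :: "nat \<Rightarrow> nat \<Rightarrow> real" where
  "corner j = (\<lambda>i. if i = j then 1 else 0)"

definition segm :: "(nat \<Rightarrow> real) \<Rightarrow> (nat \<Rightarrow> real) \<Rightarrow> real \<Rightarrow> nat \<Rightarrow> real" where
  "segm x y r = (\<lambda>i. (1 - r) * x i + r * y i)"

lemma segm_ends [simp]: "segm x y 0 = x" "segm x y 1 = y"
  by (simp_all add: segm_def)

lemma corner_in: "j \<le> n \<Longrightarrow> corner j \<in> standard_simplex n"
  unfolding corner_def by simp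

lemma segm_in:
  "x \<in> standard_simplex n \<Longrightarrow> y \<in> standard_simplex n \<Longrightarrow> r \<in> {0..1} \<Longrightarrow> segm x y r \<in> standard_simplex n"
  unfolding segm_def by (rule convex_standard_simplex) auto

lemma coface_neq: "coface i j \<noteq> i" by (simp add: coface_def)

lemma coface_inj: "coface i j = coface i k \<longleftrightarrow> j = k"
  by (auto simp: coface_def split: if_splits)

lemma coface_image: "i \<le> Suc n \<Longrightarrow> coface i ` {..n} = {..Suc n} - {i}"
proof (intro equalityI subsetI)
  fix k assume "i \<le> Suc n" "k \<in> {..Suc n} - {i}"
  then have "k = coface i (if k < i then k else k - 1)" "(if k < i then k else k - 1) \<le> n"
    by (auto simp: coface_def)
  then show "k \<in> coface i ` {..n}" by blast
qed (auto simp: coface_def)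

lemma simplical_face_coface [simp]: "simplical_face i x (coface i j) = x j"
  and simplical_face_self [simp]: "simplical_face i x i = 0"
  by (auto simp: simplical_face_def coface_def)

lemma coface_cases: obtains "k = i" | j where "k = coface i j"
  by (cases "k < i"; cases "k = i") (auto simp: coface_def intro: that(2)[of "k"] that(2)[of "k - 1"])

lemma simplical_face_eqI:
  assumes "y i = 0" "\<And>j. y (coface i j) = x j" shows "simplical_face i x = y"
proof
  fix k show "simplical_face i x k = y k" by (rule coface_cases[of k i]) (auto simp: assms)
qed

lemma simplical_face_corner: "simplical_face i (corner j) = corner (coface i j)"
  by (rule simplical_face_eqI) (auto simp: corner_def coface_inj coface_neq[symmetric])

lemma simplical_face_segm:
  "simplical_face i (segm x y r) = segm (simplical_face i x) (simplical_face i y) r"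
  by (rule simplical_face_eqI) (auto simp: segm_def)

context scwol
begin

lemma simplex_vert_in:
  "s \<in> simplices X \<Longrightarrow> i \<le> simplex_dim s \<Longrightarrow> simplex_vert X s i \<in> verts X"
  by (cases s) (auto simp: simplices_def src_in tgt_in Ball_def subset_iff hd_conv_nth)

lemma face_simplex:
  assumes "s \<in> simplices X" "1 \<le> simplex_dim s" "i \<le> simplex_dim s"
  shows "face X i s \<in> simplices X" "simplex_dim (face X i s) = simplex_dim s - 1"
    "j \<le> simplex_dim s - 1 \<Longrightarrow> simplex_vert X (face X i s) j = simplex_vert X s (coface i j)"
proof -
  obtain as where s: "s = Chain as" using assms(2) by (cases s) auto
  with assms have as: "as \<noteq> []" "set as \<subseteq> edges X"
      "\<And>j. Suc j < length as \<Longrightarrow> src X (as ! j) = tgt X (as ! Suc j)" and i: "i \<le> length as"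
    by (auto simp: simplices_def)
  have E: "as ! j \<in> edges X" if "j < length as" for j using as(2) that by auto
  have "0 < length as" using as(1) by simp
  with i have "length as = 1 \<or> (length as > 1 \<and> i = 0) \<or> (length as > 1 \<and> i = length as) \<or> (0 < i \<and> i < length as)"
    by linarith
  then consider "length as = 1" | "length as > 1" "i = 0" | "length as > 1" "i = length as"
    | "0 < i" "i < length as" by blast
  then have "face X i s \<in> simplices X \<and> simplex_dim (face X i s) = simplex_dim s - 1 \<and>
    (j \<le> simplex_dim s - 1 \<longrightarrow> simplex_vert X (face X i s) j = simplex_vert X s (coface i j))"
  proof cases
    case 1
    then obtain a where "as = [a]" by (cases as) auto
    then show ?thesis using i E[of 0] by (auto simp: s simplices_def coface_def src_in tgt_in)
  next
    case 2
    then have f: "face X i s = Chain (tl as)" by (simp add: s)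
    have "set (tl as) \<subseteq> edges X" using as(2) by (auto dest: list.set_sel(2)[OF as(1)])
    moreover have "tl as \<noteq> []" using 2 by (cases as) auto
    moreover have "src X (tl as ! k) = tgt X (tl as ! Suc k)" if "Suc k < length (tl as)" for k
      using that as(3)[of "Suc k"] by (simp add: nth_tl)
    ultimately have in_s: "Chain (tl as) \<in> simplices X" by (simp add: simplices_def)
    have "simplex_vert X (Chain (tl as)) j = simplex_vert X s (coface i j)" if "j \<le> length as - 1"
    proof (cases j)
      case 0
      have "hd (tl as) = as ! 1" using 2 by (cases as; cases "tl as") auto
      then show ?thesis using 0 2 as(3)[of 0] by (simp add: s coface_def)
    next
      case (Suc k)
      then show ?thesis using 2 that by (simp add: s coface_def nth_tl)
    qed
    then show ?thesis using f in_s by (simp add: s)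
  next
    case 3
    then have f: "face X i s = Chain (butlast as)" by (simp add: s)
    have "set (butlast as) \<subseteq> edges X" using as(2) by (auto dest: in_set_butlastD)
    moreover have "butlast as \<noteq> []" using 3 by (cases as) auto
    moreover have "src X (butlast as ! k) = tgt X (butlast as ! Suc k)" if "Suc k < length (butlast as)" for k
      using that as(3)[of k] by (simp add: nth_butlast)
    ultimately have in_s: "Chain (butlast as) \<in> simplices X" by (simp add: simplices_def)
    have "hd (butlast as) = hd as" using 3 by (cases as) auto
    then have "simplex_vert X (Chain (butlast as)) j = simplex_vert X s (coface i j)" if "j \<le> length as - 1"
    proof -
      have "j < length as" using that 3 by simp
      then show ?thesis using \<open>hd (butlast as) = hd as\<close> 3 by (cases j) (simp_all add: s coface_def nth_butlast)
    qed
    then show ?thesis using f in_s by (simp add: s)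
  next
    case 4
    then obtain m where m: "i = Suc m" "Suc m < length as" by (cases i) auto
    let ?c = "cmp X (as ! m) (as ! Suc m)"
    let ?bs = "take m as @ [?c] @ drop (Suc (Suc m)) as"
    have f: "face X i s = Chain ?bs" using m by (simp add: s)
    have co: "composable X (as ! m) (as ! Suc m)"
      using E[of m] E[of "Suc m"] as(3)[of m] m by (simp add: composable_def)
    have len: "length ?bs = length as - 1" using m by simp
    have nth: "?bs ! k = (if k < m then as ! k else if k = m then ?c else as ! Suc k)"
      if "k < length as - 1" for k
    proof -
      consider "k < m" | "k = m" | n where "k = Suc (m + n)"
        using less_iff_Suc_add[of m k] by (cases k m rule: linorder_cases) auto
      then show ?thesis
      proof cases
        case (3 n)
        then have "?bs ! k = drop (Suc (Suc m)) as ! n" using m by (simp add: nth_append)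
        also have "\<dots> = as ! (Suc (Suc m) + n)" using m by (intro nth_drop) simp
        finally show ?thesis using 3 by simp
      qed (use m in \<open>simp_all add: nth_append\<close>)
    qed
    \<comment> \<open>The composite at position \<open>m\<close> has the source of entry
      \<open>Suc m\<close> but the target of entry \<open>m\<close>. So the index shift starts at
      \<open>m\<close> for sources and only after \<open>m\<close> for targets.\<close>
    have srcs: "src X (?bs ! k) = src X (as ! (if k < m then k else Suc k))" if "k < length as - 1" for k
      unfolding nth[OF that] using src_cmp[OF co] by simp
    have tgts: "tgt X (?bs ! k) = tgt X (as ! (if k \<le> m then k else Suc k))" if "k < length as - 1" for k
      unfolding nth[OF that] using tgt_cmp[OF co] by simp
    have "set ?bs \<subseteq> edges X"
      using as(2) cmp_in[OF co] set_take_subset[of m as] set_drop_subset[of "Suc (Suc m)" as] by auto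
    moreover have "src X (?bs ! k) = tgt X (?bs ! Suc k)" if "Suc k < length ?bs" for k
    proof -
      have k: "Suc k < length as - 1" using that unfolding len .
      then have k': "k < length as - 1" by simp
      show ?thesis unfolding srcs[OF k'] tgts[OF k]
      proof (cases "k < m")
        case True
        then show "src X (as ! (if k < m then k else Suc k)) = tgt X (as ! (if Suc k \<le> m then Suc k else Suc (Suc k)))"
          using as(3)[of k] m by simp
      next
        case False
        then show "src X (as ! (if k < m then k else Suc k)) = tgt X (as ! (if Suc k \<le> m then Suc k else Suc (Suc k)))"
          using as(3)[of "Suc k"] k by simp
      qed
    qed
    ultimately have in_s: "Chain ?bs \<in> simplices X" unfolding simplices_def by blast
    have "simplex_vert X (Chain ?bs) j = simplex_vert X s (coface i j)" if j: "j \<le> length as - 1"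
    proof (cases j)
      case 0
      have "tgt X (hd ?bs) = tgt X (?bs ! 0)" by (subst hd_conv_nth) simp_all
      also have "tgt X (?bs ! 0) = tgt X (as ! (if 0 \<le> m then 0 else Suc 0))"
        by (rule tgts) (use m in simp)
      finally show ?thesis using 0 m as(1) by (simp add: s coface_def hd_conv_nth)
    next
      case (Suc k)
      then have "simplex_vert X (Chain ?bs) j = src X (?bs ! k)" by simp
      also have "\<dots> = src X (as ! (if k < m then k else Suc k))" by (rule srcs) (use Suc j in simp)
      also have "\<dots> = simplex_vert X s (coface i j)" using Suc m by (simp add: s coface_def)
      finally show ?thesis .
    qed
    then show ?thesis using f len in_s by (simp add: s)
  qed
  then show "face X i s \<in> simplices X" "simplex_dim (face X i s) = simplex_dim s - 1"
    "j \<le> simplex_dim s - 1 \<Longrightarrow> simplex_vert X (face X i s) j = simplex_vert X s (coface i j)" by blast+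
qed

abbreviation "T \<equiv> realization X"
abbreviation "SS \<equiv> simplex_space X"
abbreviation "q \<equiv> glue_class X"

lemma topspace_SS: "topspace SS = {(s, x). s \<in> simplices X \<and> x \<in> standard_simplex (simplex_dim s)}"
  by (auto simp: simplex_space_def)

lemma q_continuous: "continuous_map SS T q"
  using quotient_map_realization by (rule quotient_imp_continuous_map)

lemma q_image: "q ` topspace SS = topspace T"
  using quotient_map_realization by (rule quotient_imp_surjective_map)

lemma q_eq_iff: "q p = q p' \<longleftrightarrow> equivclp (glue X) p p'"
proof
  assume "q p = q p'"
  moreover have "p' \<in> q p'" by (simp add: glue_class_def)
  ultimately have "p' \<in> q p" by metis
  then show "equivclp (glue X) p p'" by (simp add: glue_class_def)
next
  assume "equivclp (glue X) p p'"
  then show "q p = q p'" unfolding glue_class_def by (blast intro: equivclp_trans equivclp_sym)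
qed

lemma q_face:
  assumes "s \<in> simplices X" "1 \<le> simplex_dim s" "i \<le> simplex_dim s" "x \<in> standard_simplex (simplex_dim s - 1)"
  shows "q (s, simplical_face i x) = q (face X i s, x)"
  unfolding q_eq_iff by (rule r_into_equivclp, rule glue.intros) (use assms in auto)

lemma equivclp_invariant:
  assumes "equivclp R a b" "\<And>x y. R x y \<Longrightarrow> f x = f y" shows "f a = f b"
  using assms(1) by (induction rule: equivclp_induct) (auto dest: assms(2))

definition vpt :: "'v \<Rightarrow> (('v, 'e) simplex \<times> (nat \<Rightarrow> real)) set" where
  "vpt v = q (Vertex v, corner 0)"

definition epath :: "'e \<Rightarrow> real \<Rightarrow> (('v, 'e) simplex \<times> (nat \<Rightarrow> real)) set" where
  "epath a r = q (Chain [a], segm (corner 1) (corner 0) r)"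

text \<open>A corner lies on the face opposite to any other vertex, so gluing lowers the dimension
  until a vertex simplex is left.\<close>

lemma q_corner:
  "s \<in> simplices X \<Longrightarrow> j \<le> simplex_dim s \<Longrightarrow> q (s, corner j) = vpt (simplex_vert X s j)"
proof (induction "simplex_dim s" arbitrary: s j)
  case 0
  then show ?case by (cases s) (auto simp: simplices_def vpt_def)
next
  case (Suc n)
  define i where "i = (if j = 0 then 1 else 0::nat)"
  then obtain k where k: "j = coface i k" using coface_cases[of j i] by (metis zero_neq_one)
  have i: "i \<le> simplex_dim s" using Suc.hyps(2) by (simp add: i_def)
  have kn: "k \<le> n" using k Suc.prems(2) Suc.hyps(2) by (auto simp: coface_def i_def split: if_splits)
  note F = face_simplex[OF Suc.prems(1) _ i, unfolded Suc.hyps(2)[symmetric]]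
  have "q (s, corner j) = q (face X i s, corner k)"
    unfolding k simplical_face_corner[symmetric]
    by (rule q_face) (use Suc i kn corner_in in \<open>auto simp flip: Suc.hyps(2)\<close>)
  also have "\<dots> = vpt (simplex_vert X (face X i s) k)"
    by (rule Suc.hyps(1)) (use F kn in auto)
  finally show ?case using F(3) kn k by simp
qed

text \<open>The segment between two corners lies on every face that keeps both of them. Dropping the
  other vertices one at a time leaves a single edge, so the composite of the part of the chain
  between them never has to be written down.\<close>

lemma q_segm_edge:
  assumes "s \<in> simplices X" "j < j'" "j' \<le> simplex_dim s"
  shows "\<exists>a\<in>edges X. src X a = simplex_vert X s j' \<and> tgt X a = simplex_vert X s j \<and>
    (\<forall>r\<in>{0..1}. q (s, segm (corner j') (corner j) r) = epath a r)"
  using assms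
proof (induction "simplex_dim s" arbitrary: s j j')
  case 0
  then show ?case by simp
next
  case (Suc n)
  show ?case
  proof (cases n)
    case 0
    then have "simplex_dim s = Suc 0" "j = 0" "j' = 1" using Suc.hyps(2) Suc.prems by auto
    moreover from this obtain a where "s = Chain [a]" by (cases s) (auto simp: length_Suc_conv)
    ultimately show ?thesis using Suc.prems by (auto simp: simplices_def epath_def)
  next
    case (Suc m)
    \<comment> \<open>The least number different from \<open>j\<close> and \<open>j'\<close>; it is
      at most 2, hence within a simplex of dimension at least 2.\<close>
    define i where "i = (if j > 0 then 0 else if j' = 1 then 2 else 1::nat)"
    have ij: "i \<noteq> j" "i \<noteq> j'" and i: "i \<le> simplex_dim s" using Suc.prems Suc Suc.hyps(2) by (auto simp: i_def)
    obtain k k' where k: "j = coface i k" "j' = coface i k'" using coface_cases ij by metis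
    have kk: "k < k'" "k' \<le> n" using k Suc.prems i Suc.hyps(2) by (auto simp: coface_def split: if_splits)
    note F = face_simplex[OF Suc.prems(1) _ i, unfolded Suc.hyps(2)[symmetric]]
    have "q (s, segm (corner j') (corner j) r) = q (face X i s, segm (corner k') (corner k) r)" if "r \<in> {0..1}" for r
      unfolding k simplical_face_corner[symmetric] simplical_face_segm[symmetric]
      by (rule q_face) (use Suc.prems(1) i kk corner_in that in \<open>auto intro!: segm_in simp flip: Suc.hyps(2)\<close>)
    moreover have "\<exists>a\<in>edges X. src X a = simplex_vert X (face X i s) k' \<and> tgt X a = simplex_vert X (face X i s) k \<and>
        (\<forall>r\<in>{0..1}. q (face X i s, segm (corner k') (corner k) r) = epath a r)"
      by (rule Suc.hyps(1)) (use F kk in auto)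
    ultimately show ?thesis using F(3) kk k by simp
  qed
qed

text \<open>Two different corners are joined by an edge, whose ends differ because there are no
  loops. This is what gives each star a single centre in every simplex.\<close>

lemma simplex_vert_inj:
  assumes "s \<in> simplices X" "j \<le> simplex_dim s" "j' \<le> simplex_dim s" "simplex_vert X s j = simplex_vert X s j'"
  shows "j = j'"
  using q_segm_edge[OF assms(1), of j j'] q_segm_edge[OF assms(1), of j' j] assms no_loops
  by (metis linorder_neqE_nat)

end

text \<open>The summands are open in the sum, so a neighbourhood found in one summand times
  \<open>Z\<close> is one in the whole product. This reduces a homotopy on the disjoint union of
  simplices to single simplices.\<close>

lemma continuous_map_prod_sum_topology:
  assumes "\<And>i. i \<in> I \<Longrightarrow> continuous_map (prod_topology (X i) Z) T (\<lambda>(x, z). f ((i, x), z))"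
  shows "continuous_map (prod_topology (sum_topology X I) Z) T f"
  unfolding continuous_map_def
proof (intro conjI allI impI)
  show "f \<in> topspace (prod_topology (sum_topology X I) Z) \<rightarrow> topspace T"
  proof
    fix p assume "p \<in> topspace (prod_topology (sum_topology X I) Z)"
    then obtain i x z where p: "p = ((i, x), z)" "i \<in> I" "(x, z) \<in> topspace (prod_topology (X i) Z)" by auto
    have "(\<lambda>(x, z). f ((i, x), z)) (x, z) \<in> topspace T"
      using continuous_map_funspace[OF assms[OF p(2)]] p(3) by (rule funcset_mem)
    then show "f p \<in> topspace T" by (simp add: p(1))
  qed
  fix U assume U: "openin T U"
  show "openin (prod_topology (sum_topology X I) Z) {p \<in> topspace (prod_topology (sum_topology X I) Z). f p \<in> U}"
    unfolding openin_prod_topology_alt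
  proof (intro allI impI)
    fix ix z assume ixz: "(ix, z) \<in> {p \<in> topspace (prod_topology (sum_topology X I) Z). f p \<in> U}"
    then obtain i x where ix: "ix = (i, x)" "i \<in> I" "x \<in> topspace (X i)" by auto
    define W where "W = {p \<in> topspace (prod_topology (X i) Z). (\<lambda>(x, z). f ((i, x), z)) p \<in> U}"
    have "openin (prod_topology (X i) Z) W"
      unfolding W_def using assms[OF ix(2)] U by (rule openin_continuous_map_preimage)
    moreover have "(x, z) \<in> W"
      using ix ixz by (auto simp: W_def)
    ultimately obtain A B where AB: "openin (X i) A" "openin Z B" "x \<in> A" "z \<in> B" "A \<times> B \<subseteq> W"
      unfolding openin_prod_topology_alt by meson
    have "openin (sum_topology X I) (Pair i ` A)"
      using open_map_component_injection[OF ix(2)] AB(1) unfolding open_map_def by blast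
    moreover have "Pair i ` A \<times> B \<subseteq> {p \<in> topspace (prod_topology (sum_topology X I) Z). f p \<in> U}"
      using AB(5) ix(2) by (auto simp: W_def)
    ultimately show "\<exists>U'. \<exists>V. openin (sum_topology X I) U' \<and> openin Z V \<and> ix \<in> U' \<and> z \<in> V \<and>
        U' \<times> V \<subseteq> {p \<in> topspace (prod_topology (sum_topology X I) Z). f p \<in> U}"
      using AB ix by blast
  qed
qed

abbreviation simplex_top :: "nat \<Rightarrow> (nat \<Rightarrow> real) topology" where
  "simplex_top n \<equiv> subtopology (powertop_real UNIV) (standard_simplex n)"

lemma continuous_map_coordinate: "continuous_map (simplex_top n) euclideanreal (\<lambda>x. x i)"
  by (intro continuous_map_from_subtopology continuous_map_product_projection) simp

lemma continuous_map_into_simplex: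
  assumes "\<And>i. continuous_map Z euclideanreal (\<lambda>z. f z i)" "f \<in> topspace Z \<rightarrow> standard_simplex n"
  shows "continuous_map Z (simplex_top n) f"
  using assms by (auto simp: continuous_map_in_subtopology continuous_map_componentwise_UNIV)

section \<open>Open stars of vertices and their contractions\<close>

context scwol
begin

text \<open>The barycentric coordinate at \<open>v\<close>. Summing over all positions of
  \<open>v\<close> makes invariance under gluing a matter of reindexing, independent of how often
  \<open>v\<close> occurs.\<close>

definition bary :: "'v \<Rightarrow> ('v, 'e) simplex \<times> (nat \<Rightarrow> real) \<Rightarrow> real" where
  "bary v p = (\<Sum>i\<le>simplex_dim (fst p). if simplex_vert X (fst p) i = v then snd p i else 0)"

definition star :: "'v \<Rightarrow> (('v, 'e) simplex \<times> (nat \<Rightarrow> real)) set" where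
  "star v = {p \<in> topspace SS. 0 < bary v p}"

text \<open>A face inclusion inserts a zero at position \<open>i\<close> and moves the other
  coordinates along \<open>coface i\<close>, together with the vertices they belong to.\<close>

lemma bary_glue:
  assumes "glue X p p'" shows "bary v p = bary v p'"
  using assms
proof cases
  case (1 s i x)
  define n where "n = simplex_dim s - 1"
  have n: "simplex_dim s = Suc n" using 1 by (simp add: n_def)
  note F = face_simplex[OF 1(3,4,5), unfolded n]
  let ?f = "\<lambda>k. if simplex_vert X s k = v then simplical_face i x k else 0"
  have "bary v p = sum ?f {..Suc n}" unfolding bary_def 1 fst_conv snd_conv n ..
  also have "\<dots> = sum ?f ({..Suc n} - {i})" by (rule sum.mono_neutral_right) auto
  also have "\<dots> = sum ?f (coface i ` {..n})" using coface_image[of i n] 1 n by simp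
  also have "\<dots> = (\<Sum>j\<le>n. ?f (coface i j))"
    by (subst sum.reindex) (auto simp: inj_on_def coface_inj)
  also have "\<dots> = (\<Sum>j\<le>n. if simplex_vert X (face X i s) j = v then x j else 0)"
    using F(3) by (intro sum.cong) auto
  also have "\<dots> = bary v p'" unfolding bary_def 1 fst_conv snd_conv F(2) n diff_Suc_1 ..
  finally show ?thesis .
qed

lemma bary_q: "q p = q p' \<Longrightarrow> bary v p = bary v p'"
  unfolding q_eq_iff by (erule equivclp_invariant) (rule bary_glue)

text \<open>The coordinate at \<open>v\<close> is constant on gluing classes. As the star is also
  open upstairs, its image in the realization is open.\<close>

lemma star_saturated: "{p \<in> topspace SS. q p \<in> q ` star v} = star v"
  by (auto simp: star_def) (metis bary_q)

lemma starD:
  assumes "(s, x) \<in> star v"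
  obtains j where "s \<in> simplices X" "x \<in> standard_simplex (simplex_dim s)" "j \<le> simplex_dim s"
    "simplex_vert X s j = v" "0 < x j"
proof -
  have *: "s \<in> simplices X" "x \<in> standard_simplex (simplex_dim s)" using assms by (auto simp: star_def topspace_SS)
  have "\<exists>j\<le>simplex_dim s. simplex_vert X s j = v \<and> 0 < x j"
  proof (rule ccontr)
    assume n: "\<not> ?thesis"
    have "bary v (s, x) \<le> 0" unfolding bary_def by (rule sum_nonpos) (use n in force)
    then show False using assms by (simp add: star_def)
  qed
  then show thesis using that * by blast
qed

lemma starI:
  assumes "s \<in> simplices X" "x \<in> standard_simplex (simplex_dim s)" "j \<le> simplex_dim s" "0 < x j"
  shows "(s, x) \<in> star (simplex_vert X s j)"
proof -
  let ?f = "\<lambda>i. if simplex_vert X s i = simplex_vert X s j then x i else 0"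
  have "?f j \<le> sum ?f {..simplex_dim s}"
    by (rule member_le_sum) (use assms(2,3) in \<open>auto simp: standard_simplex_def\<close>)
  then have "x j \<le> bary (simplex_vert X s j) (s, x)"
    unfolding bary_def fst_conv snd_conv by simp
  then show ?thesis using assms by (auto simp: star_def topspace_SS)
qed

lemma star_cover:
  assumes "p \<in> topspace SS" shows "\<exists>v\<in>verts X. p \<in> star v"
proof -
  obtain s x where p: "p = (s, x)" "s \<in> simplices X" "x \<in> standard_simplex (simplex_dim s)"
    using assms by (auto simp: topspace_SS)
  have "sum x {..simplex_dim s} = 1" using p(3) by (simp add: standard_simplex_def)
  then obtain j where "j \<le> simplex_dim s" "x j \<noteq> 0"
    by (metis atMost_iff sum.neutral zero_neq_one)
  moreover have "0 \<le> x j" using p(3) by (simp add: standard_simplex_def)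
  ultimately show ?thesis using starI[of s x j] simplex_vert_in[of s j] p by force
qed

lemma openin_star: "openin SS (star v)"
proof -
  have "openin (simplex_top (simplex_dim s)) {x. (s, x) \<in> star v}" if s: "s \<in> simplices X" for s
  proof -
    have "continuous_map (simplex_top (simplex_dim s)) euclideanreal (\<lambda>x. bary v (s, x))"
      unfolding bary_def fst_conv snd_conv
      by (intro continuous_map_sum) (auto simp: continuous_map_coordinate)
    then have "openin (simplex_top (simplex_dim s)) {x \<in> topspace (simplex_top (simplex_dim s)). bary v (s, x) \<in> {0<..}}"
      by (rule openin_continuous_map_preimage) simp
    moreover have "{x \<in> topspace (simplex_top (simplex_dim s)). bary v (s, x) \<in> {0<..}} = {x. (s, x) \<in> star v}"
      using s by (auto simp: star_def topspace_SS)
    ultimately show ?thesis by simp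
  qed
  moreover have "star v \<subseteq> topspace SS" by (auto simp: star_def)
  ultimately show ?thesis
    by (auto simp: simplex_space_def openin_sum_topology)
qed

lemma openin_q_star: "openin T (q ` star v)"
  using quotient_map_realization[of X] openin_star[of v] star_saturated[of v]
  by (simp add: quotient_map_saturated_open)

text \<open>The corner of \<open>s\<close> at \<open>v\<close>, expressed without choosing its
  number; it is a corner because \<open>v\<close> occurs at most once.\<close>

definition centre :: "'v \<Rightarrow> ('v, 'e) simplex \<Rightarrow> nat \<Rightarrow> real" where
  "centre v s = (\<lambda>i. if i \<le> simplex_dim s \<and> simplex_vert X s i = v then 1 else 0)"

definition cone :: "'v \<Rightarrow> ('v, 'e) simplex \<times> (nat \<Rightarrow> real) \<Rightarrow> real \<Rightarrow> ('v, 'e) simplex \<times> (nat \<Rightarrow> real)" where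
  "cone v p r = (fst p, segm (centre v (fst p)) (snd p) r)"

lemma centre_corner:
  assumes "s \<in> simplices X" "j \<le> simplex_dim s" shows "centre (simplex_vert X s j) s = corner j"
  using simplex_vert_inj[OF assms(1) _ assms(2)] assms(2) by (auto simp: centre_def corner_def)

text \<open>A positive coordinate at \<open>v\<close> forces \<open>v\<close> to be a vertex of the
  face as well, so the whole segment from the corner to the point lies in that face and is glued
  with it.\<close>

lemma cone_glue:
  assumes "glue X p p'" "0 < bary v p" "r \<in> {0..1}"
  shows "q (cone v p r) = q (cone v p' r)"
  using assms(1)
proof cases
  case (1 s i x)
  note F = face_simplex[OF 1(3,4,5)]
  have "p' \<in> star v"
    using 1 F(1,2) bary_glue[OF assms(1)] assms(2) by (auto simp: star_def topspace_SS)
  then obtain j where j: "j \<le> simplex_dim s - 1" "simplex_vert X (face X i s) j = v"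
    unfolding 1 by (elim starD) (simp add: F(2))
  have ji: "coface i j \<le> simplex_dim s" using j 1 by (auto simp: coface_def)
  have "centre v (face X i s) = corner j" using centre_corner[OF F(1), of j] j F(2) by simp
  moreover have "centre v s = corner (coface i j)"
    using centre_corner[OF 1(3) ji] F(3)[OF j(1)] j(2) by simp
  moreover have "q (s, simplical_face i (segm (corner j) x r)) = q (face X i s, segm (corner j) x r)"
    using 1 j assms(3) by (intro q_face segm_in corner_in)
  ultimately show ?thesis by (simp add: cone_def 1 simplical_face_segm simplical_face_corner)
qed

lemma cone_q:
  assumes "q p = q p'" "0 < bary v p" "r \<in> {0..1}"
  shows "q (cone v p r) = q (cone v p' r)"
proof -
  \<comment> \<open>The default value off the star makes the function total, hence testable on
    single gluings. A chain of gluings never leaves the star, because the coordinate at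
    \<open>v\<close> does not change along it.\<close>
  let ?f = "\<lambda>p. if 0 < bary v p then q (cone v p r) else {}"
  have "?f p = ?f p'"
    using assms(1) unfolding q_eq_iff
  proof (rule equivclp_invariant)
    fix x y assume g: "glue X x y"
    show "?f x = ?f y"
      using bary_glue[OF g, of v] cone_glue[OF g _ assms(3)] by presburger
  qed
  then show ?thesis using assms(2) bary_q[OF assms(1)] by simp
qed

definition contraction where
  "contraction v = (\<lambda>(y, r). q (cone v (SOME p. p \<in> star v \<and> q p = y) r))"

lemma contraction_q:
  assumes "p \<in> star v" "r \<in> {0..1}" shows "contraction v (q p, r) = q (cone v p r)"
proof -
  let ?p = "SOME p'. p' \<in> star v \<and> q p' = q p"
  have "?p \<in> star v \<and> q ?p = q p" 
    by (rule someI[of "\<lambda>p'. p' \<in> star v \<and> q p' = q p" p]) (use assms(1) in blast)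
  then have "q (cone v ?p r) = q (cone v p r)" using assms by (intro cone_q) (auto simp: star_def)
  then show ?thesis by (simp add: contraction_def)
qed

lemma cone_in: "p \<in> star v \<Longrightarrow> r \<in> {0..1} \<Longrightarrow> cone v p r \<in> topspace SS"
  by (cases p) (auto elim!: starD simp: cone_def topspace_SS centre_corner intro!: segm_in corner_in)

text \<open>The quotient map restricts to a quotient map over the open star, and its product with
  the identity of the interval is again a quotient map, as the interval is locally compact and
  Hausdorff. So continuity can be checked on each simplex times the interval, where the contraction
  is given by a formula.\<close>

lemma continuous_contraction:
  "continuous_map (prod_topology (subtopology T (q ` star v)) unit_top) T (contraction v)"
proof -
  have Q: "quotient_map (subtopology SS (star v)) (subtopology T (q ` star v)) q"
    by (rule quotient_map_restriction[OF quotient_map_realization star_saturated]) (use openin_q_star in blast)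
  have Q2: "quotient_map (prod_topology (subtopology SS (star v)) unit_top)
      (prod_topology (subtopology T (q ` star v)) unit_top) (\<lambda>(x, y). (q x, y))"
    by (rule quotient_map_prod_left[OF _ _ Q])
       (auto intro: compact_imp_locally_compact_space Hausdorff_space_subtopology
         simp: compact_space_subtopology compactin_euclidean_iff)
  have star: "star v = Sigma (simplices X) (\<lambda>s. {x. (s, x) \<in> star v})" by (auto simp: star_def topspace_SS)
  have sub: "subtopology SS (star v) =
      sum_topology (\<lambda>s. subtopology (simplex_top (simplex_dim s)) {x. (s, x) \<in> star v}) (simplices X)"
    by (subst star) (simp add: simplex_space_def subtopology_sum_topology)
  have "continuous_map (prod_topology (subtopology SS (star v)) unit_top) T (\<lambda>(p, r). q (cone v p r))"
    unfolding sub
  proof (rule continuous_map_prod_sum_topology)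
    fix s assume s: "s \<in> simplices X"
    let ?S = "subtopology (simplex_top (simplex_dim s)) {x. (s, x) \<in> star v}"
    let ?P = "prod_topology ?S unit_top"
    have "continuous_map ?P (simplex_top (simplex_dim s)) (\<lambda>z. segm (centre v s) (fst z) (snd z))"
    proof (rule continuous_map_into_simplex)
      have "continuous_map ?P euclideanreal ((\<lambda>x. x i) \<circ> fst)" for i
        by (rule continuous_map_compose[OF continuous_map_fst])
           (intro continuous_map_from_subtopology continuous_map_coordinate)
      moreover have "continuous_map ?P euclideanreal snd"
        by (rule continuous_map_into_fulltopology[OF continuous_map_snd])
      ultimately show "continuous_map ?P euclideanreal (\<lambda>z. segm (centre v s) (fst z) (snd z) i)" for i
        unfolding segm_def o_def by (intro continuous_intros) auto
      show "(\<lambda>z. segm (centre v s) (fst z) (snd z)) \<in> topspace ?P \<rightarrow> standard_simplex (simplex_dim s)"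
        using cone_in[of "(s, _)" v] s by (auto simp: cone_def topspace_SS)
    qed
    moreover have "continuous_map (simplex_top (simplex_dim s)) T (q \<circ> Pair s)"
      using continuous_map_component_injection[of s "simplices X" "\<lambda>s. simplex_top (simplex_dim s)", OF s] q_continuous
      unfolding simplex_space_def by (rule continuous_map_compose)
    ultimately have "continuous_map ?P T ((q \<circ> Pair s) \<circ> (\<lambda>z. segm (centre v s) (fst z) (snd z)))"
      by (rule continuous_map_compose)
    then show "continuous_map ?P T (\<lambda>(x, r). case ((s, x), r) of (p, r) \<Rightarrow> q (cone v p r))"
      by (simp add: o_def cone_def case_prod_unfold)
  qed
  then have "continuous_map (prod_topology (subtopology SS (star v)) unit_top) T (contraction v \<circ> (\<lambda>(x, y). (q x, y)))"
    by (rule continuous_map_eq) (auto simp: contraction_q)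
  then show ?thesis by (rule continuous_compose_quotient_map[OF Q2])
qed

definition radius :: "'v \<Rightarrow> (('v, 'e) simplex \<times> (nat \<Rightarrow> real)) set \<Rightarrow> real \<Rightarrow> (('v, 'e) simplex \<times> (nat \<Rightarrow> real)) set" where
  "radius v y = (\<lambda>r. contraction v (y, r))"

lemma radius_q:
  assumes "(s, x) \<in> star v" "j \<le> simplex_dim s" "simplex_vert X s j = v" "r \<in> {0..1}"
  shows "radius v (q (s, x)) r = q (s, segm (corner j) x r)"
proof -
  have "s \<in> simplices X" using assms(1) by (auto simp: star_def topspace_SS)
  then show ?thesis
    using contraction_q[OF assms(1,4)] centre_corner[of s j] assms(2,3) by (simp add: radius_def cone_def)
qed

lemma star_q_topspace: "y \<in> q ` star v \<Longrightarrow> y \<in> topspace T"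
  using q_image by (auto simp: star_def)

lemma contraction_pair:
  assumes "continuous_map Z T f" "f \<in> topspace Z \<rightarrow> q ` star v" "continuous_map Z unit_top g"
  shows "continuous_map Z T (\<lambda>z. contraction v (f z, g z))"
  using continuous_map_compose[OF _ continuous_contraction[of v], of Z "\<lambda>z. (f z, g z)"] assms
  by (simp add: o_def continuous_map_pairwise continuous_map_in_subtopology image_subset_iff_funcset)

lemma radius_ends:
  assumes "y \<in> q ` star v" shows "radius v y 0 = vpt v" "radius v y 1 = y"
proof -
  obtain s x where y: "y = q (s, x)" "(s, x) \<in> star v" using assms by auto
  obtain j where j: "s \<in> simplices X" "j \<le> simplex_dim s" "simplex_vert X s j = v"
    using y(2) by (rule starD)
  show "radius v y 0 = vpt v" "radius v y 1 = y"
    using radius_q[OF y(2) j(2,3)] q_corner[OF j(1,2)] j(3) y(1) by simp_all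
qed

lemma pathin_radius: "y \<in> q ` star v \<Longrightarrow> pathin T (radius v y)"
  unfolding pathin_def radius_def by (intro contraction_pair) (auto simp: star_q_topspace)

text \<open>The homotopy is the contraction of the star, applied to the points of the path.\<close>

lemma radius_slide:
  assumes c: "pathin T c" "c \<in> {0..1} \<rightarrow> q ` star v"
  shows "hpath T (pjoin (radius v (c 0)) c) (radius v (c 1))"
proof -
  let ?C = "{0..1} \<times> {0..1} :: (real \<times> real) set"
  define F where "F = (\<lambda>z. contraction v (c (snd z), fst z))"
  have cst: "c t \<in> q ` star v" if "t \<in> {0..1}" for t using c(2) that by (rule funcset_mem)
  have F: "continuous_map (top_of_set ?C) T F"
    unfolding F_def
  proof (rule contraction_pair)
    have "continuous_map (top_of_set ?C) T (c \<circ> snd)"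
      by (rule continuous_map_compose[OF _ c(1)[unfolded pathin_def]])
        (auto simp: continuous_map_in_subtopology intro!: continuous_intros)
    then show "continuous_map (top_of_set ?C) T (\<lambda>z. c (snd z))" by (simp add: o_def)
    show "continuous_map (top_of_set ?C) unit_top fst"
      by (auto simp: continuous_map_in_subtopology intro!: continuous_intros)
  qed (auto intro!: cst)
  \<comment> \<open>The sides of the square of pairs (contraction parameter, path parameter). Both
    \<open>?l\<close> followed by \<open>?m\<close> and \<open>?n\<close> followed by
    \<open>?o\<close> run from (0, 0) to (1, 1), and \<open>?n\<close> is mapped to the constant
    path at the vertex.\<close>
  let ?l = "\<lambda>r. (r, 0::real)" and ?m = "\<lambda>t. (1::real, t)" and ?n = "\<lambda>t. (0::real, t)" and ?o = "\<lambda>r. (r, 1::real)"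
  have "hpath T (F \<circ> pjoin ?l ?m) (F \<circ> pjoin ?n ?o)"
    by (rule hpath_convex[OF _ F] ; (intro pjoin_continuous_on pjoin_funcset convex_Times)?)
       (auto intro!: continuous_intros)
  moreover have "F \<circ> ?l = radius v (c 0)" "F \<circ> ?o = radius v (c 1)"
    by (simp_all add: F_def radius_def o_def)
  moreover have "(F \<circ> ?n) t = vpt v" "(F \<circ> ?m) t = c t" if "t \<in> {0..1}" for t
    using radius_ends[OF cst[OF that]] by (simp_all add: F_def radius_def)
  ultimately have 1: "hpath T (pjoin (radius v (c 0)) (F \<circ> ?m)) (pjoin (F \<circ> ?n) (radius v (c 1)))"
    and Fm: "\<And>t. t \<in> {0..1} \<Longrightarrow> (F \<circ> ?m) t = c t" and Fn: "\<And>t. t \<in> {0..1} \<Longrightarrow> (F \<circ> ?n) t = vpt v"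
    by (simp_all only: comp_pjoin)
  have pr: "pathin T (radius v (c 0))" "pathin T (radius v (c 1))" using cst by (auto intro: pathin_radius)
  have e0: "radius v (c 0) 1 = c 0" "radius v (c 1) 0 = vpt v" using radius_ends cst by auto
  have "hpath T (pjoin (radius v (c 0)) c) (pjoin (radius v (c 0)) (F \<circ> ?m))"
    using pr e0 c(1) Fm by (intro hpath_join hpath_eqI) auto
  also note 1
  also have "hpath T (pjoin (F \<circ> ?n) (radius v (c 1))) (pjoin (\<lambda>_. radius v (c 1) 0) (radius v (c 1)))"
  proof (intro hpath_join)
    have "pathin T (F \<circ> ?n)"
      by (rule pathin_comp[OF F]) (auto intro!: continuous_intros)
    then show "hpath T (F \<circ> ?n) (\<lambda>_. radius v (c 1) 0)"
      using Fn e0 by (intro hpath_eqI) auto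
  qed (use pr Fn[of 1] e0 in auto)
  also have "hpath T \<dots> (radius v (c 1))" using pr by (intro hpath_const_join)
  finally show ?thesis .
qed

section \<open>Paths inside simplices and along edges\<close>

lemma hpath_triangle:
  assumes s: "s \<in> simplices X"
    and xyz: "x \<in> standard_simplex (simplex_dim s)" "y \<in> standard_simplex (simplex_dim s)" "z \<in> standard_simplex (simplex_dim s)"
  shows "hpath T (pjoin (\<lambda>r. q (s, segm x y r)) (\<lambda>r. q (s, segm y z r))) (\<lambda>r. q (s, segm x z r))"
proof -
  let ?n = "simplex_dim s"
  let ?C = "{u :: real \<times> real. 0 \<le> fst u \<and> 0 \<le> snd u \<and> fst u + snd u \<le> 1}"
  define f where "f = (\<lambda>u::real\<times>real. \<lambda>i. (1 - fst u - snd u) * x i + fst u * y i + snd u * z i)"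
  have in_s: "f u \<in> standard_simplex ?n" if "u \<in> ?C" for u
  proof (cases "fst u + snd u = 0")
    case True
    then have "fst u = 0" "snd u = 0" using that by auto
    then have "f u = x" by (simp add: f_def)
    then show ?thesis using xyz by simp
  next
    case False
    \<comment> \<open>The affine combination is rewritten as a point at distance \<open>t\<close> on
      the segment from \<open>x\<close> to a point of the segment from \<open>y\<close> to
      \<open>z\<close>, so that \<open>segm_in\<close> applies twice. The excluded case
      \<open>t = 0\<close> is the corner \<open>x\<close>.\<close>
    define t where "t = fst u + snd u"
    have t: "0 < t" "t \<le> 1" using False that by (auto simp: t_def)
    define a where "a = snd u / t"
    have a: "a \<in> {0..1}" "t * a = snd u" "t * (1 - a) = fst u"
      using that t by (auto simp: a_def t_def field_simps)
    have "segm x (segm y z a) t \<in> standard_simplex ?n"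
      using xyz t a(1) by (intro segm_in) auto
    moreover have "segm x (segm y z a) t = f u"
    proof
      fix i
      have "t * ((1 - a) * y i + a * z i) = (t * (1 - a)) * y i + (t * a) * z i" by (simp add: algebra_simps)
      then show "segm x (segm y z a) t i = f u i" unfolding a(2,3) by (simp add: segm_def f_def t_def diff_diff_eq)
    qed
    ultimately show ?thesis by simp
  qed
  have "continuous_map (top_of_set ?C) (simplex_top ?n) f"
    by (rule continuous_map_into_simplex) (use in_s in \<open>auto simp: f_def intro!: continuous_intros\<close>)
  moreover have "continuous_map (simplex_top ?n) T (q \<circ> Pair s)"
    using continuous_map_component_injection[of s "simplices X" "\<lambda>s. simplex_top (simplex_dim s)", OF s] q_continuous
    unfolding simplex_space_def by (rule continuous_map_compose)
  ultimately have F: "continuous_map (top_of_set ?C) T ((q \<circ> Pair s) \<circ> f)"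
    by (rule continuous_map_compose)
  have C: "convex ?C"
  proof (rule convexI)
    fix a b :: "real \<times> real" and u v :: real
    assume *: "a \<in> ?C" "b \<in> ?C" "0 \<le> u" "0 \<le> v" "u + v = 1"
    then have "u * (fst a + snd a) + v * (fst b + snd b) \<le> 1" by (intro convex_bound_le) auto
    then show "u *\<^sub>R a + v *\<^sub>R b \<in> ?C" using * by (simp add: algebra_simps)
  qed
  have "hpath T (((q \<circ> Pair s) \<circ> f) \<circ> pjoin (\<lambda>r. (r, 0)) (\<lambda>r. (1 - r, r))) (((q \<circ> Pair s) \<circ> f) \<circ> (\<lambda>r. (0, r)))"
    by (rule hpath_convex[OF C F] ; (intro pjoin_continuous_on pjoin_funcset)?) (auto intro!: continuous_intros)
  moreover have "((q \<circ> Pair s) \<circ> f) \<circ> (\<lambda>r. (r, 0)) = (\<lambda>r. q (s, segm x y r))"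
    "((q \<circ> Pair s) \<circ> f) \<circ> (\<lambda>r. (1 - r, r)) = (\<lambda>r. q (s, segm y z r))"
    "((q \<circ> Pair s) \<circ> f) \<circ> (\<lambda>r. (0, r)) = (\<lambda>r. q (s, segm x z r))"
    by (simp_all add: o_def f_def segm_def)
  ultimately show ?thesis by (simp only: comp_pjoin)
qed

lemma pathin_segm:
  assumes "s \<in> simplices X" "x \<in> standard_simplex (simplex_dim s)" "y \<in> standard_simplex (simplex_dim s)"
  shows "pathin T (\<lambda>r. q (s, segm x y r))"
  using hpath_triangle[OF assms(1,2,3,3)] hpath_imp_pathin by blast

lemma edge_simplex: "a \<in> edges X \<Longrightarrow> Chain [a] \<in> simplices X"
  by (auto simp: simplices_def)

lemma pathin_epath: "a \<in> edges X \<Longrightarrow> pathin T (epath a)"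
  unfolding epath_def using pathin_segm[OF edge_simplex] corner_in by simp

lemma epath_ends:
  assumes "a \<in> edges X" shows "epath a 0 = vpt (src X a)" "epath a 1 = vpt (tgt X a)"
  using q_corner[OF edge_simplex[OF assms], of 1] q_corner[OF edge_simplex[OF assms], of 0]
  by (simp_all add: epath_def)

text \<open>The edges \<open>b\<close>, \<open>cmp X a b\<close> and \<open>a\<close> are the faces
  0, 1 and 2 of the 2-simplex \<open>Chain [a, b]\<close>, whose vertices 2, 1, 0 are the source of
  \<open>b\<close>, the middle vertex and the target of \<open>a\<close>.\<close>

lemma hpath_epath_cmp:
  assumes "composable X a b"
  shows "hpath T (pjoin (epath b) (epath a)) (epath (cmp X a b))"
proof -
  let ?s = "Chain [a, b]"
  have s: "?s \<in> simplices X" using assms by (auto simp: simplices_def composable_def less_Suc_eq)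
  have *: "q (face X i ?s, segm (corner k) (corner l) r) = q (?s, segm (corner (coface i k)) (corner (coface i l)) r)"
    if "i \<le> 2" "r \<in> {0..1}" "k \<le> 1" "l \<le> 1" for i k l r
    unfolding simplical_face_corner[symmetric] simplical_face_segm[symmetric]
    by (rule q_face[OF s, symmetric]) (use that in \<open>auto intro!: segm_in corner_in\<close>)
  have E: "a \<in> edges X" "b \<in> edges X" "cmp X a b \<in> edges X" "src X a = tgt X b"
    using assms cmp_in by (auto simp: composable_def)
  have f: "face X 0 ?s = Chain [b]" "face X 1 ?s = Chain [cmp X a b]" "face X 2 ?s = Chain [a]" by simp_all
  have ends: "epath b 1 = epath a 0" using E by (simp add: epath_ends)
  have b: "hpath T (epath b) (\<lambda>r. q (?s, segm (corner 2) (corner 1) r))"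
    using *[of 0 _ 1 0] pathin_epath[OF E(2)]
    by (intro hpath_eqI) (auto simp: epath_def coface_def numeral_2_eq_2)
  have a: "hpath T (epath a) (\<lambda>r. q (?s, segm (corner 1) (corner 0) r))"
    using *[of 2 _ 1 0] pathin_epath[OF E(1)]
    by (intro hpath_eqI) (auto simp: epath_def coface_def numeral_2_eq_2)
  have "hpath T (pjoin (epath b) (epath a)) (pjoin (\<lambda>r. q (?s, segm (corner 2) (corner 1) r)) (\<lambda>r. q (?s, segm (corner 1) (corner 0) r)))"
    by (rule hpath_join[OF b a ends])
  also have "hpath T \<dots> (\<lambda>r. q (?s, segm (corner 2) (corner 0) r))"
    by (rule hpath_triangle[OF s]) (auto intro!: corner_in)
  also have "hpath T \<dots> (epath (cmp X a b))"
    using *[of 1 _ 1 0] pathin_epath[OF E(3)]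
    by (intro hpath_sym[OF hpath_eqI]) (auto simp: epath_def coface_def numeral_2_eq_2)
  finally show ?thesis .
qed

lemma pathin_const: "y \<in> topspace T \<Longrightarrow> pathin T (\<lambda>_. y)"
  by (simp add: pathin_def)

lemma vpt_in: "v \<in> verts X \<Longrightarrow> vpt v \<in> topspace T"
  using q_image corner_in[of 0 0] by (force simp: vpt_def topspace_SS simplices_def)

end

section \<open>A criterion for simple connectivity\<close>

context scwol
begin

context
  fixes z :: "(('v, 'e) simplex \<times> (nat \<Rightarrow> real)) set" and K
  assumes K: "\<And>v. v \<in> verts X \<Longrightarrow> pathin T (K v)" "\<And>v. v \<in> verts X \<Longrightarrow> K v 0 = z"
      "\<And>v. v \<in> verts X \<Longrightarrow> K v 1 = vpt v"
    and K_edge: "\<And>a. a \<in> edges X \<Longrightarrow> hpath T (pjoin (K (src X a)) (epath a)) (K (tgt X a))"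
begin

text \<open>A reference path to a point of the star of \<open>v\<close>: along \<open>K v\<close> to
  the vertex, then along the radius. Up to homotopy it will not depend on the star used.\<close>

definition pathto where
  "pathto v y = pjoin (K v) (radius v y)"

lemma pathto:
  assumes "v \<in> verts X" "y \<in> q ` star v"
  shows "pathin T (pathto v y)" "pathto v y 0 = z" "pathto v y 1 = y"
  using assms K radius_ends[OF assms(2)] pathin_radius[OF assms(2)]
  by (auto simp: pathto_def intro!: pathin_pjoin)

text \<open>In the triangle with corners \<open>j'\<close>, \<open>j\<close> and the point
  \<open>x\<close>, the radius from \<open>v'\<close> is homotopic to the edge from
  \<open>v'\<close> to \<open>v\<close> followed by the radius from \<open>v\<close>; compatibility
  of \<open>K\<close> with that edge absorbs it.\<close>

lemma pathto_edge:
  assumes p: "(s, x) \<in> star v" "(s, x) \<in> star v'"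
    and j: "j \<le> simplex_dim s" "simplex_vert X s j = v" "j' \<le> simplex_dim s" "simplex_vert X s j' = v'" "j < j'"
  shows "hpath T (pathto v' (q (s, x))) (pathto v (q (s, x)))"
proof -
  let ?y = "q (s, x)"
  have s: "s \<in> simplices X" "x \<in> standard_simplex (simplex_dim s)" using p(1) by (auto simp: star_def topspace_SS)
  have V: "v \<in> verts X" "v' \<in> verts X" using simplex_vert_in[OF s(1)] j by auto
  have y: "?y \<in> q ` star v" "?y \<in> q ` star v'" using p by auto
  obtain a where a: "a \<in> edges X" "src X a = v'" "tgt X a = v"
    "\<And>r. r \<in> {0..1} \<Longrightarrow> q (s, segm (corner j') (corner j) r) = epath a r"
    using q_segm_edge[OF s(1) j(5,3)] j by auto
  have "hpath T (radius v' ?y) (\<lambda>r. q (s, segm (corner j') x r))"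
    using pathin_radius[OF y(2)] radius_q[OF p(2) j(3,4)] by (intro hpath_eqI) auto
  also have "hpath T \<dots> (pjoin (\<lambda>r. q (s, segm (corner j') (corner j) r)) (\<lambda>r. q (s, segm (corner j) x r)))"
    by (rule hpath_sym[OF hpath_triangle[OF s(1)]]) (use s j corner_in in auto)
  also have "hpath T \<dots> (pjoin (epath a) (radius v ?y))"
  proof (rule hpath_join)
    show "hpath T (\<lambda>r. q (s, segm (corner j') (corner j) r)) (epath a)"
      using a(4) s(1) j corner_in by (intro hpath_eqI pathin_segm) auto
    show "hpath T (\<lambda>r. q (s, segm (corner j) x r)) (radius v ?y)"
      using radius_q[OF p(1) j(1,2)] s j corner_in by (intro hpath_eqI pathin_segm) auto
  qed simp
  finally have r: "hpath T (radius v' ?y) (pjoin (epath a) (radius v ?y))" .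
  have e: "pathin T (epath a)" "epath a 0 = vpt v'" "epath a 1 = vpt v"
    using pathin_epath epath_ends a by auto
  note re = radius_ends[OF y(1)] radius_ends[OF y(2)] pathin_radius[OF y(1)] pathin_radius[OF y(2)]
  have "hpath T (pathto v' ?y) (pjoin (K v') (pjoin (epath a) (radius v ?y)))"
    unfolding pathto_def using K V re by (intro hpath_join r) auto
  also have "hpath T \<dots> (pjoin (pjoin (K v') (epath a)) (radius v ?y))"
    using K V re e by (intro hpath_sym[OF hpath_assoc]) auto
  also have "hpath T \<dots> (pathto v ?y)"
    unfolding pathto_def using K_edge[OF a(1)] a re e by (intro hpath_join) auto
  finally show ?thesis .
qed

lemma pathto_unique:
  assumes "y \<in> q ` star v" "y \<in> q ` star v'" "v \<in> verts X"
  shows "hpath T (pathto v y) (pathto v' y)"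
proof -
  obtain s x where y: "y = q (s, x)" and p: "(s, x) \<in> star v" using assms(1) by auto
  have "(s, x) \<in> topspace SS" "q (s, x) \<in> q ` star v'" using p assms(2) y by (simp_all add: star_def)
  then have p': "(s, x) \<in> star v'" using star_saturated[of v'] by blast
  obtain j where j: "s \<in> simplices X" "j \<le> simplex_dim s" "simplex_vert X s j = v" using p by (rule starD)
  obtain j' where j': "j' \<le> simplex_dim s" "simplex_vert X s j' = v'" using p' by (rule starD)
  consider "j < j'" | "j = j'" | "j' < j" by linarith
  then show ?thesis
  proof cases
    case 1
    show ?thesis unfolding y by (rule hpath_sym[OF pathto_edge[OF p p' j(2,3) j' 1]])
  next
    case 2
    then have "v = v'" using j(3) j'(2) by simp
    then show ?thesis using pathto(1)[OF assms(3,1)] by simp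
  next
    case 3
    show ?thesis unfolding y by (rule pathto_edge[OF p' p j' j(2,3) 3])
  qed
qed

lemma star_cover_point:
  assumes "y \<in> topspace T" shows "\<exists>v\<in>verts X. y \<in> q ` star v"
proof -
  obtain p where "p \<in> topspace SS" "y = q p" using assms unfolding q_image[symmetric] by (rule imageE)
  then show ?thesis using star_cover by fast
qed

text \<open>Near each parameter the path stays in one star, where \<open>radius_slide\<close>
  absorbs a piece of it into the reference path. Hence the property \<open>P\<close> is locally
  constant in the parameter, and the unit interval is connected.\<close>

lemma pathto_path:
  assumes p: "pathin T p" and v: "v \<in> verts X" "p 0 \<in> q ` star v" "v' \<in> verts X" "p 1 \<in> q ` star v'"
  shows "hpath T (pjoin (pathto v (p 0)) p) (pathto v' (p 1))"
proof -
  let ?g = "pathto v (p 0)"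
  \<comment> \<open>Quantifying over all stars that contain \<open>p t\<close> builds the change of
    star into the property.\<close>
  define P where "P t \<longleftrightarrow> (\<forall>u\<in>verts X. p t \<in> q ` star u \<longrightarrow> hpath T (pjoin ?g (psub p 0 t)) (pathto u (p t)))" for t
  note g = pathto[OF v(1,2)]
  have pT: "p t \<in> topspace T" if "t \<in> {0..1}" for t
    using continuous_map_funspace[OF p[unfolded pathin_def]] by (rule funcset_mem) (use that in simp)
  have "P 1"
  proof (rule connected_induction_simple[where S = "{0..1}" and P = P and a = 0 and b = 1])
    show "P 0"
      unfolding P_def
    proof (intro ballI impI)
      fix u assume u: "u \<in> verts X" "p 0 \<in> q ` star u"
      have "psub p 0 0 = (\<lambda>_. ?g 1)" using g(3) by (simp add: psub_def linepath_def o_def)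
      then have "hpath T (pjoin ?g (psub p 0 0)) ?g" using hpath_const_join(2)[OF g(1)] by simp
      also have "hpath T ?g (pathto u (p 0))" by (rule pathto_unique[OF v(2) u(2) v(1)])
      finally show "hpath T (pjoin ?g (psub p 0 0)) (pathto u (p 0))" .
    qed
    fix t0 :: real assume t0: "t0 \<in> {0..1}"
    obtain u where u: "u \<in> verts X" "p t0 \<in> q ` star u" using star_cover_point[OF pT[OF t0]] by blast
    let ?U = "{t \<in> {0..1}. p t \<in> q ` star u}"
    have "openin unit_top ?U"
      using openin_continuous_map_preimage[OF p[unfolded pathin_def] openin_q_star[of u]] by simp
    then obtain e where e: "e > 0" "\<And>t. t \<in> {0..1} \<Longrightarrow> dist t t0 < e \<Longrightarrow> p t \<in> q ` star u"
      using t0 u(2) unfolding openin_euclidean_subtopology_iff by (metis (mono_tags, lifting) mem_Collect_eq)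
    have "P t'" if t: "t \<in> {0..1} \<inter> ball t0 e" "t' \<in> {0..1} \<inter> ball t0 e" "P t" for t t'
      unfolding P_def
    proof (intro ballI impI)
      fix w assume w: "w \<in> verts X" "p t' \<in> q ` star w"
      let ?c = "psub p t t'"
      have t01: "t \<in> {0..1}" "t' \<in> {0..1}" "0 \<in> {0..1::real}" using t by auto
      have ct: "pathin T ?c" "pathin T (psub p 0 t)" using pathin_psub[OF p] t01 by auto
      have cu: "?c \<in> {0..1} \<rightarrow> q ` star u"
      proof
        fix r :: real assume r: "r \<in> {0..1}"
        \<comment> \<open>Convexity keeps the piece of \<open>p\<close> between \<open>t\<close> and
          \<open>t'\<close> inside the star of \<open>u\<close>, whichever of the two comes
          first.\<close>
        have "convex ({0..1} \<inter> ball t0 e)" by (intro convex_Int convex_ball convex_real_interval)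
        with t(1,2) have "closed_segment t t' \<subseteq> {0..1} \<inter> ball t0 e" by (rule closed_segment_subset)
        then have "linepath t t' r \<in> {0..1} \<inter> ball t0 e" using linepath_in_path[OF r] by (rule subsetD)
        then show "?c r \<in> q ` star u" using e(2) by (auto simp: psub_def dist_commute)
      qed
      have pt: "p t \<in> q ` star u" "p t' \<in> q ` star u" using e(2) t by (auto simp: dist_commute)
      note rd = radius_ends[OF pt(1)] pathin_radius[OF pt(1)]
      have "hpath T (pjoin ?g (psub p 0 t')) (pjoin ?g (pjoin (psub p 0 t) ?c))"
        using hpath_psub_join[OF p, of 0 t t'] t01 g by (intro hpath_join hpath_sym[OF hpath_psub_join[OF p]]) auto
      also have "hpath T \<dots> (pjoin (pjoin ?g (psub p 0 t)) ?c)"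
        using g ct by (intro hpath_sym[OF hpath_assoc]) auto
      also have "hpath T \<dots> (pjoin (pathto u (p t)) ?c)"
        using t(3) u pt ct by (intro hpath_join) (auto simp: P_def)
      also have "hpath T \<dots> (pjoin (K u) (pjoin (radius u (p t)) ?c))"
        unfolding pathto_def using K u ct rd by (intro hpath_assoc) auto
      also have "hpath T \<dots> (pathto u (p t'))"
        unfolding pathto_def using radius_slide[OF ct(1) cu] K u rd by (intro hpath_join) auto
      also have "hpath T \<dots> (pathto w (p t'))" by (rule pathto_unique[OF pt(2) w(2) u(1)])
      finally show "hpath T (pjoin ?g (psub p 0 t')) (pathto w (p t'))" .
    qed
    moreover have "openin unit_top ({0..1} \<inter> ball t0 e)" by (simp add: openin_open_Int)
    moreover have "t0 \<in> {0..1} \<inter> ball t0 e" using t0 e(1) by simp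
    ultimately show "\<exists>U. openin unit_top U \<and> t0 \<in> U \<and> (\<forall>x\<in>U. \<forall>y\<in>U. P x \<longrightarrow> P y)" by meson
  qed auto
  then have "hpath T (pjoin ?g (psub p 0 1)) (pathto v' (p 1))" using v(3,4) by (simp add: P_def)
  moreover have "psub p 0 1 = p" by (simp add: psub_def linepath_def o_def)
  ultimately show ?thesis by metis
qed

text \<open>For a loop both reference paths can be taken equal, and cancelling them contracts the
  loop to its base point. A free homotopy must also move that base point to \<open>z\<close>, so
  that loops with different base points become comparable.\<close>

lemma loop_null_homotopic:
  assumes p: "pathin T p" "p 1 = p 0"
  shows "homotopic_with (\<lambda>r. r 1 = r 0) unit_top T p (\<lambda>_. z)"
proof -
  have pT: "p 0 \<in> topspace T"
    using continuous_map_funspace[OF p(1)[unfolded pathin_def]] by (rule funcset_mem) simp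
  obtain v where v: "v \<in> verts X" "p 0 \<in> q ` star v" using star_cover_point[OF pT] by blast
  let ?g = "pathto v (p 0)"
  note g = pathto[OF v]
  have "hpath T (pjoin ?g p) ?g" using pathto_path[OF p(1) v v(1)] v p by simp
  also have "hpath T \<dots> (pjoin ?g (\<lambda>_. p 0))" using hpath_sym[OF hpath_const_join(2)[OF g(1)]] g(3) by simp
  finally have "hpath T p (\<lambda>_. p 0)"
    using g p pT by (elim hpath_cancel_left) (auto intro: pathin_const)
  then have "homotopic_with (\<lambda>r. r 1 = r 0) unit_top T p (\<lambda>_. p 0)"
    unfolding hpath_def using p(2) by (auto elim!: homotopic_with_mono)
  moreover have "homotopic_with (\<lambda>r. r 1 = r 0) unit_top T (\<lambda>_. z) (\<lambda>_. p 0)"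
    unfolding homotopic_with_def
  \<comment> \<open>Every stage is a constant loop, at a point that travels along the reference
    path.\<close>
  proof (intro exI[of _ "?g \<circ> fst"] conjI)
    show "continuous_map (prod_topology unit_top unit_top) T (?g \<circ> fst)"
      by (rule continuous_map_compose[OF continuous_map_fst g(1)[unfolded pathin_def]])
  qed (use g in auto)
  ultimately show ?thesis using homotopic_with_symD homotopic_with_trans by blast
qed

lemma simply_connected_if_compatible_paths: "simply_connected_scwol X"
  unfolding simply_connected_scwol_def simply_connected_space_def
  using loop_null_homotopic homotopic_with_symD homotopic_with_trans by blast

end

text \<open>
  On a universal cover every local system of sets has sections through each element over a base
  vertex. Applied to the homotopy classes of paths from that vertex, this gives compatible paths.
\<close>

definition has_sections :: "'s itself \<Rightarrow> 'v \<Rightarrow> bool" where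
  "has_sections _ v0 \<longleftrightarrow>
    (\<forall>(S :: 'v \<Rightarrow> 's set) \<rho> s0.
       (\<forall>a\<in>edges X. bij_betw (\<rho> a) (S (src X a)) (S (tgt X a))) \<longrightarrow>
       (\<forall>a b. composable X a b \<longrightarrow> (\<forall>c\<in>S (src X b). \<rho> (cmp X a b) c = \<rho> a (\<rho> b c))) \<longrightarrow> s0 \<in> S v0 \<longrightarrow>
       (\<exists>s. (\<forall>v\<in>verts X. s v \<in> S v) \<and> (\<forall>a\<in>edges X. \<rho> a (s (src X a)) = s (tgt X a))))"

lemma simply_connected_if_sections:
  assumes v0: "v0 \<in> verts X"
    and sec: "has_sections TYPE((real \<Rightarrow> (('v, 'e) simplex \<times> (nat \<Rightarrow> real)) set) set) v0"
  shows "simply_connected_scwol X"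
proof -
  define cls where "cls p = {p'. hpath T p p'}" for p
  have cls_eq: "cls p = cls p' \<longleftrightarrow> hpath T p p'" if "pathin T p'" for p p'
  proof
    assume "cls p = cls p'"
    moreover have "p' \<in> cls p'" using that by (simp add: cls_def)
    ultimately have "p' \<in> cls p" by metis
    then show "hpath T p p'" by (simp add: cls_def)
  next
    assume "hpath T p p'"
    then show "cls p = cls p'" unfolding cls_def by (blast intro: hpath_trans hpath_sym)
  qed
  define S where "S v = {cls p | p. pathin T p \<and> p 0 = vpt v0 \<and> p 1 = vpt v}" for v
  \<comment> \<open>The union runs over all representatives of the class; they all give the same
    class, so it is a single one.\<close>
  define \<rho> where "\<rho> a c = (\<Union>p\<in>c. cls (pjoin p (epath a)))" for a c
  have \<rho>: "\<rho> a (cls p) = cls (pjoin p (epath a))"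
    if a: "a \<in> edges X" and p: "pathin T p" "p 1 = vpt (src X a)" for a p
  proof -
    have "cls (pjoin p' (epath a)) = cls (pjoin p (epath a))" if "p' \<in> cls p" for p'
    proof -
      have h: "hpath T p' p" using that by (simp add: cls_def hpath_sym)
      have e: "p' 1 = epath a 0" using hpath_imp_ends[OF h] p epath_ends[OF a] by simp
      have "hpath T (pjoin p' (epath a)) (pjoin p (epath a))"
        using h e pathin_epath[OF a] by (intro hpath_join) auto
      then show ?thesis using hpath_imp_pathin by (subst cls_eq) auto
    qed
    moreover have "p \<in> cls p" using p by (simp add: cls_def)
    ultimately show ?thesis unfolding \<rho>_def by blast
  qed
  have pj: "pathin T (pjoin p (epath a))" if "a \<in> edges X" "pathin T p" "p 1 = vpt (src X a)" for a p
    using that pathin_epath epath_ends by (intro pathin_pjoin) auto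
  have bij: "bij_betw (\<rho> a) (S (src X a)) (S (tgt X a))" if a: "a \<in> edges X" for a
    unfolding bij_betw_def
  proof
    note e = pathin_epath[OF a] epath_ends[OF a]
    show "inj_on (\<rho> a) (S (src X a))"
    proof (rule inj_onI)
      fix c d assume "c \<in> S (src X a)" "d \<in> S (src X a)" and eq: "\<rho> a c = \<rho> a d"
      then obtain p p' where p: "c = cls p" "pathin T p" "p 1 = vpt (src X a)"
        and p': "d = cls p'" "pathin T p'" "p' 1 = vpt (src X a)" by (auto simp: S_def)
      have "hpath T (pjoin p (epath a)) (pjoin p' (epath a))"
        using eq p p' pj[OF a] by (simp add: \<rho>[OF a] cls_eq)
      then have "hpath T p p'" using p p' e by (elim hpath_cancel_right) auto
      then show "c = d" using p p' by (simp add: cls_eq)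
    qed
    show "\<rho> a ` S (src X a) = S (tgt X a)"
    proof (intro equalityI subsetI)
      fix d assume "d \<in> \<rho> a ` S (src X a)"
      then obtain p where "d = \<rho> a (cls p)" "pathin T p" "p 0 = vpt v0" "p 1 = vpt (src X a)" by (auto simp: S_def)
      then show "d \<in> S (tgt X a)" using e pj[OF a] \<rho>[OF a] by (auto simp: S_def)
    next
      fix d assume "d \<in> S (tgt X a)"
      then obtain p where p: "d = cls p" "pathin T p" "p 0 = vpt v0" "p 1 = vpt (tgt X a)" by (auto simp: S_def)
      let ?p = "pjoin p (preverse (epath a))"
      have q: "pathin T ?p" "?p 0 = vpt v0" "?p 1 = vpt (src X a)"
        using p e by (auto intro: pathin_pjoin pathin_preverse)
      have "hpath T (pjoin ?p (epath a)) p"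
        using hpath_join_reverse_cancel[of T "preverse (epath a)" p] p e by (simp add: pathin_preverse)
      then have "\<rho> a (cls ?p) = d" using p q by (simp add: \<rho>[OF a] cls_eq)
      moreover have "cls ?p \<in> S (src X a)" unfolding S_def using q by blast
      ultimately show "d \<in> \<rho> a ` S (src X a)" by blast
    qed
  qed
  have comp: "\<rho> (cmp X a b) c = \<rho> a (\<rho> b c)" if ab: "composable X a b" and c: "c \<in> S (src X b)" for a b c
  proof -
    have E: "a \<in> edges X" "b \<in> edges X" "cmp X a b \<in> edges X" "src X a = tgt X b" "src X (cmp X a b) = src X b"
      using ab cmp_in src_cmp by (auto simp: composable_def)
    note e = pathin_epath[OF E(1)] epath_ends[OF E(1)] pathin_epath[OF E(2)] epath_ends[OF E(2)]
    obtain p where p: "c = cls p" "pathin T p" "p 1 = vpt (src X b)" using c by (auto simp: S_def)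
    have "hpath T (pjoin (pjoin p (epath b)) (epath a)) (pjoin p (pjoin (epath b) (epath a)))"
      using p e E(4) by (intro hpath_assoc) auto
    also have "hpath T \<dots> (pjoin p (epath (cmp X a b)))"
      using p hpath_epath_cmp[OF ab] e by (intro hpath_join) auto
    finally have h: "hpath T (pjoin (pjoin p (epath b)) (epath a)) (pjoin p (epath (cmp X a b)))" .
    have "\<rho> a (\<rho> b c) = cls (pjoin (pjoin p (epath b)) (epath a))"
      using p pj[OF E(2)] E e by (simp add: \<rho>)
    also have "\<dots> = cls (pjoin p (epath (cmp X a b)))" using h hpath_imp_pathin[OF h] by (simp add: cls_eq)
    also have "\<dots> = \<rho> (cmp X a b) c" using p E by (simp add: \<rho>)
    finally show ?thesis by simp
  qed
  have base: "cls (\<lambda>_. vpt v0) \<in> S v0" using pathin_const[OF vpt_in[OF v0]] by (auto simp: S_def)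
  have "\<exists>s. (\<forall>v\<in>verts X. s v \<in> S v) \<and> (\<forall>a\<in>edges X. \<rho> a (s (src X a)) = s (tgt X a))"
    by (rule sec[unfolded has_sections_def, THEN spec[of _ S], THEN spec[of _ \<rho>], THEN spec, THEN mp, THEN mp, THEN mp, OF _ _ base])
      (simp_all add: bij comp)
  then obtain s where s: "\<And>v. v \<in> verts X \<Longrightarrow> s v \<in> S v" "\<And>a. a \<in> edges X \<Longrightarrow> \<rho> a (s (src X a)) = s (tgt X a)"
    by blast
  have "\<exists>p. s v = cls p \<and> pathin T p \<and> p 0 = vpt v0 \<and> p 1 = vpt v" if "v \<in> verts X" for v
    using s(1)[OF that] by (auto simp: S_def)
  then obtain K where K: "\<And>v. v \<in> verts X \<Longrightarrow> s v = cls (K v) \<and> pathin T (K v) \<and> K v 0 = vpt v0 \<and> K v 1 = vpt v"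
    by metis
  show ?thesis
  proof (rule simply_connected_if_compatible_paths)
    fix a assume a: "a \<in> edges X"
    show "hpath T (pjoin (K (src X a)) (epath a)) (K (tgt X a))"
      using s(2)[OF a] \<rho>[OF a] K[OF src_in[OF a]] K[OF tgt_in[OF a]] by (simp add: cls_eq)
  qed (use K in auto)
qed

end

section \<open>Words and paths\<close>

fun letter_start :: "('v, 'e) scwol \<Rightarrow> ('v, 'e, 'g) letter \<Rightarrow> 'v" where
  "letter_start Y (Loc \<sigma> g) = \<sigma>"
| "letter_start Y (Pos a) = tgt Y a"
| "letter_start Y (Neg a) = src Y a"

fun letter_end :: "('v, 'e) scwol \<Rightarrow> ('v, 'e, 'g) letter \<Rightarrow> 'v" where
  "letter_end Y (Loc \<sigma> g) = \<sigma>"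
| "letter_end Y (Pos a) = src Y a"
| "letter_end Y (Neg a) = tgt Y a"

text \<open>A relaxed form of \<open>gpath\<close>: local letters and edge letters need not
  alternate and the empty word is allowed, so these words are closed under concatenation and formal
  inversion.\<close>

fun wpath :: "('v, 'e) scwol \<Rightarrow> ('v, 'e, 'g) cog \<Rightarrow> 'v \<Rightarrow> ('v, 'e, 'g) fg_word \<Rightarrow> 'v \<Rightarrow> bool" where
  "wpath Y G \<sigma> [] \<tau> \<longleftrightarrow> \<sigma> = \<tau> \<and> \<sigma> \<in> verts Y"
| "wpath Y G \<sigma> (l # w) \<tau> \<longleftrightarrow> l \<in> fg_letters Y G \<and> letter_start Y l = \<sigma> \<and> wpath Y G (letter_end Y l) w \<tau>"

fun letter_inv :: "('v, 'e, 'g) cog \<Rightarrow> ('v, 'e, 'g) letter \<Rightarrow> ('v, 'e, 'g) letter" where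
  "letter_inv G (Loc \<sigma> g) = Loc \<sigma> (inv\<^bsub>lgrp G \<sigma>\<^esub> g)"
| "letter_inv G (Pos a) = Neg a"
| "letter_inv G (Neg a) = Pos a"

definition word_inv :: "('v, 'e, 'g) cog \<Rightarrow> ('v, 'e, 'g) fg_word \<Rightarrow> ('v, 'e, 'g) fg_word" where
  "word_inv G w = rev (map (letter_inv G) w)"

lemma word_inv_simps [simp]:
  "word_inv G [] = []" "word_inv G (l # w) = word_inv G w @ [letter_inv G l]"
  by (simp_all add: word_inv_def)

lemma fg_letters_simps [simp]:
  "Loc \<sigma> g \<in> fg_letters Y G \<longleftrightarrow> \<sigma> \<in> verts Y \<and> g \<in> carrier (lgrp G \<sigma>)"
  "Pos a \<in> fg_letters Y G \<longleftrightarrow> a \<in> edges Y"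
  "Neg a \<in> fg_letters Y G \<longleftrightarrow> a \<in> edges Y"
  by (auto simp: fg_letters_def)

lemma wpath_append: "wpath Y G \<sigma> u \<mu> \<Longrightarrow> wpath Y G \<mu> v \<tau> \<Longrightarrow> wpath Y G \<sigma> (u @ v) \<tau>"
  by (induction u arbitrary: \<sigma>) auto

lemma wpath_letters: "wpath Y G \<sigma> w \<tau> \<Longrightarrow> set w \<subseteq> fg_letters Y G"
  by (induction w arbitrary: \<sigma>) auto

lemma fg_eq_invariant:
  assumes "fg_eq Y G u v" "\<And>l r p s. fg_rel Y G l r \<Longrightarrow> f (p @ l @ s) = f (p @ r @ s)"
  shows "f u = f v"
  using assms(1) unfolding fg_eq_def
proof (induction rule: equivclp_induct)
  case (step y z)
  have "f p = f q" if "fg_step Y G p q" for p q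
    using that by cases (simp add: assms(2))
  then show ?case using step by metis
qed simp

sublocale complex_of_groups \<subseteq> F: group "FG Y G"
  by (rule group_FG) (rule complex_of_groups_axioms)

context complex_of_groups
begin

abbreviation "F \<equiv> FG Y G"
abbreviation "cl \<equiv> fg_class Y G"

lemma cl_append: "cl (u @ v) = cl u \<otimes>\<^bsub>F\<^esub> cl v"
  by (rule fg_mult[symmetric])

lemma cl_Nil: "cl [] = \<one>\<^bsub>F\<^esub>"
  by (simp add: FG_def)

lemma cl_Cons: "cl (l # w) = cl [l] \<otimes>\<^bsub>F\<^esub> cl w"
  using cl_append[of "[l]" w] by simp

lemma cl_in: "set w \<subseteq> fg_letters Y G \<Longrightarrow> cl w \<in> carrier F"
  by (auto simp: FG_def)

lemma cl_letter_in [simp]: "l \<in> fg_letters Y G \<Longrightarrow> cl [l] \<in> carrier F"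
  by (simp add: cl_in)

lemma cl_rel: "fg_rel Y G l r \<Longrightarrow> cl l = cl r"
  unfolding fg_class_eq_iff by (rule fg_rel_eq)

lemma cl_Loc_mult:
  "\<sigma> \<in> verts Y \<Longrightarrow> g \<in> carrier (lgrp G \<sigma>) \<Longrightarrow> h \<in> carrier (lgrp G \<sigma>) \<Longrightarrow>
    cl [Loc \<sigma> g] \<otimes>\<^bsub>F\<^esub> cl [Loc \<sigma> h] = cl [Loc \<sigma> (g \<otimes>\<^bsub>lgrp G \<sigma>\<^esub> h)]"
  using cl_rel[OF rel_mult[of \<sigma> Y g G h]] cl_append[of "[Loc \<sigma> g]" "[Loc \<sigma> h]"] by simp

lemma cl_Loc_one: "\<sigma> \<in> verts Y \<Longrightarrow> cl [Loc \<sigma> \<one>\<^bsub>lgrp G \<sigma>\<^esub>] = \<one>\<^bsub>F\<^esub>"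
  using cl_rel[OF rel_one[of \<sigma> Y G]] cl_Nil by simp

lemma letter_inv_in: "l \<in> fg_letters Y G \<Longrightarrow> letter_inv G l \<in> fg_letters Y G"
  using group.inv_closed[OF lgrp_group] by (cases l) auto

lemma cl_letter_inv: "l \<in> fg_letters Y G \<Longrightarrow> cl [letter_inv G l] = inv\<^bsub>F\<^esub> cl [l]"
proof (rule F.inv_equality[symmetric])
  assume l: "l \<in> fg_letters Y G"
  show "cl [letter_inv G l] \<otimes>\<^bsub>F\<^esub> cl [l] = \<one>\<^bsub>F\<^esub>"
  proof (cases l)
    case (Loc \<sigma> g)
    then interpret M: group "lgrp G \<sigma>" using l lgrp_group by simp
    show ?thesis using l Loc by (simp add: cl_Loc_mult cl_Loc_one)
  next
    case (Pos a)
    then show ?thesis using l cl_rel[OF rel_neg_pos[of a Y G]] cl_Cons[of "Neg a" "[Pos a]"] by (simp add: cl_Nil)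
  next
    case (Neg a)
    then show ?thesis using l cl_rel[OF rel_pos_neg[of a Y G]] cl_Cons[of "Pos a" "[Neg a]"] by (simp add: cl_Nil)
  qed
qed (simp_all add: letter_inv_in)

lemma cl_Neg: "a \<in> edges Y \<Longrightarrow> cl [Neg a] = inv\<^bsub>F\<^esub> cl [Pos a]"
  using cl_letter_inv[of "Pos a"] by simp

lemma cl_Loc_inv: "\<sigma> \<in> verts Y \<Longrightarrow> g \<in> carrier (lgrp G \<sigma>) \<Longrightarrow> cl [Loc \<sigma> (inv\<^bsub>lgrp G \<sigma>\<^esub> g)] = inv\<^bsub>F\<^esub> cl [Loc \<sigma> g]"
  using cl_letter_inv[of "Loc \<sigma> g"] by simp

lemma cl_twist:
  "composable Y a b \<Longrightarrow> cl [Pos a] \<otimes>\<^bsub>F\<^esub> cl [Pos b] = cl [Loc (tgt Y a) (twist G a b)] \<otimes>\<^bsub>F\<^esub> cl [Pos (cmp Y a b)]"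
  using cl_rel[OF rel_twist[of Y a b G]] by (simp add: cl_Cons[of _ "[_]"])

lemma psi_in: "a \<in> edges Y \<Longrightarrow> g \<in> carrier (lgrp G (src Y a)) \<Longrightarrow> psi G a g \<in> carrier (lgrp G (tgt Y a))"
  using hom_in_carrier[OF psi_hom] .

lemma cl_psi:
  assumes "a \<in> edges Y" "g \<in> carrier (lgrp G (src Y a))"
  shows "cl [Loc (tgt Y a) (psi G a g)] = cl [Pos a] \<otimes>\<^bsub>F\<^esub> cl [Loc (src Y a) g] \<otimes>\<^bsub>F\<^esub> inv\<^bsub>F\<^esub> cl [Pos a]"
  using cl_rel[OF rel_psi[OF assms]] assms src_in
  by (simp add: cl_Cons[of _ "_ # _"] cl_Neg F.m_assoc)

lemma cl_word_inv: "set w \<subseteq> fg_letters Y G \<Longrightarrow> cl (word_inv G w) = inv\<^bsub>F\<^esub> cl w"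
proof (induction w)
  case (Cons l w)
  then show ?case
    using cl_Cons[of l w] cl_in[of w] by (simp add: cl_append cl_letter_inv F.inv_mult_group)
qed (simp add: cl_Nil)

lemma letter_verts: "l \<in> fg_letters Y G \<Longrightarrow> letter_start Y l \<in> verts Y \<and> letter_end Y l \<in> verts Y"
  by (cases l) (auto simp: src_in tgt_in)

lemma wpath_verts: "wpath Y G \<sigma> w \<tau> \<Longrightarrow> \<sigma> \<in> verts Y \<and> \<tau> \<in> verts Y"
  by (induction w arbitrary: \<sigma>) (auto dest: letter_verts)

lemma letter_inv_ends [simp]:
  "letter_start Y (letter_inv G l) = letter_end Y l" "letter_end Y (letter_inv G l) = letter_start Y l"
  by (cases l; simp)+

lemma wpath_word_inv: "wpath Y G \<sigma> w \<tau> \<Longrightarrow> wpath Y G \<tau> (word_inv G w) \<sigma>"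
proof (induction w arbitrary: \<sigma>)
  case (Cons l w)
  then have "wpath Y G (letter_end Y l) [letter_inv G l] \<sigma>" using letter_verts[of l] by (auto simp: letter_inv_in)
  moreover have "wpath Y G \<tau> (word_inv G w) (letter_end Y l)" using Cons by simp
  ultimately show ?case unfolding word_inv_simps by (rule wpath_append[rotated])
qed simp

section \<open>The development as a scwol of cosets\<close>

definition coset :: "('v, 'e, 'g) fg \<Rightarrow> 'v \<Rightarrow> ('v, 'e, 'g) fg set" where
  "coset x \<sigma> = {x \<otimes>\<^bsub>F\<^esub> cl [Loc \<sigma> g] | g. g \<in> carrier (lgrp G \<sigma>)}"

lemma coset_eq_iff:
  assumes "\<sigma> \<in> verts Y" "x \<in> carrier F" "y \<in> carrier F"
  shows "coset x \<sigma> = coset y \<sigma> \<longleftrightarrow> (\<exists>g\<in>carrier (lgrp G \<sigma>). y = x \<otimes>\<^bsub>F\<^esub> cl [Loc \<sigma> g])"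
proof
  interpret M: group "lgrp G \<sigma>" using lgrp_group assms(1) .
  have one: "y \<otimes>\<^bsub>F\<^esub> cl [Loc \<sigma> \<one>\<^bsub>lgrp G \<sigma>\<^esub>] = y" using assms cl_Loc_one by simp
  assume "coset x \<sigma> = coset y \<sigma>"
  moreover have "y \<in> coset y \<sigma>"
    unfolding coset_def mem_Collect_eq by (intro exI conjI) (rule one[symmetric], rule M.one_closed)
  ultimately have "y \<in> coset x \<sigma>" by metis
  then show "\<exists>g\<in>carrier (lgrp G \<sigma>). y = x \<otimes>\<^bsub>F\<^esub> cl [Loc \<sigma> g]" by (auto simp: coset_def)
next
  interpret M: group "lgrp G \<sigma>" using lgrp_group assms(1) .
  assume "\<exists>g\<in>carrier (lgrp G \<sigma>). y = x \<otimes>\<^bsub>F\<^esub> cl [Loc \<sigma> g]"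
  then obtain g where g: "g \<in> carrier (lgrp G \<sigma>)" "y = x \<otimes>\<^bsub>F\<^esub> cl [Loc \<sigma> g]" by blast
  have 1: "y \<otimes>\<^bsub>F\<^esub> cl [Loc \<sigma> h] = x \<otimes>\<^bsub>F\<^esub> cl [Loc \<sigma> (g \<otimes>\<^bsub>lgrp G \<sigma>\<^esub> h)]" if "h \<in> carrier (lgrp G \<sigma>)" for h
    using g that assms by (simp add: F.m_assoc cl_Loc_mult)
  have 2: "x \<otimes>\<^bsub>F\<^esub> cl [Loc \<sigma> h] = y \<otimes>\<^bsub>F\<^esub> cl [Loc \<sigma> (inv\<^bsub>lgrp G \<sigma>\<^esub> g \<otimes>\<^bsub>lgrp G \<sigma>\<^esub> h)]" if "h \<in> carrier (lgrp G \<sigma>)" for h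
    using g that by (subst 1) (simp_all add: M.m_assoc[symmetric])
  show "coset x \<sigma> = coset y \<sigma>"
  proof (intro equalityI subsetI)
    fix u assume "u \<in> coset x \<sigma>"
    then obtain h where "h \<in> carrier (lgrp G \<sigma>)" "u = x \<otimes>\<^bsub>F\<^esub> cl [Loc \<sigma> h]" by (auto simp: coset_def)
    then show "u \<in> coset y \<sigma>" unfolding coset_def using 2 g(1) by auto
  next
    fix u assume "u \<in> coset y \<sigma>"
    then obtain h where "h \<in> carrier (lgrp G \<sigma>)" "u = y \<otimes>\<^bsub>F\<^esub> cl [Loc \<sigma> h]" by (auto simp: coset_def)
    then show "u \<in> coset x \<sigma>" unfolding coset_def using 1 g(1) by auto
  qed
qed

text \<open>
  The vertices \<open>dvert x \<sigma>\<close> and edges \<open>dedge x a\<close> of the development are the cosets \<open>x G\<^sub>\<sigma>\<close> and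
  \<open>x G\<^bsub>i(a)\<^esub>\<close>, where \<open>x\<close> is the class of a path from \<open>\<sigma>\<^sub>0\<close> to \<open>\<sigma>\<close> or \<open>i(a)\<close>. The edge \<open>x G\<^bsub>i(a)\<^esub>\<close> over \<open>a\<close>
  ends at \<open>x a\<^sup>- G\<^bsub>t(a)\<^esub>\<close>.
\<close>

definition paths_to :: "'v \<Rightarrow> 'v \<Rightarrow> ('v, 'e, 'g) fg set" where
  "paths_to \<sigma>0 \<sigma> = {cl w | w. wpath Y G \<sigma>0 w \<sigma>}"

definition dvert :: "('v, 'e, 'g) fg \<Rightarrow> 'v \<Rightarrow> ('v, 'e, 'g) fg set \<times> 'v" where
  "dvert x \<sigma> = (coset x \<sigma>, \<sigma>)"

definition dedge :: "('v, 'e, 'g) fg \<Rightarrow> 'e \<Rightarrow> ('v, 'e, 'g) fg set \<times> 'e" where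
  "dedge x a = (coset x (src Y a), a)"

definition development :: "'v \<Rightarrow> (('v, 'e, 'g) fg set \<times> 'v, ('v, 'e, 'g) fg set \<times> 'e) scwol" where
  "development \<sigma>0 = \<lparr>
     verts = {dvert x \<sigma> | x \<sigma>. x \<in> paths_to \<sigma>0 \<sigma>},
     edges = {dedge x a | x a. a \<in> edges Y \<and> x \<in> paths_to \<sigma>0 (src Y a)},
     src = (\<lambda>(A, a). (A, src Y a)),
     tgt = (\<lambda>(A, a). (\<Union>x\<in>A. coset (x \<otimes>\<^bsub>F\<^esub> cl [Neg a]) (tgt Y a), tgt Y a)),
     cmp = (\<lambda>(A, a) (B, b). (B, cmp Y a b))\<rparr>"

lemma paths_toI: "wpath Y G \<sigma>0 w \<sigma> \<Longrightarrow> cl w \<in> paths_to \<sigma>0 \<sigma>"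
  by (auto simp: paths_to_def)

lemma paths_to_in: "x \<in> paths_to \<sigma>0 \<sigma> \<Longrightarrow> x \<in> carrier F"
  by (auto simp: paths_to_def intro!: cl_in dest: wpath_letters)

lemma paths_to_verts: "x \<in> paths_to \<sigma>0 \<sigma> \<Longrightarrow> \<sigma> \<in> verts Y"
  by (auto simp: paths_to_def dest: wpath_verts)

lemma paths_to_append: "x \<in> paths_to \<sigma>0 \<sigma> \<Longrightarrow> wpath Y G \<sigma> w \<tau> \<Longrightarrow> x \<otimes>\<^bsub>F\<^esub> cl w \<in> paths_to \<sigma>0 \<tau>"
  by (auto simp: paths_to_def cl_append[symmetric] intro: wpath_append)

lemma paths_to_letter:
  "x \<in> paths_to \<sigma>0 (letter_start Y l) \<Longrightarrow> l \<in> fg_letters Y G \<Longrightarrow> x \<otimes>\<^bsub>F\<^esub> cl [l] \<in> paths_to \<sigma>0 (letter_end Y l)"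
  using letter_verts[of l] by (intro paths_to_append[of x _ "letter_start Y l"]) auto

lemma dvert_eq_iff:
  assumes "\<sigma> \<in> verts Y" "x \<in> carrier F" "y \<in> carrier F"
  shows "dvert x \<sigma> = dvert y \<tau> \<longleftrightarrow> \<sigma> = \<tau> \<and> (\<exists>g\<in>carrier (lgrp G \<sigma>). y = x \<otimes>\<^bsub>F\<^esub> cl [Loc \<sigma> g])"
  using coset_eq_iff[OF assms] by (auto simp: dvert_def)

lemma dedge_eq_iff:
  assumes "a \<in> edges Y" "x \<in> carrier F" "y \<in> carrier F"
  shows "dedge x a = dedge y b \<longleftrightarrow> a = b \<and> dvert x (src Y a) = dvert y (src Y a)"
  by (auto simp: dedge_def dvert_def)

lemma dvert_in: "x \<in> paths_to \<sigma>0 \<sigma> \<Longrightarrow> dvert x \<sigma> \<in> verts (development \<sigma>0)"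
  by (auto simp: development_def)

lemma dev_edge: "a \<in> edges Y \<Longrightarrow> x \<in> paths_to \<sigma>0 (src Y a) \<Longrightarrow> dedge x a \<in> edges (development \<sigma>0)"
  by (auto simp: development_def)

lemma dev_src: "src (development \<sigma>0) (dedge x a) = dvert x (src Y a)"
  by (simp add: development_def dedge_def dvert_def)

lemma coset_refl: "\<sigma> \<in> verts Y \<Longrightarrow> x \<in> carrier F \<Longrightarrow> x \<in> coset x \<sigma>"
  unfolding coset_def mem_Collect_eq
  by (intro exI[of _ "\<one>\<^bsub>lgrp G \<sigma>\<^esub>"] conjI)
    (simp_all add: cl_Loc_one group.is_monoid[OF lgrp_group])

lemma dvert_Loc:
  assumes "\<sigma> \<in> verts Y" "x \<in> carrier F" "g \<in> carrier (lgrp G \<sigma>)"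
  shows "dvert (x \<otimes>\<^bsub>F\<^esub> cl [Loc \<sigma> g]) \<sigma> = dvert x \<sigma>"
  using dvert_eq_iff[of \<sigma> x "x \<otimes>\<^bsub>F\<^esub> cl [Loc \<sigma> g]" \<sigma>] assms by auto

text \<open>Replacing \<open>x\<close> by x g with g in the group at the source changes x a^- into x
  g a^- = x a^- psi_a(g), which is in the same coset of the group at the target. So the union in
  \<open>tgt\<close> consists of equal cosets.\<close>

lemma dev_tgt:
  assumes a: "a \<in> edges Y" and x: "x \<in> carrier F"
  shows "tgt (development \<sigma>0) (dedge x a) = dvert (x \<otimes>\<^bsub>F\<^esub> cl [Neg a]) (tgt Y a)"
proof -
  have "coset (y \<otimes>\<^bsub>F\<^esub> cl [Neg a]) (tgt Y a) = coset (x \<otimes>\<^bsub>F\<^esub> cl [Neg a]) (tgt Y a)" if y: "y \<in> coset x (src Y a)" for y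
  proof -
    obtain g where g: "g \<in> carrier (lgrp G (src Y a))" "y = x \<otimes>\<^bsub>F\<^esub> cl [Loc (src Y a) g]"
      using y by (auto simp: coset_def)
    have "y \<otimes>\<^bsub>F\<^esub> cl [Neg a] = (x \<otimes>\<^bsub>F\<^esub> cl [Neg a]) \<otimes>\<^bsub>F\<^esub> cl [Loc (tgt Y a) (psi G a g)]"
      using a x g src_in by (simp add: cl_psi cl_Neg F.m_assoc[symmetric]) (simp add: F.m_assoc)
    then show ?thesis
      using a x g src_in tgt_in psi_in coset_eq_iff[of "tgt Y a" "x \<otimes>\<^bsub>F\<^esub> cl [Neg a]" "y \<otimes>\<^bsub>F\<^esub> cl [Neg a]"]
      by auto
  qed
  moreover have "x \<in> coset x (src Y a)" using coset_refl src_in a x by blast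
  ultimately have "(\<Union>y\<in>coset x (src Y a). coset (y \<otimes>\<^bsub>F\<^esub> cl [Neg a]) (tgt Y a)) = coset (x \<otimes>\<^bsub>F\<^esub> cl [Neg a]) (tgt Y a)"
    by blast
  then show ?thesis by (simp add: development_def dedge_def dvert_def)
qed

lemma dev_cmp:
  assumes "composable Y a b" shows "cmp (development \<sigma>0) (dedge x a) (dedge y b) = dedge y (cmp Y a b)"
  using src_cmp[OF assms] by (simp add: development_def dedge_def)

lemma dev_edgeE:
  assumes "A \<in> edges (development \<sigma>0)"
  obtains x a where "A = dedge x a" "a \<in> edges Y" "x \<in> paths_to \<sigma>0 (src Y a)" "x \<in> carrier F"
  using assms paths_to_in by (auto simp: development_def)

lemma dev_composable:
  assumes "composable Y a b" "y \<in> paths_to \<sigma>0 (src Y b)"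
  shows "composable (development \<sigma>0) (dedge (y \<otimes>\<^bsub>F\<^esub> cl [Neg b]) a) (dedge y b)"
  using assms paths_to_letter[of y \<sigma>0 "Neg b"] paths_to_in[of y \<sigma>0]
  by (auto simp: composable_def dev_src dev_tgt dev_edge)

lemma dev_composableE:
  assumes "composable (development \<sigma>0) A B"
  obtains y a b where "composable Y a b" "y \<in> paths_to \<sigma>0 (src Y b)" "y \<in> carrier F"
    "A = dedge (y \<otimes>\<^bsub>F\<^esub> cl [Neg b]) a" "B = dedge y b"
proof -
  from assms obtain x a y b where A: "A = dedge x a" "a \<in> edges Y" "x \<in> carrier F"
    and B: "B = dedge y b" "b \<in> edges Y" "y \<in> paths_to \<sigma>0 (src Y b)" "y \<in> carrier F"
    unfolding composable_def by (auto elim!: dev_edgeE)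
  have eq: "dvert x (src Y a) = dvert (y \<otimes>\<^bsub>F\<^esub> cl [Neg b]) (tgt Y b)"
    using assms A B by (simp add: composable_def dev_src dev_tgt)
  then have st: "src Y a = tgt Y b" by (simp add: dvert_def)
  have "A = dedge (y \<otimes>\<^bsub>F\<^esub> cl [Neg b]) a"
    using eq A B st by (simp add: dedge_eq_iff)
  then show thesis using that[of a b y] A B st by (simp add: composable_def)
qed

text \<open>Inverting a^+ b^+ = g_{a,b} (ab)^+ gives b^- a^- = (ab)^- g_{a,b}^{-1}; the last factor
  disappears in the coset.\<close>

lemma dvert_cmp:
  assumes "composable Y a b" "y \<in> carrier F"
  shows "dvert (y \<otimes>\<^bsub>F\<^esub> cl [Neg b] \<otimes>\<^bsub>F\<^esub> cl [Neg a]) (tgt Y a) = dvert (y \<otimes>\<^bsub>F\<^esub> cl [Neg (cmp Y a b)]) (tgt Y a)"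
proof -
  have E: "a \<in> edges Y" "b \<in> edges Y" "cmp Y a b \<in> edges Y" "tgt Y a \<in> verts Y" "twist G a b \<in> carrier (lgrp G (tgt Y a))"
    using assms cmp_in tgt_in twist_in by (auto simp: composable_def)
  have "inv\<^bsub>F\<^esub> (cl [Pos a] \<otimes>\<^bsub>F\<^esub> cl [Pos b]) = inv\<^bsub>F\<^esub> (cl [Loc (tgt Y a) (twist G a b)] \<otimes>\<^bsub>F\<^esub> cl [Pos (cmp Y a b)])"
    using cl_twist[OF assms(1)] by simp
  then have "cl [Neg b] \<otimes>\<^bsub>F\<^esub> cl [Neg a] = cl [Neg (cmp Y a b)] \<otimes>\<^bsub>F\<^esub> cl [Loc (tgt Y a) (inv\<^bsub>lgrp G (tgt Y a)\<^esub> (twist G a b))]"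
    using E by (simp add: cl_Neg cl_Loc_inv F.inv_mult_group)
  then have "y \<otimes>\<^bsub>F\<^esub> cl [Neg b] \<otimes>\<^bsub>F\<^esub> cl [Neg a] = y \<otimes>\<^bsub>F\<^esub> cl [Neg (cmp Y a b)] \<otimes>\<^bsub>F\<^esub> cl [Loc (tgt Y a) (inv\<^bsub>lgrp G (tgt Y a)\<^esub> (twist G a b))]"
    using E assms(2) group.inv_closed[OF lgrp_group[OF E(4)] E(5)] by (simp add: F.m_assoc)
  then show ?thesis using E assms(2) group.inv_closed[OF lgrp_group[OF E(4)] E(5)] by (simp add: dvert_Loc)
qed

lemma scwol_development: "scwol (development \<sigma>0)"
proof (rule scwol.intro, goal_cases)
  case (1 A)
  then show ?case by (elim dev_edgeE) (simp add: dev_src dvert_in)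
next
  case (2 A)
  then show ?case
    by (elim dev_edgeE) (use paths_to_letter[of _ \<sigma>0 "Neg _"] in \<open>auto simp: dev_tgt dvert_in\<close>)
next
  case (3 A B)
  then show ?case by (elim dev_composableE) (auto simp: dev_cmp dev_edge cmp_in src_cmp)
next
  case (4 A B)
  then show ?case by (elim dev_composableE) (auto simp: dev_cmp dev_src src_cmp)
next
  case (5 A B)
  then show ?case
  proof (elim dev_composableE)
    fix y a b assume *: "composable Y a b" "y \<in> carrier F" "A = dedge (y \<otimes>\<^bsub>F\<^esub> cl [Neg b]) a" "B = dedge y b"
    then have "a \<in> edges Y" "b \<in> edges Y" "cmp Y a b \<in> edges Y" using cmp_in by (auto simp: composable_def)
    then show "tgt (development \<sigma>0) (cmp (development \<sigma>0) A B) = tgt (development \<sigma>0) A"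
      using * dvert_cmp[OF *(1,2)] by (simp add: dev_cmp dev_tgt tgt_cmp)
  qed
next
  case (6 A B C)
  obtain y a b where ab: "composable Y a b" "A = dedge (y \<otimes>\<^bsub>F\<^esub> cl [Neg b]) a" "B = dedge y b"
    using 6(1) by (rule dev_composableE)
  obtain z b' c where bc: "composable Y b' c" "B = dedge (z \<otimes>\<^bsub>F\<^esub> cl [Neg c]) b'" "C = dedge z c"
    using 6(2) by (rule dev_composableE)
  have "b = b'" using ab bc by (simp add: dedge_def)
  then show ?case
    using ab bc cmp_assoc[of a b c] by (simp add: development_def dedge_def)
next
  case (7 A)
  then show ?case by (elim dev_edgeE) (auto simp: dev_src dev_tgt dvert_def no_loops)
qed

text \<open>Reachability from \<sigma> agrees at all vertices of a simplex and is preserved by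
  gluing, so reachable and unreachable simplices split the realization into two disjoint open
  sets.\<close>

lemma connected_wpath:
  assumes con: "connected_scwol Y" and v: "\<sigma> \<in> verts Y" "\<tau> \<in> verts Y"
  shows "\<exists>w. wpath Y G \<sigma> w \<tau>"
proof (rule ccontr)
  assume not: "\<nexists>w. wpath Y G \<sigma> w \<tau>"
  define R where "R v \<longleftrightarrow> (\<exists>w. wpath Y G \<sigma> w v)" for v
  \<comment> \<open>Vertex 0 labels the simplex. A face may omit it, and then vertex 1 takes its
    place, which is joined to it by an edge.\<close>
  define W where "W b = {p \<in> topspace SS. R (simplex_vert Y (fst p) 0) = b}" for b
  have R_edge: "R (src Y a) = R (tgt Y a)" if a: "a \<in> edges Y" for a
  proof -
    have "wpath Y G (src Y a) [Neg a] (tgt Y a)" "wpath Y G (tgt Y a) [Pos a] (src Y a)"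
      using a by (simp_all add: src_in tgt_in)
    then show ?thesis unfolding R_def by (meson wpath_append)
  qed
  have inv: "R (simplex_vert Y (fst p) 0) = R (simplex_vert Y (fst p') 0)" if "glue Y p p'" for p p'
    using that
  proof cases
    case (1 s i x)
    have "simplex_vert Y (face Y i s) 0 = simplex_vert Y s (coface i 0)"
      using face_simplex(3)[OF 1(3,4,5)] by simp
    moreover have "R (simplex_vert Y s 0) = R (simplex_vert Y s 1)"
      using q_segm_edge[OF 1(3), of 0 1] 1(4) R_edge by force
    ultimately show ?thesis by (auto simp: 1 coface_def)
  qed
  have sat: "{p \<in> topspace SS. q p \<in> q ` W b} \<subseteq> W b" for b
  proof
    fix p assume "p \<in> {p \<in> topspace SS. q p \<in> q ` W b}"
    then obtain p' where p: "p \<in> topspace SS" "q p = q p'" "p' \<in> W b" by blast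
    have "R (simplex_vert Y (fst p) 0) = R (simplex_vert Y (fst p') 0)"
      using p(2) inv unfolding q_eq_iff by (rule equivclp_invariant[where f = "\<lambda>p. R (simplex_vert Y (fst p) 0)"])
    then show "p \<in> W b" using p by (simp add: W_def)
  qed
  have op: "openin T (q ` W b)" for b
  proof -
    have "openin SS (W b)"
      unfolding simplex_space_def openin_sum_topology
    proof (intro conjI ballI)
      fix s assume s: "s \<in> simplices Y"
      have "{x. (s, x) \<in> W b} = (if R (simplex_vert Y s 0) = b then standard_simplex (simplex_dim s) else {})"
        using s by (auto simp: W_def topspace_SS)
      then show "openin (simplex_top (simplex_dim s)) {x. (s, x) \<in> W b}"
        using openin_topspace[of "simplex_top (simplex_dim s)"] by (simp add: topspace_standard_simplex)
    qed (auto simp: W_def topspace_SS)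
    then show ?thesis using quotient_map_realization[of Y] sat[of b] by (simp add: quotient_map_saturated_open)
  qed
  have "q ` W True \<inter> q ` W False = {}"
  proof (rule Int_emptyI)
    fix y assume y: "y \<in> q ` W True" "y \<in> q ` W False"
    from y(1) obtain p where p: "p \<in> W True" "y = q p" by (rule imageE)
    then have "p \<in> {p \<in> topspace SS. q p \<in> q ` W False}" using y(2) by (simp add: W_def)
    then have "p \<in> W False" using sat by (rule subsetD[rotated])
    then show False using p(1) by (simp add: W_def)
  qed
  moreover have "topspace T \<subseteq> q ` W True \<union> q ` W False"
    unfolding q_image[symmetric] image_Un[symmetric] by (rule image_mono) (auto simp: W_def)
  moreover have "q (Vertex v, corner 0) \<in> q ` W (R v)" if "v \<in> verts Y" for v
    by (rule imageI) (use that corner_in[of 0 0] in \<open>simp add: W_def topspace_SS simplices_def\<close>)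
  then have "q ` W (R \<sigma>) \<noteq> {}" "q ` W (R \<tau>) \<noteq> {}" using v by force+
  moreover have "R \<sigma>" unfolding R_def using v(1) by (intro exI[of _ "[]"]) simp
  moreover have "\<not> R \<tau>" using not by (simp add: R_def)
  ultimately have "\<not> connected_space T"
    unfolding connected_space_def not_not using op
    by (intro exI[of _ "q ` W True"] exI[of _ "q ` W False"] conjI) simp_all
  then show False using con by (simp add: connected_scwol_def)
qed

end

locale based_cog = complex_of_groups Y G
  for Y :: "('v, 'e) scwol" and G :: "('v, 'e, 'g) cog" +
  fixes \<sigma>0 :: 'v
  assumes base: "\<sigma>0 \<in> verts Y"
    and reach: "\<sigma> \<in> verts Y \<Longrightarrow> \<exists>w. wpath Y G \<sigma>0 w \<sigma>"
begin

abbreviation "D \<equiv> development \<sigma>0"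

sublocale D: scwol D by (rule scwol_development)

lemma one_paths_to: "\<one>\<^bsub>F\<^esub> \<in> paths_to \<sigma>0 \<sigma>0"
  using paths_toI[of \<sigma>0 "[]" \<sigma>0] base by (simp add: cl_Nil)

section \<open>Transport of a local system along words\<close>

context
  fixes S :: "('v, 'e, 'g) fg set \<times> 'v \<Rightarrow> 's set" and \<rho> :: "('v, 'e, 'g) fg set \<times> 'e \<Rightarrow> 's \<Rightarrow> 's" and s0 :: 's
  assumes \<rho>_bij: "\<And>a. a \<in> edges D \<Longrightarrow> bij_betw (\<rho> a) (S (src D a)) (S (tgt D a))"
    and \<rho>_cmp: "\<And>a b c. composable D a b \<Longrightarrow> c \<in> S (src D b) \<Longrightarrow> \<rho> (cmp D a b) c = \<rho> a (\<rho> b c)"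
    and s0: "s0 \<in> S (dvert \<one>\<^bsub>F\<^esub> \<sigma>0)"
begin

text \<open>Here \<open>x\<close> is the class of what has been read so far. A local letter does not
  move the vertex; \<open>Neg a\<close> follows the edge starting at the current vertex;
  \<open>Pos a\<close> goes back along the edge that ends there, which is the coset of x
  a^+.\<close>

fun transport_letter :: "('v, 'e, 'g) fg \<Rightarrow> ('v, 'e, 'g) letter \<Rightarrow> 's \<Rightarrow> 's" where
  "transport_letter x (Loc \<sigma> g) s = s"
| "transport_letter x (Neg a) s = \<rho> (dedge x a) s"
| "transport_letter x (Pos a) s = inv_into (S (dvert (x \<otimes>\<^bsub>F\<^esub> cl [Pos a]) (src Y a))) (\<rho> (dedge (x \<otimes>\<^bsub>F\<^esub> cl [Pos a]) a)) s"

fun transport :: "('v, 'e, 'g) fg \<Rightarrow> ('v, 'e, 'g) fg_word \<Rightarrow> 's \<Rightarrow> 's" where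
  "transport x [] s = s"
| "transport x (l # w) s = transport (x \<otimes>\<^bsub>F\<^esub> cl [l]) w (transport_letter x l s)"

lemma \<rho>_dedge:
  assumes "a \<in> edges Y" "x \<in> paths_to \<sigma>0 (src Y a)"
  shows "bij_betw (\<rho> (dedge x a)) (S (dvert x (src Y a))) (S (dvert (x \<otimes>\<^bsub>F\<^esub> cl [Neg a]) (tgt Y a)))"
  using \<rho>_bij[OF dev_edge[OF assms]] assms paths_to_in[OF assms(2)] by (simp add: dev_src dev_tgt)

lemma \<rho>_Pos:
  assumes "a \<in> edges Y" "x \<in> paths_to \<sigma>0 (tgt Y a)"
  shows "bij_betw (\<rho> (dedge (x \<otimes>\<^bsub>F\<^esub> cl [Pos a]) a)) (S (dvert (x \<otimes>\<^bsub>F\<^esub> cl [Pos a]) (src Y a))) (S (dvert x (tgt Y a)))"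
  using \<rho>_dedge[of a "x \<otimes>\<^bsub>F\<^esub> cl [Pos a]"] assms paths_to_letter[of x \<sigma>0 "Pos a"] paths_to_in[OF assms(2)]
  by (simp add: cl_Neg F.m_assoc)

lemma transport_letter_in:
  assumes "l \<in> fg_letters Y G" "x \<in> paths_to \<sigma>0 (letter_start Y l)" "s \<in> S (dvert x (letter_start Y l))"
  shows "transport_letter x l s \<in> S (dvert (x \<otimes>\<^bsub>F\<^esub> cl [l]) (letter_end Y l))"
proof (cases l)
  case (Loc \<sigma> g)
  then show ?thesis using assms paths_to_in by (simp add: dvert_Loc)
next
  case (Pos a)
  have "s \<in> \<rho> (dedge (x \<otimes>\<^bsub>F\<^esub> cl [Pos a]) a) ` S (dvert (x \<otimes>\<^bsub>F\<^esub> cl [Pos a]) (src Y a))"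
    using assms Pos \<rho>_Pos[of a x] by (simp add: bij_betw_def)
  then show ?thesis using Pos by (simp add: inv_into_into)
next
  case (Neg a)
  then show ?thesis using assms \<rho>_dedge[of a x] by (auto simp: bij_betw_def)
qed

lemma transport_in:
  assumes "wpath Y G \<alpha> w \<beta>" "x \<in> paths_to \<sigma>0 \<alpha>" "s \<in> S (dvert x \<alpha>)"
  shows "transport x w s \<in> S (dvert (x \<otimes>\<^bsub>F\<^esub> cl w) \<beta>)"
  using assms
proof (induction w arbitrary: x \<alpha> s)
  case Nil
  then show ?case using paths_to_in by (simp add: cl_Nil)
next
  case (Cons l w)
  then have l: "l \<in> fg_letters Y G" "letter_start Y l = \<alpha>" "wpath Y G (letter_end Y l) w \<beta>" by auto
  have "transport (x \<otimes>\<^bsub>F\<^esub> cl [l]) w (transport_letter x l s) \<in> S (dvert (x \<otimes>\<^bsub>F\<^esub> cl [l] \<otimes>\<^bsub>F\<^esub> cl w) \<beta>)"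
    using l Cons.prems by (intro Cons.IH[OF l(3)] paths_to_letter transport_letter_in) auto
  then show ?case
    using l paths_to_in[OF Cons.prems(2)] cl_in[OF wpath_letters[OF l(3)]] by (simp add: cl_Cons[of l w] F.m_assoc)
qed

lemma transport_append:
  assumes "set u \<subseteq> fg_letters Y G" "x \<in> carrier F"
  shows "transport x (u @ v) s = transport (x \<otimes>\<^bsub>F\<^esub> cl u) v (transport x u s)"
  using assms
proof (induction u arbitrary: x s)
  case (Cons l u)
  then show ?case using cl_in[of u] by (simp add: cl_Cons[of l u] F.m_assoc)
qed (simp add: cl_Nil)

text \<open>Equality of the classes is part of the relation because whatever is read after
  \<open>w\<close> is transported from \<open>x\<close> times the class of \<open>w\<close>; this
  makes the relation stable under contexts.\<close>

definition teq :: "'v \<Rightarrow> ('v, 'e, 'g) fg_word \<Rightarrow> ('v, 'e, 'g) fg_word \<Rightarrow> bool" where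
  "teq \<alpha> w w' \<longleftrightarrow> set w \<subseteq> fg_letters Y G \<and> set w' \<subseteq> fg_letters Y G \<and> cl w = cl w' \<and>
    (\<forall>x\<in>paths_to \<sigma>0 \<alpha>. \<forall>s\<in>S (dvert x \<alpha>). transport x w s = transport x w' s)"

lemma teq_refl: "set w \<subseteq> fg_letters Y G \<Longrightarrow> teq \<alpha> w w"
  by (simp add: teq_def)

lemma teq_sym: "teq \<alpha> u v \<Longrightarrow> teq \<alpha> v u"
  by (simp add: teq_def)

lemma teq_trans [trans]: "teq \<alpha> u v \<Longrightarrow> teq \<alpha> v w \<Longrightarrow> teq \<alpha> u w"
  by (simp add: teq_def)

lemma teq_context:
  assumes "teq \<beta> l r" "wpath Y G \<alpha> u \<beta>" "set v \<subseteq> fg_letters Y G"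
  shows "teq \<alpha> (u @ l @ v) (u @ r @ v)"
proof -
  note u = wpath_letters[OF assms(2)]
  have "transport x (u @ l @ v) s = transport x (u @ r @ v) s"
    if x: "x \<in> paths_to \<sigma>0 \<alpha>" "s \<in> S (dvert x \<alpha>)" for x s
  proof -
    have xu: "x \<otimes>\<^bsub>F\<^esub> cl u \<in> paths_to \<sigma>0 \<beta>" using x(1) assms(2) by (rule paths_to_append)
    moreover have "transport x u s \<in> S (dvert (x \<otimes>\<^bsub>F\<^esub> cl u) \<beta>)" using assms(2) x by (rule transport_in)
    ultimately have "transport (x \<otimes>\<^bsub>F\<^esub> cl u) l (transport x u s) = transport (x \<otimes>\<^bsub>F\<^esub> cl u) r (transport x u s)"
      using assms(1) by (simp add: teq_def)
    then show ?thesis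
      using assms(1) u paths_to_in[OF x(1)] paths_to_in[OF xu] by (simp add: teq_def transport_append)
  qed
  then show ?thesis using assms u by (auto simp: teq_def cl_append)
qed

lemma transport_Pos_Neg:
  assumes "a \<in> edges Y" "x \<in> paths_to \<sigma>0 (tgt Y a)" "s \<in> S (dvert x (tgt Y a))"
  shows "\<rho> (dedge (x \<otimes>\<^bsub>F\<^esub> cl [Pos a]) a) (transport_letter x (Pos a) s) = s"
  using \<rho>_Pos[OF assms(1,2)] assms(3) by (simp add: bij_betw_def f_inv_into_f)

lemma teq_letter:
  assumes l: "l \<in> fg_letters Y G"
  shows "teq (letter_start Y l) [l, letter_inv G l] []"
proof -
  have "cl [l, letter_inv G l] = cl []"
    using l cl_Cons[of l "[letter_inv G l]"] by (simp add: cl_letter_inv cl_Nil)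
  moreover have "transport x [l, letter_inv G l] s = s"
    if x: "x \<in> paths_to \<sigma>0 (letter_start Y l)" "s \<in> S (dvert x (letter_start Y l))" for x s
  proof (cases l)
    case (Pos a)
    then show ?thesis using transport_Pos_Neg[of a x s] x l by simp
  next
    case (Neg a)
    then have "x \<otimes>\<^bsub>F\<^esub> cl [Neg a] \<otimes>\<^bsub>F\<^esub> cl [Pos a] = x"
      using l paths_to_in[OF x(1)] by (simp add: cl_Neg F.m_assoc)
    then show ?thesis
      using Neg l x \<rho>_dedge[of a x] by (simp add: bij_betw_def)
  qed simp
  ultimately show ?thesis using l by (simp add: teq_def letter_inv_in)
qed

lemma teq_word_inv: "wpath Y G \<alpha> w \<beta> \<Longrightarrow> teq \<alpha> (w @ word_inv G w) []"
proof (induction w arbitrary: \<alpha>)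
  case (Cons l w)
  then have l: "l \<in> fg_letters Y G" "letter_start Y l = \<alpha>" "wpath Y G (letter_end Y l) w \<beta>" by auto
  have "teq \<alpha> ([l] @ (w @ word_inv G w) @ [letter_inv G l]) ([l] @ [] @ [letter_inv G l])"
    by (rule teq_context[OF Cons.IH[OF l(3)]]) (use l letter_verts[of l] letter_inv_in in auto)
  also have "teq \<alpha> ([l] @ [] @ [letter_inv G l]) []" using teq_letter[OF l(1)] l(2) by simp
  finally show ?case by simp
qed (simp add: teq_refl)

lemma letter_inv_inv: "l \<in> fg_letters Y G \<Longrightarrow> letter_inv G (letter_inv G l) = l"
  using group.inv_inv[OF lgrp_group] by (cases l) auto

lemma word_inv_inv: "set w \<subseteq> fg_letters Y G \<Longrightarrow> word_inv G (word_inv G w) = w"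
  by (induction w) (auto simp: word_inv_def rev_map letter_inv_inv)

lemma teq_word_inv': "wpath Y G \<alpha> w \<beta> \<Longrightarrow> teq \<beta> (word_inv G w @ w) []"
  using teq_word_inv[OF wpath_word_inv] word_inv_inv[OF wpath_letters] by metis

text \<open>Both sides of every relation are edge paths with common ends. The twist relation is
  followed because \<open>\<rho>\<close> respects composites, the relation for \<open>psi\<close>
  because a local factor does not change the edge of a coset, and the inverse relations because
  \<open>\<rho>\<close> is bijective.\<close>

lemma teq_rel:
  assumes "fg_rel Y G l r" shows "\<exists>\<alpha> \<beta>. wpath Y G \<alpha> l \<beta> \<and> wpath Y G \<alpha> r \<beta> \<and> teq \<alpha> l r"
  using assms
proof cases
  case (rel_mult \<sigma> g h)
  moreover have "g \<otimes>\<^bsub>lgrp G \<sigma>\<^esub> h \<in> carrier (lgrp G \<sigma>)"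
    using rel_mult monoid.m_closed[OF group.is_monoid[OF lgrp_group]] by auto
  ultimately show ?thesis using cl_rel[OF assms]
    by (intro exI[of _ \<sigma>]) (simp add: teq_def)
next
  case (rel_one \<sigma>)
  then show ?thesis using cl_rel[OF assms] monoid.one_closed[OF group.is_monoid[OF lgrp_group]]
    by (intro exI[of _ \<sigma>]) (simp add: teq_def)
next
  case (rel_pos_neg a)
  then show ?thesis using teq_letter[of "Pos a"]
    by (intro exI[of _ "tgt Y a"]) (simp add: tgt_in)
next
  case (rel_neg_pos a)
  then show ?thesis using teq_letter[of "Neg a"]
    by (intro exI[of _ "src Y a"]) (simp add: src_in)
next
  case (rel_twist a b)
  let ?ab = "cmp Y a b" and ?t = "tgt Y a" and ?g = "twist G a b"
  have E: "a \<in> edges Y" "b \<in> edges Y" "src Y a = tgt Y b" "?ab \<in> edges Y" "?t \<in> verts Y" "?g \<in> carrier (lgrp G ?t)"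
    "src Y ?ab = src Y b" "tgt Y ?ab = ?t"
    using rel_twist cmp_in tgt_in twist_in src_cmp tgt_cmp by (auto simp: composable_def)
  have "transport x l s = transport x r s" if x: "x \<in> paths_to \<sigma>0 ?t" "s \<in> S (dvert x ?t)" for x s
  proof -
    \<comment> \<open>From here on \<open>?g\<close> is the class \<open>x\<close> times the
      twisting element, no longer the twisting element itself; the edge over the composite is read
      from this class.\<close>
    let ?x = "x \<otimes>\<^bsub>F\<^esub> cl [Pos a]" and ?g = "x \<otimes>\<^bsub>F\<^esub> cl [Loc ?t ?g]"
    let ?y = "?x \<otimes>\<^bsub>F\<^esub> cl [Pos b]"
    have xc: "x \<in> carrier F" using x(1) by (rule paths_to_in)
    have x': "?x \<in> paths_to \<sigma>0 (tgt Y b)" using paths_to_letter[of x \<sigma>0 "Pos a"] x E by simp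
    have y: "?y \<in> paths_to \<sigma>0 (src Y b)" using paths_to_letter[of ?x \<sigma>0 "Pos b"] x' E by simp
    have yg: "?g \<otimes>\<^bsub>F\<^esub> cl [Pos ?ab] = ?y"
      using cl_twist[OF rel_twist(3)] xc E by (simp add: F.m_assoc)
    have g: "?g \<in> paths_to \<sigma>0 ?t" using paths_to_letter[of x \<sigma>0 "Loc ?t (twist G a b)"] x E by simp
    define c where "c = transport_letter x (Pos a) s"
    define d where "d = transport_letter ?x (Pos b) c"
    have c: "c \<in> S (dvert ?x (tgt Y b))" using transport_letter_in[of "Pos a" x s] x E by (simp add: c_def del: transport_letter.simps)
    have d: "d \<in> S (dvert ?y (src Y b))" using transport_letter_in[of "Pos b" ?x c] x' c E by (simp add: d_def del: transport_letter.simps)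
    have co: "composable D (dedge ?x a) (dedge ?y b)"
      using dev_composable[OF rel_twist(3) y] xc E by (simp add: cl_Neg F.m_assoc)
    have "\<rho> (dedge ?y ?ab) d = \<rho> (dedge ?x a) (\<rho> (dedge ?y b) d)"
      using \<rho>_cmp[OF co, of d] d by (simp add: dev_cmp[OF rel_twist(3)] dev_src)
    also have "\<rho> (dedge ?y b) d = c" unfolding d_def using E(2) x' c by (rule transport_Pos_Neg)
    also have "\<rho> (dedge ?x a) c = s" unfolding c_def using E(1) x by (rule transport_Pos_Neg)
    finally have "\<rho> (dedge ?y ?ab) d = s" .
    moreover have "inj_on (\<rho> (dedge ?y ?ab)) (S (dvert ?y (src Y b)))"
      using \<rho>_dedge[OF E(4), of ?y] y E(7) by (simp add: bij_betw_def)
    ultimately have "inv_into (S (dvert ?y (src Y b))) (\<rho> (dedge ?y ?ab)) s = d"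
      using d by (intro inv_into_f_eq)
    then have "transport_letter ?g (Pos ?ab) s = d" by (simp add: yg E)
    then show ?thesis by (simp add: rel_twist c_def d_def)
  qed
  then show ?thesis using cl_rel[OF assms] E rel_twist src_in
    by (intro exI[of _ ?t] exI[of _ "src Y b"]) (simp add: teq_def)
next
  case (rel_psi a g)
  have "transport x l s = transport x r s" if x: "x \<in> paths_to \<sigma>0 (tgt Y a)" "s \<in> S (dvert x (tgt Y a))" for x s
  proof -
    let ?x = "x \<otimes>\<^bsub>F\<^esub> cl [Pos a]"
    have "?x \<in> carrier F" "?x \<otimes>\<^bsub>F\<^esub> cl [Loc (src Y a) g] \<in> carrier F" using paths_to_in[OF x(1)] rel_psi src_in by auto
    then have "dedge (?x \<otimes>\<^bsub>F\<^esub> cl [Loc (src Y a) g]) a = dedge ?x a"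
      using rel_psi src_in by (simp add: dedge_eq_iff dvert_Loc)
    then show ?thesis using transport_Pos_Neg[OF rel_psi(3) x] by (simp add: rel_psi)
  qed
  then show ?thesis using cl_rel[OF assms] rel_psi src_in tgt_in psi_in
    by (intro exI[of _ "tgt Y a"]) (simp add: teq_def)
qed

text \<open>The empty word at the base vertex matters: the padding at the start of a path from
  \<open>\<sigma>0\<close> then vanishes.\<close>

definition joiner :: "'v \<Rightarrow> ('v, 'e, 'g) fg_word" where
  "joiner \<sigma> = (if \<sigma> = \<sigma>0 then [] else SOME w. wpath Y G \<sigma>0 w \<sigma>)"

lemma joiner: "\<sigma> \<in> verts Y \<Longrightarrow> wpath Y G \<sigma>0 (joiner \<sigma>) \<sigma>"
  using someI_ex[OF reach, of \<sigma>] base by (simp add: joiner_def)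

text \<open>
  Replacing every letter by a loop at the base vertex turns an arbitrary word into a path, so that the
  relations of \<open>FG\<close>, which may be applied to words that are no paths, can be followed by transports.
\<close>

definition loop :: "('v, 'e, 'g) letter \<Rightarrow> ('v, 'e, 'g) fg_word" where
  "loop l = (if l \<in> fg_letters Y G then joiner (letter_start Y l) @ [l] @ word_inv G (joiner (letter_end Y l)) else [])"

definition loops :: "('v, 'e, 'g) fg_word \<Rightarrow> ('v, 'e, 'g) fg_word" where
  "loops w = concat (map loop w)"

lemma wpath_loop: "wpath Y G \<sigma>0 (loop l) \<sigma>0"
proof (cases "l \<in> fg_letters Y G")
  case True
  then have v: "letter_start Y l \<in> verts Y" "letter_end Y l \<in> verts Y" using letter_verts by auto
  have "wpath Y G (letter_start Y l) [l] (letter_end Y l)" using True v by simp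
  then show ?thesis unfolding loop_def if_P[OF True]
    by (intro wpath_append[OF joiner[OF v(1)]] wpath_append[OF _ wpath_word_inv[OF joiner[OF v(2)]]])
qed (simp add: loop_def base)

lemma wpath_loops: "wpath Y G \<sigma>0 (loops w) \<sigma>0"
  by (induction w) (auto simp: loops_def base intro: wpath_append wpath_loop)

text \<open>The joiners telescope: at each intermediate vertex the inverse of a joiner meets that
  joiner.\<close>

lemma teq_loops:
  assumes "wpath Y G \<alpha> w \<beta>" shows "teq \<sigma>0 (loops w) (joiner \<alpha> @ w @ word_inv G (joiner \<beta>))"
  using assms
proof (induction w arbitrary: \<alpha>)
  case Nil
  then have ab: "\<alpha> = \<beta>" "\<beta> \<in> verts Y" by auto
  show ?case using teq_sym[OF teq_word_inv[OF joiner[OF ab(2)]]] ab(1) by (simp add: loops_def)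
next
  case (Cons l w)
  then have l: "l \<in> fg_letters Y G" "letter_start Y l = \<alpha>" "wpath Y G (letter_end Y l) w \<beta>" by auto
  let ?k = "joiner (letter_end Y l)" and ?r = "w @ word_inv G (joiner \<beta>)"
  have v: "letter_end Y l \<in> verts Y" "\<alpha> \<in> verts Y" "\<beta> \<in> verts Y" using letter_verts l wpath_verts[OF l(3)] by auto
  have "set (word_inv G (joiner \<beta>)) \<subseteq> fg_letters Y G" by (rule wpath_letters[OF wpath_word_inv[OF joiner[OF v(3)]]])
  then have r: "set ?r \<subseteq> fg_letters Y G" using wpath_letters[OF l(3)] by simp
  have "teq \<sigma>0 (loop l @ loops w @ []) (loop l @ (?k @ ?r) @ [])"
    using Cons.IH[OF l(3)] by (intro teq_context[OF _ wpath_loop]) auto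
  also have "loop l @ (?k @ ?r) @ [] = (joiner \<alpha> @ [l]) @ (word_inv G ?k @ ?k) @ ?r" using l by (simp add: loop_def)
  also have "teq \<sigma>0 \<dots> ((joiner \<alpha> @ [l]) @ [] @ ?r)"
    by (rule teq_context[OF teq_word_inv'[OF joiner[OF v(1)]] wpath_append[OF joiner[OF v(2)]] r])
      (use l v in simp)
  finally show ?case by (simp add: loops_def)
qed

text \<open>A relation may be applied inside any word, even one with letters outside the alphabet.
  \<open>loops\<close> deletes such letters and turns the rest into a loop at the base vertex, so
  the context can be transported along whatever it was.\<close>

lemma teq_loops_fg_eq:
  assumes "fg_eq Y G u v" shows "teq \<sigma>0 (loops u) (loops v)"
proof -
  have la: "loops (u @ v) = loops u @ loops v" for u v by (simp add: loops_def)
  have "teq \<sigma>0 (loops (p @ l @ s)) (loops (p @ r @ s))" if rel: "fg_rel Y G l r" for l r p s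
  proof -
    obtain \<alpha> \<beta> where *: "wpath Y G \<alpha> l \<beta>" "wpath Y G \<alpha> r \<beta>" "teq \<alpha> l r" using teq_rel[OF rel] by blast
    have v: "\<alpha> \<in> verts Y" "\<beta> \<in> verts Y" using wpath_verts[OF *(1)] by auto
    have "teq \<sigma>0 (loops l) (joiner \<alpha> @ l @ word_inv G (joiner \<beta>))" using *(1) by (rule teq_loops)
    also have "teq \<sigma>0 \<dots> (joiner \<alpha> @ r @ word_inv G (joiner \<beta>))"
      by (rule teq_context[OF *(3) joiner[OF v(1)] wpath_letters[OF wpath_word_inv[OF joiner[OF v(2)]]]])
    also have "teq \<sigma>0 \<dots> (loops r)" using *(2) by (rule teq_sym[OF teq_loops])
    finally show ?thesis
      unfolding la by (rule teq_context[OF _ wpath_loops wpath_letters[OF wpath_loops]])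
  qed
  \<comment> \<open>Invariance is stated for functions with equal values, so a word is replaced by
    the set of words equivalent to its loops.\<close>
  then have eq: "{w. teq \<sigma>0 (loops (p @ l @ s)) w} = {w. teq \<sigma>0 (loops (p @ r @ s)) w}"
    if "fg_rel Y G l r" for l r p s
    using that by (blast intro: teq_trans teq_sym)
  have "{w. teq \<sigma>0 (loops u) w} = {w. teq \<sigma>0 (loops v) w}"
    by (rule fg_eq_invariant[where f = "\<lambda>u. {w. teq \<sigma>0 (loops u) w}", OF assms eq])
  moreover have "teq \<sigma>0 (loops v) (loops v)" by (rule teq_refl[OF wpath_letters[OF wpath_loops]])
  ultimately show ?thesis by blast
qed

text \<open>Appending the joiner of \<open>\<tau>\<close> to the loops of a path recovers that path
  up to \<open>teq\<close>. Thus the equality of loops, valid for arbitrary words, descends to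
  genuine paths.\<close>

lemma transport_unique:
  assumes w: "wpath Y G \<sigma>0 w \<tau>" "wpath Y G \<sigma>0 w' \<tau>" "cl w = cl w'"
  shows "transport \<one>\<^bsub>F\<^esub> w s0 = transport \<one>\<^bsub>F\<^esub> w' s0"
proof -
  let ?k = "joiner \<tau>"
  have \<tau>: "\<tau> \<in> verts Y" using wpath_verts[OF w(1)] by blast
  note k = joiner[OF \<tau>]
  have j: "joiner \<sigma>0 = []" by (simp add: joiner_def)
  have "fg_eq Y G w w'" using w(3) unfolding fg_class_eq_iff .
  then have lo: "teq \<sigma>0 (loops w) (loops w')" by (rule teq_loops_fg_eq)
  have pad: "teq \<sigma>0 (loops u @ ?k) u" if u: "wpath Y G \<sigma>0 u \<tau>" for u
  proof -
    have "teq \<sigma>0 ([] @ loops u @ ?k) ([] @ (u @ word_inv G ?k) @ ?k)"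
      using teq_loops[OF u] base wpath_letters[OF k] by (intro teq_context[of \<sigma>0]) (auto simp: j)
    also have "[] @ (u @ word_inv G ?k) @ ?k = u @ (word_inv G ?k @ ?k) @ []" by simp
    also have "teq \<sigma>0 \<dots> (u @ [] @ [])" by (rule teq_context[OF teq_word_inv'[OF k] u]) simp
    finally show ?thesis by simp
  qed
  have "teq \<sigma>0 w (loops w @ ?k)" by (rule teq_sym[OF pad[OF w(1)]])
  also have "teq \<sigma>0 ([] @ loops w @ ?k) ([] @ loops w' @ ?k)"
    by (rule teq_context[OF lo _ wpath_letters[OF k]]) (simp add: base)
  then have "teq \<sigma>0 (loops w @ ?k) (loops w' @ ?k)" by simp
  also have "teq \<sigma>0 (loops w' @ ?k) w'" by (rule pad[OF w(2)])
  finally show ?thesis using one_paths_to s0 by (simp add: teq_def)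
qed

definition sect :: "('v, 'e, 'g) fg set \<times> 'v \<Rightarrow> 's" where
  "sect V = transport \<one>\<^bsub>F\<^esub> (SOME w. wpath Y G \<sigma>0 w (snd V) \<and> V = dvert (cl w) (snd V)) s0"

text \<open>Two paths to the same coset differ in \<open>FG\<close> by a local element at the end,
  and local letters transport trivially; hence the chosen path may be replaced by any other.\<close>

lemma sect:
  assumes w: "wpath Y G \<sigma>0 w \<sigma>" shows "sect (dvert (cl w) \<sigma>) = transport \<one>\<^bsub>F\<^esub> w s0"
proof -
  let ?w = "SOME u. wpath Y G \<sigma>0 u (snd (dvert (cl w) \<sigma>)) \<and> dvert (cl w) \<sigma> = dvert (cl u) (snd (dvert (cl w) \<sigma>))"
  have sn: "snd (dvert (cl w) \<sigma>) = \<sigma>" by (simp add: dvert_def)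
  have "wpath Y G \<sigma>0 ?w \<sigma> \<and> dvert (cl w) \<sigma> = dvert (cl ?w) \<sigma>"
    unfolding sn by (rule someI[of _ w]) (simp add: w)
  then have u: "wpath Y G \<sigma>0 ?w \<sigma>" "dvert (cl w) \<sigma> = dvert (cl ?w) \<sigma>" by auto
  have \<sigma>: "\<sigma> \<in> verts Y" using wpath_verts[OF w] by blast
  have c: "cl w \<in> carrier F" "cl ?w \<in> carrier F" 
    by (rule cl_in[OF wpath_letters[OF w]], rule cl_in[OF wpath_letters[OF u(1)]])
  obtain g where g: "g \<in> carrier (lgrp G \<sigma>)" "cl ?w = cl w \<otimes>\<^bsub>F\<^esub> cl [Loc \<sigma> g]"
    using u(2) dvert_eq_iff[OF \<sigma> c] by blast
  have wg: "wpath Y G \<sigma>0 (w @ [Loc \<sigma> g]) \<sigma>" using \<sigma> g by (intro wpath_append[OF w]) simp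
  have "sect (dvert (cl w) \<sigma>) = transport \<one>\<^bsub>F\<^esub> ?w s0" by (simp add: sect_def)
  also have "\<dots> = transport \<one>\<^bsub>F\<^esub> (w @ [Loc \<sigma> g]) s0"
    using u(1) wg g(2) by (intro transport_unique) (simp_all add: cl_append)
  also have "\<dots> = transport \<one>\<^bsub>F\<^esub> w s0" using wpath_letters[OF w] by (subst transport_append) simp_all
  finally show ?thesis .
qed

lemma sect_edge:
  assumes "wpath Y G \<sigma>0 w (src Y a)" "a \<in> edges Y"
  shows "\<rho> (dedge (cl w) a) (sect (dvert (cl w) (src Y a))) = sect (dvert (cl w \<otimes>\<^bsub>F\<^esub> cl [Neg a]) (tgt Y a))"
proof -
  have "wpath Y G \<sigma>0 (w @ [Neg a]) (tgt Y a)" using assms tgt_in by (intro wpath_append[OF assms(1)]) simp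
  then have "sect (dvert (cl (w @ [Neg a])) (tgt Y a)) = transport \<one>\<^bsub>F\<^esub> (w @ [Neg a]) s0" by (rule sect)
  also have "\<dots> = \<rho> (dedge (cl w) a) (transport \<one>\<^bsub>F\<^esub> w s0)"
    using wpath_letters[OF assms(1)] cl_in[OF wpath_letters[OF assms(1)]] by (subst transport_append) simp_all
  finally show ?thesis by (simp add: sect[OF assms(1)] cl_append)
qed

lemma sections_exist: "\<exists>s. (\<forall>v\<in>verts D. s v \<in> S v) \<and> (\<forall>a\<in>edges D. \<rho> a (s (src D a)) = s (tgt D a))"
proof (intro exI[of _ sect] conjI ballI)
  fix v assume "v \<in> verts D"
  then obtain w \<sigma> where "v = dvert (cl w) \<sigma>" and w: "wpath Y G \<sigma>0 w \<sigma>" by (auto simp: development_def paths_to_def)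
  then show "sect v \<in> S v"
    using transport_in[OF w one_paths_to s0] cl_in[OF wpath_letters[OF w]] by (simp add: sect)
next
  fix A assume "A \<in> edges D"
  then obtain w a where *: "A = dedge (cl w) a" "a \<in> edges Y" "wpath Y G \<sigma>0 w (src Y a)"
    by (auto simp: development_def paths_to_def)
  then show "\<rho> A (sect (src D A)) = sect (tgt D A)"
    using sect_edge[OF *(3,2)] cl_in[OF wpath_letters[OF *(3)]] by (simp add: dev_src dev_tgt)
qed

end

lemma has_sections_development: "D.has_sections TYPE('s) (dvert \<one>\<^bsub>F\<^esub> \<sigma>0)"
  unfolding D.has_sections_def
proof (intro allI impI)
  fix S \<rho> s0
  assume *: "\<forall>a\<in>edges D. bij_betw (\<rho> a) (S (src D a)) (S (tgt D a))"
    "\<forall>a b. composable D a b \<longrightarrow> (\<forall>c\<in>S (src D b). \<rho> (cmp D a b) c = \<rho> a (\<rho> b c))"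
    "s0 \<in> S (dvert \<one>\<^bsub>F\<^esub> \<sigma>0)"
  show "\<exists>s. (\<forall>v\<in>verts D. s v \<in> S v) \<and> (\<forall>a\<in>edges D. \<rho> a (s (src D a)) = s (tgt D a))"
    by (rule sections_exist[of \<rho> S s0]) (use * in auto)
qed

lemma simply_connected_development: "simply_connected_scwol D"
  by (rule D.simply_connected_if_sections[OF dvert_in[OF one_paths_to] has_sections_development])

end

section \<open>The action on the development\<close>

text \<open>The permutations in \<open>BijGroup E\<close> are extensional functions, hence the
  restriction to \<open>E\<close>; the inverse group element supplies the inverse bijection.\<close>

lemma group_action_restrictI:
  assumes "group H"
    and cl: "\<And>g x. g \<in> carrier H \<Longrightarrow> x \<in> E \<Longrightarrow> f g x \<in> E"
    and mult: "\<And>g h x. g \<in> carrier H \<Longrightarrow> h \<in> carrier H \<Longrightarrow> x \<in> E \<Longrightarrow> f (g \<otimes>\<^bsub>H\<^esub> h) x = f g (f h x)"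
    and one: "\<And>x. x \<in> E \<Longrightarrow> f \<one>\<^bsub>H\<^esub> x = x"
  shows "group_action H E (\<lambda>g. restrict (f g) E)"
proof -
  interpret H: group H by fact
  have bij: "restrict (f g) E \<in> Bij E" if g: "g \<in> carrier H" for g
  proof -
    have "bij_betw (f g) E E"
      by (rule bij_betw_byWitness[where f' = "f (inv\<^bsub>H\<^esub> g)"])
        (use g cl mult[of "inv\<^bsub>H\<^esub> g" g] mult[of g "inv\<^bsub>H\<^esub> g"] one in auto)
    then have "bij_betw (restrict (f g) E) E E" by (simp cong: bij_betw_cong)
    then show ?thesis by (simp add: Bij_def)
  qed
  have "restrict (f (g \<otimes>\<^bsub>H\<^esub> h)) E = compose E (restrict (f g) E) (restrict (f h) E)"
    if "g \<in> carrier H" "h \<in> carrier H" for g h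
    using that cl by (intro ext) (simp add: compose_def mult)
  then have "(\<lambda>g. restrict (f g) E) \<in> hom H (BijGroup E)"
    using bij by (intro homI) (simp_all add: BijGroup_def)
  then show ?thesis
    by (intro group_action.intro group_hom.intro group_hom_axioms.intro group_BijGroup H.group_axioms)
qed

context based_cog
begin

text \<open>The fundamental group at \<open>\<sigma>0\<close>, described by \<open>wpath\<close>
  words.\<close>

definition dgrp :: "('v, 'e, 'g) fg monoid" where
  "dgrp = F\<lparr>carrier := paths_to \<sigma>0 \<sigma>0\<rparr>"

lemma dgrp_simps [simp]:
  "carrier dgrp = paths_to \<sigma>0 \<sigma>0" "x \<otimes>\<^bsub>dgrp\<^esub> y = x \<otimes>\<^bsub>F\<^esub> y" "\<one>\<^bsub>dgrp\<^esub> = \<one>\<^bsub>F\<^esub>"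
  by (simp_all add: dgrp_def)

lemma paths_to_mult: "x \<in> paths_to \<sigma>0 \<sigma>0 \<Longrightarrow> y \<in> paths_to \<sigma>0 \<sigma> \<Longrightarrow> x \<otimes>\<^bsub>F\<^esub> y \<in> paths_to \<sigma>0 \<sigma>"
  unfolding paths_to_def[of \<sigma>0 \<sigma>] using paths_to_append[of x \<sigma>0 \<sigma>0] by (auto simp: paths_to_def)

lemma paths_to_inv:
  assumes "x \<in> paths_to \<sigma>0 \<sigma>" "y \<in> paths_to \<sigma>0 \<sigma>" shows "y \<otimes>\<^bsub>F\<^esub> inv\<^bsub>F\<^esub> x \<in> paths_to \<sigma>0 \<sigma>0"
proof -
  obtain w where w: "x = cl w" "wpath Y G \<sigma>0 w \<sigma>" using assms(1) by (auto simp: paths_to_def)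
  have "y \<otimes>\<^bsub>F\<^esub> cl (word_inv G w) \<in> paths_to \<sigma>0 \<sigma>0" using assms(2) wpath_word_inv[OF w(2)] by (rule paths_to_append)
  then show ?thesis using cl_word_inv[OF wpath_letters[OF w(2)]] w(1) by simp
qed

lemma subgroup_paths_to: "subgroup (paths_to \<sigma>0 \<sigma>0) F"
proof (rule F.subgroupI)
  show "inv\<^bsub>F\<^esub> x \<in> paths_to \<sigma>0 \<sigma>0" if "x \<in> paths_to \<sigma>0 \<sigma>0" for x
    using paths_to_inv[OF that one_paths_to] paths_to_in[OF that] by simp
qed (use one_paths_to paths_to_in paths_to_mult in auto)

sublocale H: group dgrp
  unfolding dgrp_def by (rule subgroup.subgroup_is_group[OF subgroup_paths_to F.group_axioms])

lemma inv_dgrp [simp]: "x \<in> paths_to \<sigma>0 \<sigma>0 \<Longrightarrow> inv\<^bsub>dgrp\<^esub> x = inv\<^bsub>F\<^esub> x"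
  unfolding dgrp_def by (rule F.m_inv_consistent[OF subgroup_paths_to])

definition lmul :: "('v, 'e, 'g) fg \<Rightarrow> ('v, 'e, 'g) fg set \<times> 'b \<Rightarrow> ('v, 'e, 'g) fg set \<times> 'b" where
  "lmul h = (\<lambda>(A, b). ((\<lambda>x. h \<otimes>\<^bsub>F\<^esub> x) ` A, b))"

lemma lmul_coset:
  assumes "h \<in> carrier F" "x \<in> carrier F" "\<sigma> \<in> verts Y"
  shows "(\<lambda>x. h \<otimes>\<^bsub>F\<^esub> x) ` coset x \<sigma> = coset (h \<otimes>\<^bsub>F\<^esub> x) \<sigma>"
proof -
  have "h \<otimes>\<^bsub>F\<^esub> (x \<otimes>\<^bsub>F\<^esub> cl [Loc \<sigma> g]) = h \<otimes>\<^bsub>F\<^esub> x \<otimes>\<^bsub>F\<^esub> cl [Loc \<sigma> g]" if "g \<in> carrier (lgrp G \<sigma>)" for g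
    using that assms by (simp add: F.m_assoc)
  then show ?thesis unfolding coset_def by (auto simp: image_iff)
qed

lemma lmul_dvert: "h \<in> carrier F \<Longrightarrow> x \<in> carrier F \<Longrightarrow> \<sigma> \<in> verts Y \<Longrightarrow> lmul h (dvert x \<sigma>) = dvert (h \<otimes>\<^bsub>F\<^esub> x) \<sigma>"
  by (simp add: lmul_def dvert_def lmul_coset)

lemma lmul_dedge: "h \<in> carrier F \<Longrightarrow> x \<in> carrier F \<Longrightarrow> a \<in> edges Y \<Longrightarrow> lmul h (dedge x a) = dedge (h \<otimes>\<^bsub>F\<^esub> x) a"
  by (simp add: lmul_def dedge_def lmul_coset src_in)

definition vact where "vact h = restrict (lmul h) (verts D)"
definition eact where "eact h = restrict (lmul h) (edges D)"

lemma dev_vertE: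
  assumes "V \<in> verts D" obtains x \<sigma> where "V = dvert x \<sigma>" "\<sigma> \<in> verts Y" "x \<in> paths_to \<sigma>0 \<sigma>" "x \<in> carrier F"
  using assms paths_to_in paths_to_verts by (auto simp: development_def)

lemma vact_dvert:
  assumes "h \<in> paths_to \<sigma>0 \<sigma>0" "x \<in> paths_to \<sigma>0 \<sigma>"
  shows "vact h (dvert x \<sigma>) = dvert (h \<otimes>\<^bsub>F\<^esub> x) \<sigma>"
  using assms dvert_in[OF assms(2)] paths_to_in paths_to_verts by (simp add: vact_def lmul_dvert)

lemma eact_dedge:
  assumes "h \<in> paths_to \<sigma>0 \<sigma>0" "x \<in> paths_to \<sigma>0 (src Y a)" "a \<in> edges Y"
  shows "eact h (dedge x a) = dedge (h \<otimes>\<^bsub>F\<^esub> x) a"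
  using assms dev_edge[OF assms(3,2)] paths_to_in by (simp add: eact_def lmul_dedge)

lemma group_action_vact: "group_action dgrp (verts D) vact"
  unfolding vact_def
proof (rule group_action_restrictI)
  fix g V assume "g \<in> carrier dgrp" "V \<in> verts D"
  then show "lmul g V \<in> verts D"
    by (elim dev_vertE) (simp add: lmul_dvert paths_to_in dvert_in paths_to_mult)
next
  fix g h V assume "g \<in> carrier dgrp" "h \<in> carrier dgrp" "V \<in> verts D"
  then show "lmul (g \<otimes>\<^bsub>dgrp\<^esub> h) V = lmul g (lmul h V)"
    by (elim dev_vertE) (simp add: lmul_dvert paths_to_in F.m_assoc)
next
  fix V assume "V \<in> verts D"
  then show "lmul \<one>\<^bsub>dgrp\<^esub> V = V" by (elim dev_vertE) (simp add: lmul_dvert)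
qed (rule H.group_axioms)

lemma group_action_eact: "group_action dgrp (edges D) eact"
  unfolding eact_def
proof (rule group_action_restrictI)
  fix g V assume "g \<in> carrier dgrp" "V \<in> edges D"
  then show "lmul g V \<in> edges D"
    by (elim dev_edgeE) (simp add: lmul_dedge paths_to_in dev_edge paths_to_mult)
next
  fix g h V assume "g \<in> carrier dgrp" "h \<in> carrier dgrp" "V \<in> edges D"
  then show "lmul (g \<otimes>\<^bsub>dgrp\<^esub> h) V = lmul g (lmul h V)"
    by (elim dev_edgeE) (simp add: lmul_dedge paths_to_in F.m_assoc)
next
  fix V assume "V \<in> edges D"
  then show "lmul \<one>\<^bsub>dgrp\<^esub> V = V" by (elim dev_edgeE) (simp add: lmul_dedge)
qed (rule H.group_axioms)

lemma vact_tgt: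
  assumes h: "h \<in> paths_to \<sigma>0 \<sigma>0" and x: "x \<in> paths_to \<sigma>0 (src Y a)" and a: "a \<in> edges Y"
  shows "vact h (tgt D (dedge x a)) = dvert (h \<otimes>\<^bsub>F\<^esub> x \<otimes>\<^bsub>F\<^esub> cl [Neg a]) (tgt Y a)"
  using vact_dvert[OF h, of "x \<otimes>\<^bsub>F\<^esub> cl [Neg a]"] paths_to_letter[of x \<sigma>0 "Neg a"] assms
  by (simp add: dev_tgt paths_to_in F.m_assoc)

lemma scwol_functor_act:
  assumes h: "h \<in> paths_to \<sigma>0 \<sigma>0" shows "scwol_functor D D (vact h) (eact h)"
  unfolding scwol_functor_def
proof (intro conjI ballI allI impI)
  show "vact h \<in> verts D \<rightarrow> verts D" using group_action.element_image[OF group_action_vact] h by auto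
  show "eact h \<in> edges D \<rightarrow> edges D" using group_action.element_image[OF group_action_eact] h by auto
next
  fix A assume "A \<in> edges D"
  then obtain x a where A: "A = dedge x a" "a \<in> edges Y" "x \<in> paths_to \<sigma>0 (src Y a)" by (rule dev_edgeE)
  note hx = paths_to_mult[OF h A(3)]
  show "src D (eact h A) = vact h (src D A)"
    using A h by (simp add: eact_dedge vact_dvert dev_src)
  show "tgt D (eact h A) = vact h (tgt D A)"
    using A h vact_tgt[OF h A(3,2)] paths_to_in[OF hx] by (simp add: eact_dedge dev_tgt)
next
  fix A B assume "composable D A B"
  then obtain y a b where ab: "composable Y a b" "y \<in> paths_to \<sigma>0 (src Y b)" "y \<in> carrier F"
    "A = dedge (y \<otimes>\<^bsub>F\<^esub> cl [Neg b]) a" "B = dedge y b" by (rule dev_composableE)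
  have E: "a \<in> edges Y" "b \<in> edges Y" "src Y a = tgt Y b" "cmp Y a b \<in> edges Y" "src Y (cmp Y a b) = src Y b"
    using ab(1) cmp_in src_cmp by (auto simp: composable_def)
  have "y \<otimes>\<^bsub>F\<^esub> cl [Neg b] \<in> paths_to \<sigma>0 (src Y a)" using paths_to_letter[of y \<sigma>0 "Neg b"] ab(2) E by simp
  then show "eact h (cmp D A B) = cmp D (eact h A) (eact h B)"
    using ab E h by (simp add: eact_dedge dev_cmp)
qed

lemma scwol_action_development: "scwol_action dgrp D vact eact"
proof (intro scwol_action.intro scwol_action_axioms.intro D.scwol_axioms group_action_vact group_action_eact)
  show "scwol_functor D D (vact h) (eact h)" if "h \<in> carrier dgrp" for h
    using that by (simp add: scwol_functor_act)
  fix h A assume h: "h \<in> carrier dgrp" and "A \<in> edges D"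
  then obtain x a where A: "A = dedge x a" "a \<in> edges Y" "x \<in> paths_to \<sigma>0 (src Y a)" "x \<in> carrier F"
    by (elim dev_edgeE)
  have s: "vact h (src D A) = dvert (h \<otimes>\<^bsub>F\<^esub> x) (src Y a)" using A h by (simp add: dev_src vact_dvert)
  show "vact h (src D A) \<noteq> tgt D A"
    unfolding s using A no_loops by (simp add: dev_tgt dvert_def)
  show "eact h A = A" if "vact h (src D A) = src D A"
    using that A h unfolding s by (simp add: eact_dedge dedge_eq_iff dev_src paths_to_in)
qed

sublocale act: scwol_action dgrp D vact eact
  by (rule scwol_action_development)

section \<open>Orbits, the quotient of the development and the choice of lifts\<close>

definition vfib where "vfib \<sigma> = {dvert y \<sigma> | y. y \<in> paths_to \<sigma>0 \<sigma>}"
definition efib where "efib a = {dedge y a | y. y \<in> paths_to \<sigma>0 (src Y a)}"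

lemma paths_to_transitive:
  assumes "x \<in> paths_to \<sigma>0 \<sigma>" "y \<in> paths_to \<sigma>0 \<sigma>"
  obtains h where "h \<in> paths_to \<sigma>0 \<sigma>0" "y = h \<otimes>\<^bsub>F\<^esub> x"
  using that[OF paths_to_inv[OF assms]] paths_to_in[OF assms(1)] paths_to_in[OF assms(2)] by (simp add: F.m_assoc)

lemma orbit_dvert: assumes x: "x \<in> paths_to \<sigma>0 \<sigma>" shows "orbit dgrp vact (dvert x \<sigma>) = vfib \<sigma>"
proof (intro equalityI subsetI)
  fix v assume "v \<in> orbit dgrp vact (dvert x \<sigma>)"
  then obtain h where "h \<in> paths_to \<sigma>0 \<sigma>0" "v = vact h (dvert x \<sigma>)" by (auto simp: orbit_def)
  then show "v \<in> vfib \<sigma>" using x paths_to_mult by (auto simp: vact_dvert vfib_def)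
next
  fix v assume "v \<in> vfib \<sigma>"
  then obtain y where y: "y \<in> paths_to \<sigma>0 \<sigma>" "v = dvert y \<sigma>" by (auto simp: vfib_def)
  obtain h where h: "h \<in> paths_to \<sigma>0 \<sigma>0" "y = h \<otimes>\<^bsub>F\<^esub> x" by (rule paths_to_transitive[OF x y(1)])
  then have "v = vact h (dvert x \<sigma>)" using y x by (simp add: vact_dvert)
  then show "v \<in> orbit dgrp vact (dvert x \<sigma>)" using h by (auto simp: orbit_def)
qed

lemma orbit_dedge:
  assumes a: "a \<in> edges Y" and x: "x \<in> paths_to \<sigma>0 (src Y a)" shows "orbit dgrp eact (dedge x a) = efib a"
proof (intro equalityI subsetI)
  fix v assume "v \<in> orbit dgrp eact (dedge x a)"
  then obtain h where "h \<in> paths_to \<sigma>0 \<sigma>0" "v = eact h (dedge x a)" by (auto simp: orbit_def)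
  then show "v \<in> efib a" using a x paths_to_mult by (auto simp: eact_dedge efib_def)
next
  fix v assume "v \<in> efib a"
  then obtain y where y: "y \<in> paths_to \<sigma>0 (src Y a)" "v = dedge y a" by (auto simp: efib_def)
  obtain h where h: "h \<in> paths_to \<sigma>0 \<sigma>0" "y = h \<otimes>\<^bsub>F\<^esub> x" by (rule paths_to_transitive[OF x y(1)])
  then have "v = eact h (dedge x a)" using y x a by (simp add: eact_dedge)
  then show "v \<in> orbit dgrp eact (dedge x a)" using h by (auto simp: orbit_def)
qed

definition rep :: "'v \<Rightarrow> ('v, 'e, 'g) fg" where
  "rep \<sigma> = (SOME x. x \<in> paths_to \<sigma>0 \<sigma>)"

lemma rep: "\<sigma> \<in> verts Y \<Longrightarrow> rep \<sigma> \<in> paths_to \<sigma>0 \<sigma>"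
  unfolding rep_def by (rule someI_ex) (use reach paths_toI in blast)

lemma rep_in [simp]: "\<sigma> \<in> verts Y \<Longrightarrow> rep \<sigma> \<in> carrier F"
  using rep paths_to_in by blast

abbreviation "Q \<equiv> quotient_scwol dgrp D vact eact"

lemma verts_Q: "verts Q = vfib ` verts Y"
proof (intro equalityI subsetI)
  fix V assume "V \<in> verts Q"
  then obtain v where "v \<in> verts D" "V = orbit dgrp vact v" by (auto simp: quotient_scwol_def orbits_def)
  then show "V \<in> vfib ` verts Y" by (elim dev_vertE) (auto simp: orbit_dvert)
next
  fix V assume "V \<in> vfib ` verts Y"
  then obtain \<sigma> where \<sigma>: "\<sigma> \<in> verts Y" "V = vfib \<sigma>" by blast
  then have "V = orbit dgrp vact (dvert (rep \<sigma>) \<sigma>)" "dvert (rep \<sigma>) \<sigma> \<in> verts D"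
    using rep[OF \<sigma>(1)] by (simp_all add: orbit_dvert dvert_in)
  then show "V \<in> verts Q" unfolding quotient_scwol_def orbits_def scwol.select_convs by blast
qed

lemma edges_Q: "edges Q = efib ` edges Y"
proof (intro equalityI subsetI)
  fix A assume "A \<in> edges Q"
  then obtain a where "a \<in> edges D" "A = orbit dgrp eact a" by (auto simp: quotient_scwol_def orbits_def)
  then show "A \<in> efib ` edges Y" by (elim dev_edgeE) (auto simp: orbit_dedge)
next
  fix A assume "A \<in> efib ` edges Y"
  then obtain a where a: "a \<in> edges Y" "A = efib a" by blast
  then have "A = orbit dgrp eact (dedge (rep (src Y a)) a)" "dedge (rep (src Y a)) a \<in> edges D"
    using rep[OF src_in[OF a(1)]] by (simp_all add: orbit_dedge dev_edge)
  then show "A \<in> edges Q" unfolding quotient_scwol_def orbits_def scwol.select_convs by blast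
qed

lemma src_Q: assumes a: "a \<in> edges Y" shows "src Q (efib a) = vfib (src Y a)"
  using act.src_orbit[OF dev_edge[OF a rep[OF src_in[OF a]]]] a rep[OF src_in[OF a]]
  by (simp add: quotient_scwol_def orbit_dedge orbit_dvert dev_src)

lemma tgt_Q: assumes a: "a \<in> edges Y" shows "tgt Q (efib a) = vfib (tgt Y a)"
  using act.tgt_orbit[OF dev_edge[OF a rep[OF src_in[OF a]]]] a rep[OF src_in[OF a]]
    paths_to_letter[of "rep (src Y a)" \<sigma>0 "Neg a"] src_in[OF a]
  by (simp add: quotient_scwol_def orbit_dedge orbit_dvert dev_tgt)

lemma cmp_Q:
  assumes ab: "composable Y a b" shows "cmp Q (efib a) (efib b) = efib (cmp Y a b)"
proof -
  have E: "a \<in> edges Y" "b \<in> edges Y" "src Y a = tgt Y b" "cmp Y a b \<in> edges Y" "src Y (cmp Y a b) = src Y b"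
    using ab cmp_in src_cmp by (auto simp: composable_def)
  let ?y = "rep (src Y b)"
  have y: "?y \<in> paths_to \<sigma>0 (src Y b)" using rep src_in E by blast
  have x: "?y \<otimes>\<^bsub>F\<^esub> cl [Neg b] \<in> paths_to \<sigma>0 (src Y a)" using paths_to_letter[of ?y \<sigma>0 "Neg b"] y E by simp
  show ?thesis
    using act.Q_cmp[OF dev_composable[OF ab y]] orbit_dedge[OF E(1) x] orbit_dedge[OF E(2) y] orbit_dedge[OF E(4), of ?y] y E
    by (simp add: dev_cmp[OF ab])
qed

text \<open>Lifts have to be functions of orbits. All members of an orbit carry the same vertex or
  edge of \<open>Y\<close> as second component, so an arbitrary member reveals it. The element
  \<open>hlift\<close> takes x a^-, for \<open>x\<close> the representative at the source, to the
  representative at the target.\<close>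

definition vlift where "vlift V = dvert (rep (snd (SOME v. v \<in> V))) (snd (SOME v. v \<in> V))"
definition elift where "elift A = dedge (rep (src Y (snd (SOME a. a \<in> A)))) (snd (SOME a. a \<in> A))"
definition hlift where "hlift A = (let a = snd (SOME a. a \<in> A) in
  rep (tgt Y a) \<otimes>\<^bsub>F\<^esub> cl [Pos a] \<otimes>\<^bsub>F\<^esub> inv\<^bsub>F\<^esub> rep (src Y a))"

lemma rep_vfib: "\<sigma> \<in> verts Y \<Longrightarrow> dvert (rep \<sigma>) \<sigma> \<in> vfib \<sigma>"
  unfolding vfib_def using rep by blast

lemma rep_efib: "a \<in> edges Y \<Longrightarrow> dedge (rep (src Y a)) a \<in> efib a"
  unfolding efib_def using rep[OF src_in] by blast

lemma snd_vfib: assumes "\<sigma> \<in> verts Y" shows "snd (SOME v. v \<in> vfib \<sigma>) = \<sigma>"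
proof -
  have "(SOME v. v \<in> vfib \<sigma>) \<in> vfib \<sigma>" 
    using rep_vfib[OF assms] by (rule someI)
  then show ?thesis unfolding vfib_def[of \<sigma>] by (auto simp: dvert_def)
qed

lemma snd_efib: assumes "a \<in> edges Y" shows "snd (SOME v. v \<in> efib a) = a"
proof -
  have "(SOME v. v \<in> efib a) \<in> efib a" 
    using rep_efib[OF assms] by (rule someI)
  then show ?thesis unfolding efib_def[of a] by (auto simp: dedge_def)
qed

lemma vlift_vfib: "\<sigma> \<in> verts Y \<Longrightarrow> vlift (vfib \<sigma>) = dvert (rep \<sigma>) \<sigma>"
  by (simp add: vlift_def snd_vfib)

lemma elift_efib: "a \<in> edges Y \<Longrightarrow> elift (efib a) = dedge (rep (src Y a)) a"
  by (simp add: elift_def snd_efib)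

lemma hlift_efib: "a \<in> edges Y \<Longrightarrow> hlift (efib a) = rep (tgt Y a) \<otimes>\<^bsub>F\<^esub> cl [Pos a] \<otimes>\<^bsub>F\<^esub> inv\<^bsub>F\<^esub> rep (src Y a)"
  by (simp add: hlift_def snd_efib)

lemma hlift_in: assumes a: "a \<in> edges Y" shows "hlift (efib a) \<in> paths_to \<sigma>0 \<sigma>0"
proof -
  have "rep (tgt Y a) \<otimes>\<^bsub>F\<^esub> cl [Pos a] \<in> paths_to \<sigma>0 (src Y a)"
    using paths_to_letter[of "rep (tgt Y a)" \<sigma>0 "Pos a"] rep[OF tgt_in[OF a]] a by simp
  then show ?thesis unfolding hlift_efib[OF a] by (rule paths_to_inv[OF rep[OF src_in[OF a]]])
qed

lemma lift_choice_development: "lift_choice dgrp D vact eact vlift elift hlift"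
  unfolding lift_choice_def Let_def verts_Q edges_Q
proof (intro conjI ballI; elim imageE; hypsubst)
  fix \<sigma> assume "\<sigma> \<in> verts Y"
  then show "vlift (vfib \<sigma>) \<in> vfib \<sigma>" by (simp add: vlift_vfib rep_vfib)
next
  fix a assume a: "a \<in> edges Y"
  note r = rep[OF src_in[OF a]] rep[OF tgt_in[OF a]]
  show "elift (efib a) \<in> efib a" using a by (simp add: elift_efib rep_efib)
  show "src D (elift (efib a)) = vlift (src Q (efib a))"
    using a by (simp add: elift_efib dev_src src_Q vlift_vfib src_in)
  show "hlift (efib a) \<in> carrier dgrp" using hlift_in[OF a] by simp
  have "hlift (efib a) \<otimes>\<^bsub>F\<^esub> rep (src Y a) \<otimes>\<^bsub>F\<^esub> cl [Neg a] = rep (tgt Y a)"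
    using a src_in tgt_in by (simp add: hlift_efib cl_Neg F.m_assoc)
  then show "vact (hlift (efib a)) (tgt D (elift (efib a))) = vlift (tgt Q (efib a))"
    using vact_tgt[OF hlift_in[OF a] r(1) a] a by (simp add: elift_efib tgt_Q vlift_vfib tgt_in)
qed

lemma vfib_inj: "inj_on vfib (verts Y)"
  by (rule inj_onI) (metis snd_vfib)

lemma efib_inj: "inj_on efib (edges Y)"
  by (rule inj_onI) (metis snd_efib)

section \<open>The associated complex of groups is isomorphic to the given one\<close>

definition conj_loc :: "'v \<Rightarrow> 'g \<Rightarrow> ('v, 'e, 'g) fg" where
  "conj_loc \<sigma> g = rep \<sigma> \<otimes>\<^bsub>F\<^esub> cl [Loc \<sigma> g] \<otimes>\<^bsub>F\<^esub> inv\<^bsub>F\<^esub> rep \<sigma>"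

text \<open>For the representative x, the element h fixes the coset x G_\<sigma> exactly if h x = x
  g for some g in G_\<sigma>, that is, if h = x g x^{-1}.\<close>

lemma stabilizer_rep:
  assumes \<sigma>: "\<sigma> \<in> verts Y"
  shows "stabilizer dgrp vact (dvert (rep \<sigma>) \<sigma>) = conj_loc \<sigma> ` carrier (lgrp G \<sigma>)"
proof (intro equalityI subsetI)
  fix h assume "h \<in> stabilizer dgrp vact (dvert (rep \<sigma>) \<sigma>)"
  then have h: "h \<in> paths_to \<sigma>0 \<sigma>0" "dvert (rep \<sigma>) \<sigma> = dvert (h \<otimes>\<^bsub>F\<^esub> rep \<sigma>) \<sigma>"
    using rep[OF \<sigma>] by (auto simp: stabilizer_def vact_dvert)
  then obtain g where g: "g \<in> carrier (lgrp G \<sigma>)" "h \<otimes>\<^bsub>F\<^esub> rep \<sigma> = rep \<sigma> \<otimes>\<^bsub>F\<^esub> cl [Loc \<sigma> g]"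
    using \<sigma> paths_to_in dvert_eq_iff[of \<sigma> "rep \<sigma>" "h \<otimes>\<^bsub>F\<^esub> rep \<sigma>" \<sigma>] by auto
  have "h = conj_loc \<sigma> g"
    using g(2) \<sigma> paths_to_in[OF h(1)] by (simp add: conj_loc_def F.m_assoc flip: g(2))
  then show "h \<in> conj_loc \<sigma> ` carrier (lgrp G \<sigma>)" using g(1) by blast
next
  fix h assume "h \<in> conj_loc \<sigma> ` carrier (lgrp G \<sigma>)"
  then obtain g where g: "g \<in> carrier (lgrp G \<sigma>)" "h = conj_loc \<sigma> g" by blast
  have "rep \<sigma> \<otimes>\<^bsub>F\<^esub> cl [Loc \<sigma> g] \<in> paths_to \<sigma>0 \<sigma>"
    using paths_to_letter[of "rep \<sigma>" \<sigma>0 "Loc \<sigma> g"] rep[OF \<sigma>] \<sigma> g by simp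
  then have h: "h \<in> paths_to \<sigma>0 \<sigma>0" unfolding g(2) conj_loc_def by (rule paths_to_inv[OF rep[OF \<sigma>]])
  have "h \<otimes>\<^bsub>F\<^esub> rep \<sigma> = rep \<sigma> \<otimes>\<^bsub>F\<^esub> cl [Loc \<sigma> g]" using \<sigma> g by (simp add: conj_loc_def F.m_assoc)
  then show "h \<in> stabilizer dgrp vact (dvert (rep \<sigma>) \<sigma>)"
    using h rep[OF \<sigma>] \<sigma> g by (simp add: stabilizer_def vact_dvert dvert_Loc)
qed

abbreviation "A \<equiv> associated_cog dgrp D vact eact vlift hlift"

lemma lgrp_A:
  "\<sigma> \<in> verts Y \<Longrightarrow> lgrp A (vfib \<sigma>) = dgrp\<lparr>carrier := conj_loc \<sigma> ` carrier (lgrp G \<sigma>)\<rparr>"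
  by (simp add: associated_cog_def vlift_vfib stabilizer_rep)

lemma conj_loc_mult:
  assumes "\<sigma> \<in> verts Y" "g \<in> carrier (lgrp G \<sigma>)" "h \<in> carrier (lgrp G \<sigma>)"
  shows "conj_loc \<sigma> g \<otimes>\<^bsub>F\<^esub> conj_loc \<sigma> h = conj_loc \<sigma> (g \<otimes>\<^bsub>lgrp G \<sigma>\<^esub> h)"
proof -
  have "conj_loc \<sigma> g \<otimes>\<^bsub>F\<^esub> conj_loc \<sigma> h = rep \<sigma> \<otimes>\<^bsub>F\<^esub> (cl [Loc \<sigma> g] \<otimes>\<^bsub>F\<^esub> cl [Loc \<sigma> h]) \<otimes>\<^bsub>F\<^esub> inv\<^bsub>F\<^esub> rep \<sigma>"
    using assms by (simp add: conj_loc_def F.m_assoc F.inv_solve_left')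
  then show ?thesis using assms by (simp add: cl_Loc_mult conj_loc_def)
qed

lemma conj_loc_in: "\<sigma> \<in> verts Y \<Longrightarrow> g \<in> carrier (lgrp G \<sigma>) \<Longrightarrow> conj_loc \<sigma> g \<in> paths_to \<sigma>0 \<sigma>0"
  using stabilizer_rep[of \<sigma>] by (force simp: stabilizer_def)

lemma Ad_hlift:
  assumes a: "a \<in> edges Y" and g: "g \<in> carrier (lgrp G (src Y a))"
  shows "Ad dgrp (hlift (efib a)) (conj_loc (src Y a) g) = conj_loc (tgt Y a) (psi G a g)"
proof -
  let ?s = "rep (src Y a)" and ?t = "rep (tgt Y a)"
  have c: "?s \<in> carrier F" "?t \<in> carrier F" "cl [Pos a] \<in> carrier F" "cl [Loc (src Y a) g] \<in> carrier F"
    using a g src_in tgt_in by auto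
  have "Ad dgrp (hlift (efib a)) (conj_loc (src Y a) g) =
      (?t \<otimes>\<^bsub>F\<^esub> cl [Pos a] \<otimes>\<^bsub>F\<^esub> inv\<^bsub>F\<^esub> ?s) \<otimes>\<^bsub>F\<^esub> (?s \<otimes>\<^bsub>F\<^esub> cl [Loc (src Y a) g] \<otimes>\<^bsub>F\<^esub> inv\<^bsub>F\<^esub> ?s) \<otimes>\<^bsub>F\<^esub>
      inv\<^bsub>F\<^esub> (?t \<otimes>\<^bsub>F\<^esub> cl [Pos a] \<otimes>\<^bsub>F\<^esub> inv\<^bsub>F\<^esub> ?s)"
    using hlift_in[OF a] by (simp add: Ad_def conj_loc_def hlift_efib[OF a])
  also have "\<dots> = ?t \<otimes>\<^bsub>F\<^esub> (cl [Pos a] \<otimes>\<^bsub>F\<^esub> cl [Loc (src Y a) g] \<otimes>\<^bsub>F\<^esub> inv\<^bsub>F\<^esub> cl [Pos a]) \<otimes>\<^bsub>F\<^esub> inv\<^bsub>F\<^esub> ?t"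
    using c by (simp add: F.m_assoc F.inv_mult_group F.inv_solve_left')
  finally show ?thesis using a g by (simp add: conj_loc_def cl_psi)
qed

text \<open>The representatives at the intermediate vertices cancel, and the twist relation turns
  what is left into a conjugated twisting element.\<close>

lemma twist_hlift:
  assumes ab: "composable Y a b"
  shows "hlift (efib a) \<otimes>\<^bsub>F\<^esub> hlift (efib b) \<otimes>\<^bsub>F\<^esub> inv\<^bsub>F\<^esub> hlift (efib (cmp Y a b)) = conj_loc (tgt Y a) (twist G a b)"
proof -
  have E: "a \<in> edges Y" "b \<in> edges Y" "src Y a = tgt Y b" "cmp Y a b \<in> edges Y" "src Y (cmp Y a b) = src Y b"
    "tgt Y (cmp Y a b) = tgt Y a" "twist G a b \<in> carrier (lgrp G (tgt Y a))"
    using ab cmp_in src_cmp tgt_cmp twist_in by (auto simp: composable_def)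
  let ?t = "rep (tgt Y a)" and ?m = "rep (tgt Y b)" and ?s = "rep (src Y b)" and ?P = "\<lambda>a. cl [Pos a]"
    and ?g = "cl [Loc (tgt Y a) (twist G a b)]"
  have c: "?t \<in> carrier F" "?m \<in> carrier F" "?s \<in> carrier F" "?P a \<in> carrier F" "?P b \<in> carrier F" "?P (cmp Y a b) \<in> carrier F"
    "?g \<in> carrier F" using E src_in tgt_in by auto
  have "hlift (efib a) \<otimes>\<^bsub>F\<^esub> hlift (efib b) \<otimes>\<^bsub>F\<^esub> inv\<^bsub>F\<^esub> hlift (efib (cmp Y a b)) =
      ?t \<otimes>\<^bsub>F\<^esub> (?P a \<otimes>\<^bsub>F\<^esub> ?P b) \<otimes>\<^bsub>F\<^esub> (inv\<^bsub>F\<^esub> ?P (cmp Y a b) \<otimes>\<^bsub>F\<^esub> inv\<^bsub>F\<^esub> ?t)"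
    using c E by (simp add: hlift_efib F.m_assoc F.inv_mult_group F.inv_solve_left')
  also have "\<dots> = conj_loc (tgt Y a) (twist G a b)"
    unfolding cl_twist[OF ab] using c by (simp add: conj_loc_def F.m_assoc) (simp add: F.m_assoc[symmetric])
  finally show ?thesis .
qed

lemma group_lgrp_A:
  assumes "\<sigma> \<in> verts Y" shows "group (lgrp A (vfib \<sigma>))"
proof -
  interpret A: complex_of_groups Q A
    by (rule act.complex_of_groups_associated_cog[OF lift_choice_development])
  show ?thesis by (rule A.lgrp_group) (use assms in \<open>simp add: verts_Q\<close>)
qed

text \<open>The elements attached to edges are trivial because \<open>hlift\<close> and
  \<open>conj_loc\<close> use the same representatives.\<close>

definition dev_mor where
  "dev_mor = \<lparr>on_vert = vfib, on_edge = efib, loc = conj_loc, elt = (\<lambda>_. \<one>\<^bsub>F\<^esub>)\<rparr>"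

text \<open>Here injectivity of the local groups enters: \<open>conj_loc \<sigma>\<close> maps onto
  the stabilizer in any case, and its kernel is that of the map of \<open>lgrp G \<sigma>\<close> to
  \<open>FG\<close>.\<close>

lemma conj_loc_iso:
  assumes \<sigma>: "\<sigma> \<in> verts Y" and inj: "inj_on (\<lambda>g. cl [Loc \<sigma> g]) (carrier (lgrp G \<sigma>))"
  shows "conj_loc \<sigma> \<in> iso (lgrp G \<sigma>) (lgrp A (vfib \<sigma>))"
proof -
  have "inj_on (conj_loc \<sigma>) (carrier (lgrp G \<sigma>))"
  proof (rule inj_onI)
    fix g h assume gh: "g \<in> carrier (lgrp G \<sigma>)" "h \<in> carrier (lgrp G \<sigma>)" "conj_loc \<sigma> g = conj_loc \<sigma> h"
    then have "cl [Loc \<sigma> g] = cl [Loc \<sigma> h]" using \<sigma> by (simp add: conj_loc_def)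
    then show "g = h" using inj_onD[OF inj, of g h] gh(1,2) by simp
  qed
  then show ?thesis
    using \<sigma> by (simp add: iso_def lgrp_A hom_def conj_loc_mult inj_on_imp_bij_betw)
qed

lemma cog_isomorphism_dev_mor:
  assumes inj: "\<And>\<sigma>. \<sigma> \<in> verts Y \<Longrightarrow> inj_on (\<lambda>g. cl [Loc \<sigma> g]) (carrier (lgrp G \<sigma>))"
  shows "cog_isomorphism Y G Q A dev_mor"
proof -
  have sel: "on_vert dev_mor = vfib" "on_edge dev_mor = efib" "loc dev_mor = conj_loc" "elt dev_mor = (\<lambda>_. \<one>\<^bsub>F\<^esub>)"
    by (simp_all add: dev_mor_def)
  have psiA: "psi A = (\<lambda>a. Ad dgrp (hlift a))" by (simp add: associated_cog_def)
  have twA: "twist A = (\<lambda>a b. hlift a \<otimes>\<^bsub>dgrp\<^esub> hlift b \<otimes>\<^bsub>dgrp\<^esub> inv\<^bsub>dgrp\<^esub> hlift (cmp Q a b))"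
    by (simp add: associated_cog_def)
  have iso: "conj_loc \<sigma> \<in> iso (lgrp G \<sigma>) (lgrp A (vfib \<sigma>))" if "\<sigma> \<in> verts Y" for \<sigma>
    by (rule conj_loc_iso[OF that inj[OF that]])
  have one: "\<one>\<^bsub>lgrp A (vfib \<sigma>)\<^esub> = \<one>\<^bsub>F\<^esub>" if "\<sigma> \<in> verts Y" for \<sigma> using that by (simp add: lgrp_A)
  have func: "scwol_functor Y Q vfib efib"
    unfolding scwol_functor_def
    by (auto simp: verts_Q edges_Q src_Q tgt_Q cmp_Q)
  have "cog_morphism Y G Q A dev_mor"
    unfolding cog_morphism_def sel
  proof (intro conjI ballI allI impI func)
    fix \<sigma> assume "\<sigma> \<in> verts Y"
    then show "conj_loc \<sigma> \<in> hom (lgrp G \<sigma>) (lgrp A (vfib \<sigma>))" using iso by (simp add: iso_def)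
  next
    fix a assume a: "a \<in> edges Y"
    interpret M: group "lgrp A (vfib (tgt Y a))" by (rule group_lgrp_A[OF tgt_in[OF a]])
    show "\<one>\<^bsub>F\<^esub> \<in> carrier (lgrp A (tgt Q (efib a)))"
      using M.one_closed by (simp add: tgt_Q[OF a] one[OF tgt_in[OF a]])
    fix g assume g: "g \<in> carrier (lgrp G (src Y a))"
    have "psi A (efib a) (conj_loc (src Y a) g) = conj_loc (tgt Y a) (psi G a g)"
      using Ad_hlift[OF a g] by (simp add: psiA)
    moreover have "conj_loc (tgt Y a) (psi G a g) \<in> carrier (lgrp A (vfib (tgt Y a)))"
      using psi_in[OF a g] tgt_in[OF a] by (simp add: lgrp_A)
    ultimately show "Ad (lgrp A (tgt Q (efib a))) \<one>\<^bsub>F\<^esub> (psi A (efib a) (conj_loc (src Y a) g)) = conj_loc (tgt Y a) (psi G a g)"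
      using M.Ad_one by (simp add: tgt_Q[OF a] one[OF tgt_in[OF a]])
  next
    fix a b assume ab: "composable Y a b"
    have E: "a \<in> edges Y" "b \<in> edges Y" "cmp Y a b \<in> edges Y" "tgt Y a \<in> verts Y" "src Y a \<in> verts Y" "tgt Y b = src Y a"
      using ab cmp_in tgt_in src_in by (auto simp: composable_def)
    have tw: "twist A (efib a) (efib b) = conj_loc (tgt Y a) (twist G a b)"
      using twist_hlift[OF ab] hlift_in[OF E(3)] by (simp add: twA cmp_Q[OF ab])
    have psi1: "psi A (efib a) \<one>\<^bsub>F\<^esub> = \<one>\<^bsub>F\<^esub>"
      using hlift_in[OF E(1)] paths_to_in[OF hlift_in[OF E(1)]] by (simp add: psiA Ad_def)
    have "conj_loc (tgt Y a) (twist G a b) \<in> carrier F"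
      using conj_loc_in[OF E(4) twist_in[OF ab]] by (rule paths_to_in)
    then show "conj_loc (tgt Y a) (twist G a b) \<otimes>\<^bsub>lgrp A (tgt Q (efib a))\<^esub> \<one>\<^bsub>F\<^esub> =
        \<one>\<^bsub>F\<^esub> \<otimes>\<^bsub>lgrp A (tgt Q (efib a))\<^esub> psi A (efib a) \<one>\<^bsub>F\<^esub> \<otimes>\<^bsub>lgrp A (tgt Q (efib a))\<^esub> twist A (efib a) (efib b)"
      using E by (simp add: tgt_Q lgrp_A tw psi1)
  qed
  then show ?thesis
    unfolding cog_isomorphism_def scwol_isomorphism_def sel
    using func iso inj_on_imp_bij_betw[OF vfib_inj] inj_on_imp_bij_betw[OF efib_inj] by (simp add: verts_Q edges_Q)
qed

lemma developable_based:
  assumes "\<And>\<sigma>. \<sigma> \<in> verts Y \<Longrightarrow> inj_on (\<lambda>g. cl [Loc \<sigma> g]) (carrier (lgrp G \<sigma>))"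
  shows "developable Y G"
  unfolding developable_def developable_over_def
  using simply_connected_development scwol_action_development lift_choice_development
    cog_isomorphism_dev_mor[OF assms] by blast

end

section \<open>Injectivity of the local groups\<close>

definition word_val :: "('h, 'm) monoid_scheme \<Rightarrow> (('v, 'e, 'g) letter \<Rightarrow> 'h) \<Rightarrow> ('v, 'e, 'g) fg_word \<Rightarrow> 'h" where
  "word_val H f w = foldr (\<lambda>l x. f l \<otimes>\<^bsub>H\<^esub> x) w \<one>\<^bsub>H\<^esub>"

lemma word_val_simps [simp]:
  "word_val H f [] = \<one>\<^bsub>H\<^esub>" "word_val H f (l # w) = f l \<otimes>\<^bsub>H\<^esub> word_val H f w"
  by (simp_all add: word_val_def)

context group
begin

lemma word_val_in: "(\<And>l. f l \<in> carrier G) \<Longrightarrow> word_val G f w \<in> carrier G"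
  by (induction w) auto

lemma word_val_append:
  assumes "\<And>l. f l \<in> carrier G"
  shows "word_val G f (u @ v) = word_val G f u \<otimes> word_val G f v"
  using assms by (induction u) (auto simp: word_val_in m_assoc)

text \<open>The universal property of the presented group. The values \<open>f l\<close> must lie in
  the group for every letter of the type, since a chain of rewritings may contain letters outside
  the alphabet.\<close>

lemma word_val_fg_eq:
  assumes f: "\<And>l. f l \<in> carrier G" and rel: "\<And>l r. fg_rel Y K l r \<Longrightarrow> word_val G f l = word_val G f r"
    and eq: "fg_eq Y K u v"
  shows "word_val G f u = word_val G f v"
  by (rule fg_eq_invariant[OF eq]) (simp add: word_val_append[OF f] rel)

end

text \<open>The isomorphism with the associated complex carries elements of its own, so a^+ has to
  go to \<open>elt \<phi> a\<close> times the chosen element of the image edge. The resulting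
  homomorphism restricts on each local group to \<open>loc \<phi>\<close>, which is
  injective.\<close>

lemma developable_over_imp_injective:
  assumes Y: "complex_of_groups Y G" and dev: "developable_over TYPE('h \<times> 'w \<times> 'd) Y G" and \<sigma>: "\<sigma> \<in> verts Y"
  shows "inj_on (\<lambda>g. fg_class Y G [Loc \<sigma> g]) (carrier (lgrp G \<sigma>))"
proof -
  interpret complex_of_groups Y G by fact
  from dev obtain H :: "'h monoid" and X :: "('w, 'd) scwol" and av ae vlift elift h \<phi>
    where act: "scwol_action H X av ae" and lift: "lift_choice H X av ae vlift elift h"
      and iso: "cog_isomorphism Y G (quotient_scwol H X av ae) (associated_cog H X av ae vlift h) \<phi>"
    unfolding developable_over_def by blast
  interpret A: scwol_action H X av ae by fact
  interpret H: group H by (rule group_hom.axioms(1)[OF A.verts.group_hom])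
  let ?Q = "quotient_scwol H X av ae" and ?A = "associated_cog H X av ae vlift h"
  interpret AC: complex_of_groups ?Q ?A by (rule A.complex_of_groups_associated_cog[OF lift])
  let ?v = "on_vert \<phi>" and ?e = "on_edge \<phi>"
  note m = iso[unfolded cog_isomorphism_def cog_morphism_def scwol_functor_def]
  have v: "?v \<tau> \<in> verts ?Q" if "\<tau> \<in> verts Y" for \<tau> using m that by blast
  have e: "?e a \<in> edges ?Q" "src ?Q (?e a) = ?v (src Y a)" "tgt ?Q (?e a) = ?v (tgt Y a)" if "a \<in> edges Y" for a
    using m that by blast+
  have ecmp: "?e (cmp Y a b) = cmp ?Q (?e a) (?e b)" if "composable Y a b" for a b using m that by blast
  have loc_iso: "loc \<phi> \<tau> \<in> iso (lgrp G \<tau>) (lgrp ?A (?v \<tau>))" if "\<tau> \<in> verts Y" for \<tau> using m that by blast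
  have lgA: "lgrp ?A q = H\<lparr>carrier := stabilizer H av (vlift q)\<rparr>" for q by (simp add: associated_cog_def)
  have hin: "h q \<in> carrier H" if "q \<in> edges ?Q" for q using lift that by (simp add: lift_choice_def Let_def)
  have sub: "x \<in> carrier H" if "x \<in> carrier (lgrp ?A q)" for x q using that by (simp add: lgA stabilizer_def)
  have invA: "inv\<^bsub>lgrp ?A q\<^esub> x = inv\<^bsub>H\<^esub> x" if "q \<in> verts ?Q" "x \<in> carrier (lgrp ?A q)" for q x
  proof -
    interpret M: group "lgrp ?A q" using that(1) by (rule AC.lgrp_group)
    have "inv\<^bsub>lgrp ?A q\<^esub> x \<otimes>\<^bsub>H\<^esub> x = \<one>\<^bsub>H\<^esub>" using M.l_inv[OF that(2)] by (simp add: lgA)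
    then show ?thesis using H.inv_equality sub that(2) M.inv_closed by metis
  qed
  have locA: "loc \<phi> \<tau> g \<in> carrier (lgrp ?A (?v \<tau>))" if "\<tau> \<in> verts Y" "g \<in> carrier (lgrp G \<tau>)" for \<tau> g
  proof -
    have "loc \<phi> \<tau> \<in> hom (lgrp G \<tau>) (lgrp ?A (?v \<tau>))" using loc_iso[OF that(1)] by (simp add: iso_def)
    then show ?thesis using that(2) by (rule hom_in_carrier)
  qed
  have eltA: "elt \<phi> a \<in> carrier (lgrp ?A (?v (tgt Y a)))" if "a \<in> edges Y" for a using m e that by metis
  \<comment> \<open>The value one outside the alphabet makes every letter evaluate inside
    \<open>H\<close>.\<close>
  define f where "f l = (if l \<in> fg_letters Y G then (case l of Loc \<tau> g \<Rightarrow> loc \<phi> \<tau> g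
      | Pos a \<Rightarrow> elt \<phi> a \<otimes>\<^bsub>H\<^esub> h (?e a) | Neg a \<Rightarrow> inv\<^bsub>H\<^esub> (elt \<phi> a \<otimes>\<^bsub>H\<^esub> h (?e a))) else \<one>\<^bsub>H\<^esub>)" for l
  have inH: "elt \<phi> a \<in> carrier H" "h (?e a) \<in> carrier H" if "a \<in> edges Y" for a
    using sub[OF eltA[OF that]] hin e that by auto
  have locH: "loc \<phi> \<tau> g \<in> carrier H" if "\<tau> \<in> verts Y" "g \<in> carrier (lgrp G \<tau>)" for \<tau> g
    using sub[OF locA[OF that]] .
  have f: "f l \<in> carrier H" for l
    by (cases l) (auto simp: f_def inH locH)
  have locmult: "loc \<phi> \<tau> (g \<otimes>\<^bsub>lgrp G \<tau>\<^esub> g') = loc \<phi> \<tau> g \<otimes>\<^bsub>H\<^esub> loc \<phi> \<tau> g'"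
    if "\<tau> \<in> verts Y" "g \<in> carrier (lgrp G \<tau>)" "g' \<in> carrier (lgrp G \<tau>)" for \<tau> g g'
    using hom_mult[of "loc \<phi> \<tau>" "lgrp G \<tau>" "lgrp ?A (?v \<tau>)" g g'] loc_iso[OF that(1)] that by (simp add: iso_def lgA)
  have locone: "loc \<phi> \<tau> \<one>\<^bsub>lgrp G \<tau>\<^esub> = \<one>\<^bsub>H\<^esub>" if "\<tau> \<in> verts Y" for \<tau>
    using hom_one[of "loc \<phi> \<tau>" "lgrp G \<tau>" "lgrp ?A (?v \<tau>)"] loc_iso[OF that] lgrp_group[OF that] AC.lgrp_group[OF v[OF that]]
    by (simp add: iso_def lgA)
  have psi: "loc \<phi> (tgt Y a) (psi G a g) = elt \<phi> a \<otimes>\<^bsub>H\<^esub> (h (?e a) \<otimes>\<^bsub>H\<^esub> loc \<phi> (src Y a) g \<otimes>\<^bsub>H\<^esub> inv\<^bsub>H\<^esub> h (?e a)) \<otimes>\<^bsub>H\<^esub> inv\<^bsub>H\<^esub> elt \<phi> a"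
    if a: "a \<in> edges Y" and g: "g \<in> carrier (lgrp G (src Y a))" for a g
  proof -
    have "Ad (lgrp ?A (?v (tgt Y a))) (elt \<phi> a) (psi ?A (?e a) (loc \<phi> (src Y a) g)) = loc \<phi> (tgt Y a) (psi G a g)"
      using m a g e by metis
    then show ?thesis
      using invA[OF v[OF tgt_in[OF a]] eltA[OF a]] by (simp add: Ad_def lgA) (simp add: associated_cog_def Ad_def)
  qed
  have psiA: "psi ?A (?e a) x = h (?e a) \<otimes>\<^bsub>H\<^esub> x \<otimes>\<^bsub>H\<^esub> inv\<^bsub>H\<^esub> h (?e a)" for a x
    by (simp add: associated_cog_def Ad_def)
  have tw: "loc \<phi> (tgt Y a) (twist G a b) \<otimes>\<^bsub>H\<^esub> elt \<phi> (cmp Y a b) =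
      elt \<phi> a \<otimes>\<^bsub>H\<^esub> (h (?e a) \<otimes>\<^bsub>H\<^esub> elt \<phi> b \<otimes>\<^bsub>H\<^esub> inv\<^bsub>H\<^esub> h (?e a)) \<otimes>\<^bsub>H\<^esub>
      (h (?e a) \<otimes>\<^bsub>H\<^esub> h (?e b) \<otimes>\<^bsub>H\<^esub> inv\<^bsub>H\<^esub> h (?e (cmp Y a b)))"
    if ab: "composable Y a b" for a b
  proof -
    have "loc \<phi> (tgt Y a) (twist G a b) \<otimes>\<^bsub>lgrp ?A (tgt ?Q (?e a))\<^esub> elt \<phi> (cmp Y a b)
        = elt \<phi> a \<otimes>\<^bsub>lgrp ?A (tgt ?Q (?e a))\<^esub> psi ?A (?e a) (elt \<phi> b) \<otimes>\<^bsub>lgrp ?A (tgt ?Q (?e a))\<^esub> twist ?A (?e a) (?e b)"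
      using m ab by blast
    then show ?thesis by (simp add: lgA psiA ecmp[OF ab]) (simp add: associated_cog_def)
  qed
  have cancel: "x \<otimes>\<^bsub>H\<^esub> (inv\<^bsub>H\<^esub> x \<otimes>\<^bsub>H\<^esub> y) = y" "inv\<^bsub>H\<^esub> x \<otimes>\<^bsub>H\<^esub> (x \<otimes>\<^bsub>H\<^esub> y) = y"
    if "x \<in> carrier H" "y \<in> carrier H" for x y using that by (simp_all add: H.m_assoc[symmetric])
  have rel: "word_val H f l = word_val H f r" if "fg_rel Y G l r" for l r
    using that
  proof cases
    case (rel_mult \<tau> g g')
    then show ?thesis
      using monoid.m_closed[OF group.is_monoid[OF lgrp_group[OF rel_mult(3)]] rel_mult(4,5)]
      by (simp add: f_def locmult locH)
  next
    case (rel_one \<tau>)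
    then show ?thesis
      using monoid.one_closed[OF group.is_monoid[OF lgrp_group[OF rel_one(3)]]] by (simp add: f_def locone)
  next
    case (rel_pos_neg a) then show ?thesis by (simp add: f_def inH)
  next
    case (rel_neg_pos a) then show ?thesis by (simp add: f_def inH)
  next
    case (rel_twist a b)
    then have E: "a \<in> edges Y" "b \<in> edges Y" "cmp Y a b \<in> edges Y" "tgt Y a \<in> verts Y" "twist G a b \<in> carrier (lgrp G (tgt Y a))"
      using cmp_in tgt_in twist_in by (auto simp: composable_def)
    have "loc \<phi> (tgt Y a) (twist G a b) \<otimes>\<^bsub>H\<^esub> (elt \<phi> (cmp Y a b) \<otimes>\<^bsub>H\<^esub> h (?e (cmp Y a b)))
        = (loc \<phi> (tgt Y a) (twist G a b) \<otimes>\<^bsub>H\<^esub> elt \<phi> (cmp Y a b)) \<otimes>\<^bsub>H\<^esub> h (?e (cmp Y a b))"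
      using E by (simp add: H.m_assoc inH locH)
    also have "\<dots> = elt \<phi> a \<otimes>\<^bsub>H\<^esub> h (?e a) \<otimes>\<^bsub>H\<^esub> (elt \<phi> b \<otimes>\<^bsub>H\<^esub> h (?e b))"
      unfolding tw[OF rel_twist(3)] using E by (simp add: H.m_assoc inH cancel)
    finally show ?thesis using E by (simp add: rel_twist f_def inH locH)
  next
    case (rel_psi a g)
    then show ?thesis
      using psi_in[OF rel_psi(3,4)] src_in[OF rel_psi(3)] tgt_in[OF rel_psi(3)]
      by (simp add: f_def psi inH locH H.m_assoc H.inv_mult_group)
  qed
  show ?thesis
  proof (rule inj_onI)
    fix g g' assume g: "g \<in> carrier (lgrp G \<sigma>)" "g' \<in> carrier (lgrp G \<sigma>)" and "cl [Loc \<sigma> g] = cl [Loc \<sigma> g']"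
    then have eq: "fg_eq Y G [Loc \<sigma> g] [Loc \<sigma> g']" by (simp add: fg_class_eq_iff)
    have "word_val H f [Loc \<sigma> g] = word_val H f [Loc \<sigma> g']" by (rule H.word_val_fg_eq[where f = f, OF f rel eq])
    then have "loc \<phi> \<sigma> g = loc \<phi> \<sigma> g'" using \<sigma> g by (simp add: f_def locH)
    then show "g = g'" using loc_iso[OF \<sigma>] g by (auto simp: iso_def bij_betw_def dest: inj_onD)
  qed
qed

text \<open>Without a base vertex there is no coset construction. The empty scwol serves instead: it
  has no loops to contract, and any group of the prescribed type acts on it, for instance
  \<open>FG\<close>.\<close>

lemma developable_no_verts:
  assumes Y: "complex_of_groups Y G" and empty: "verts Y = {}" shows "developable Y G"
proof -
  interpret complex_of_groups Y G by fact
  have edges: "edges Y = {}" using src_in empty by fastforce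
  let ?X = "\<lparr>verts = {}, edges = {}, src = undefined, tgt = undefined, cmp = undefined\<rparr>
     :: (('v, 'e, 'g) fg set \<times> 'v, ('v, 'e, 'g) fg set \<times> 'e) scwol" 
  let ?av = "\<lambda>_ :: ('v, 'e, 'g) fg. restrict id ({} :: (('v, 'e, 'g) fg set \<times> 'v) set)"
  let ?ae = "\<lambda>_ :: ('v, 'e, 'g) fg. restrict id ({} :: (('v, 'e, 'g) fg set \<times> 'e) set)"
  have X: "scwol ?X" by (rule scwol.intro) (auto simp: composable_def)
  have "group_action F {} ?av" "group_action F {} ?ae"
    by (rule group_action_restrictI; simp add: F.group_axioms)+
  then have act: "scwol_action F ?X ?av ?ae"
    by (intro scwol_action.intro scwol_action_axioms.intro X) (auto simp: scwol_functor_def composable_def)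
  have "topspace (realization ?X) = glue_class ?X ` topspace (simplex_space ?X)"
    using quotient_imp_surjective_map[OF quotient_map_realization] by metis
  also have "\<dots> = {}" by (auto simp: simplex_space_def simplices_def)
  finally have top: "topspace (realization ?X) = {}" .
  have "\<not> pathin (realization ?X) p" for p
  proof
    assume "pathin (realization ?X) p"
    then have "p \<in> {0..1} \<rightarrow> topspace (realization ?X)"
      unfolding pathin_def by (metis continuous_map_funspace topspace_euclidean_subtopology)
    then have "p 0 \<in> topspace (realization ?X)" by (rule funcset_mem) simp
    then show False by (simp only: top empty_iff)
  qed
  then have sc: "simply_connected_scwol ?X"
    unfolding simply_connected_scwol_def simply_connected_space_def by blast
  have Q: "verts (quotient_scwol F ?X ?av ?ae) = {}" "edges (quotient_scwol F ?X ?av ?ae) = {}"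
    by (simp_all add: quotient_scwol_def orbits_def)
  have "lift_choice F ?X ?av ?ae undefined undefined undefined"
    by (simp add: lift_choice_def Let_def Q)
  moreover have "cog_isomorphism Y G (quotient_scwol F ?X ?av ?ae) (associated_cog F ?X ?av ?ae undefined undefined) undefined"
    by (simp add: cog_isomorphism_def cog_morphism_def scwol_functor_def scwol_isomorphism_def empty edges Q composable_def bij_betw_def)
  ultimately show ?thesis
    unfolding developable_def developable_over_def using sc act by blast
qed

lemma developable_if_injective:
  assumes Y: "complex_of_groups Y G" "connected_scwol Y"
    and inj: "\<And>\<sigma>. \<sigma> \<in> verts Y \<Longrightarrow> inj_on (\<lambda>g. fg_class Y G [Loc \<sigma> g]) (carrier (lgrp G \<sigma>))"
  shows "developable Y G"
proof (cases "verts Y = {}")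
  case True
  then show ?thesis using developable_no_verts Y(1) by blast
next
  case False
  then obtain \<sigma>0 where \<sigma>0: "\<sigma>0 \<in> verts Y" by blast
  interpret complex_of_groups Y G by fact
  interpret based_cog Y G \<sigma>0
    by unfold_locales (use \<sigma>0 connected_wpath[OF Y(2)] in auto)
  show ?thesis using inj by (rule developable_based)
qed

lemma gpath_imp_wpath:
  assumes "scwol Y" "gpath Y G \<sigma> w \<tau>" shows "wpath Y G \<sigma> w \<tau>"
  using assms(2) by (induction rule: gpath.induct) (auto simp: scwol.src_in[OF assms(1)] scwol.tgt_in[OF assms(1)])

section \<open>The fundamental group of the local complex of groups\<close>

locale cone_cog = complex_of_groups Y G
  for Y :: "('v, 'e) scwol" and G :: "('v, 'e, 'g) cog" +
  fixes \<gamma> :: 'v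
  assumes \<gamma>: "\<gamma> \<in> verts Y"
begin

abbreviation "L \<equiv> local_scwol Y \<gamma>"
abbreviation "LG \<equiv> local_cog Y G \<gamma>"

sublocale L: complex_of_groups L LG
  by (rule complex_of_groups_local_cog[OF complex_of_groups_axioms \<gamma>])

sublocale M: group "lgrp G \<gamma>"
  by (rule lgrp_group[OF \<gamma>])

lemma LG_simps [simp]:
  "lgrp LG = local_grp Y G \<gamma>" "psi LG = local_psi G" "twist LG = local_twist G \<gamma>"
  by (simp_all add: local_cog_def)

text \<open>
  Since \<open>\<gamma>\<close> is a cone point, \<open>L(\<Y>(\<gamma>))\<close> retracts onto \<open>G\<^sub>\<gamma>\<close>.
\<close>

fun retr :: "('e local_vert, 'e local_edge, 'g) letter \<Rightarrow> 'g" where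
  "retr (Loc (Upper c) g) = psi G c g"
| "retr (Loc Cone g) = g"
| "retr (Loc (Lower b) g) = g"
| "retr (Pos (UpperE c d)) = twist G c d"
| "retr (Neg (UpperE c d)) = inv\<^bsub>lgrp G \<gamma>\<^esub> twist G c d"
| "retr _ = \<one>\<^bsub>lgrp G \<gamma>\<^esub>"

text \<open>Totalized so that letters outside the alphabet also have values in the group.\<close>

definition retr' where "retr' l = (if l \<in> fg_letters L LG then retr l else \<one>\<^bsub>lgrp G \<gamma>\<^esub>)"

lemma twist_in_\<gamma>: "c \<in> edges Y \<Longrightarrow> d \<in> edges Y \<Longrightarrow> src Y c = tgt Y d \<Longrightarrow> tgt Y c = \<gamma> \<Longrightarrow> twist G c d \<in> carrier (lgrp G \<gamma>)"
  using twist_in[of c d] by (simp add: composable_def)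

lemma psi_in_\<gamma>: "c \<in> edges Y \<Longrightarrow> tgt Y c = \<gamma> \<Longrightarrow> g \<in> carrier (lgrp G (src Y c)) \<Longrightarrow> psi G c g \<in> carrier (lgrp G \<gamma>)"
  using psi_in[of c g] by simp

lemma retr'_in: "retr' l \<in> carrier (lgrp G \<gamma>)"
proof (cases "l \<in> fg_letters L LG")
  case True
  then show ?thesis
  proof (cases l)
    case (Loc v g) then show ?thesis using True by (cases v) (auto simp: retr'_def psi_in_\<gamma>)
  next
    case (Pos a) then show ?thesis using True by (cases a) (auto simp: retr'_def twist_in_\<gamma>)
  next
    case (Neg a) then show ?thesis using True by (cases a) (auto simp: retr'_def twist_in_\<gamma>)
  qed
qed (simp add: retr'_def)

text \<open>Once the edges into and out of the cone point are sent to one, the relation between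
  \<open>ToCone c\<close>, \<open>UpperE c d\<close> and their composite forces
  \<open>UpperE c d\<close> to go to g_{c,d}. On the upper link the twist relations then become the
  cocycle identity and the relations for \<open>psi\<close> become \<open>Ad_twist\<close>.\<close>

lemma retr_rel:
  assumes "fg_rel L LG l r" shows "word_val (lgrp G \<gamma>) retr' l = word_val (lgrp G \<gamma>) retr' r"
  using assms
proof cases
  case (rel_mult v g h)
  have "g \<otimes>\<^bsub>local_grp Y G \<gamma> v\<^esub> h \<in> carrier (local_grp Y G \<gamma> v)"
    using rel_mult monoid.m_closed[OF group.is_monoid[OF L.lgrp_group]] by simp
  then show ?thesis using rel_mult
    by (cases v) (auto simp: retr'_def psi_in_\<gamma> hom_mult[OF psi_hom])
next
  case (rel_one v)
  have "\<one>\<^bsub>local_grp Y G \<gamma> v\<^esub> \<in> carrier (local_grp Y G \<gamma> v)"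
    using rel_one monoid.one_closed[OF group.is_monoid[OF L.lgrp_group]] by simp
  moreover have "psi G c \<one>\<^bsub>lgrp G (src Y c)\<^esub> = \<one>\<^bsub>lgrp G \<gamma>\<^esub>" if "c \<in> edges Y" "tgt Y c = \<gamma>" for c
    using hom_one[OF psi_hom[OF that(1)]] lgrp_group src_in tgt_in that by auto
  ultimately show ?thesis using rel_one by (cases v) (auto simp: retr'_def)
next
  case (rel_pos_neg a)
  then show ?thesis by (cases a) (auto simp: retr'_def twist_in_\<gamma>)
next
  case (rel_neg_pos a)
  then show ?thesis by (cases a) (auto simp: retr'_def twist_in_\<gamma>)
next
  case (rel_twist a b)
  have ab: "a \<in> edges L" "b \<in> edges L" "cmp L a b \<in> edges L" "twist LG a b \<in> carrier (lgrp LG (tgt L a))" "tgt L a \<in> verts L"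
    "local_src Y a = local_tgt Y b"
    using rel_twist(3) L.cmp_in[OF rel_twist(3)] L.twist_in[OF rel_twist(3)] L.tgt_in by (auto simp: composable_def)
  have co: "twist G c d \<otimes>\<^bsub>lgrp G \<gamma>\<^esub> twist G (cmp Y c d) d' = psi G c (twist G d d') \<otimes>\<^bsub>lgrp G \<gamma>\<^esub> twist G c (cmp Y d d')"
    if "c \<in> edges Y" "d \<in> edges Y" "d' \<in> edges Y" "src Y c = tgt Y d" "src Y d = tgt Y d'" "tgt Y c = \<gamma>" for c d d'
    using cocycle[of c d d'] that by (simp add: composable_def)
  have ci: "cmp Y c d \<in> edges Y" "src Y (cmp Y c d) = src Y d" "tgt Y (cmp Y c d) = tgt Y c"
    if "c \<in> edges Y" "d \<in> edges Y" "src Y c = tgt Y d" for c d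
    using cmp_in src_cmp tgt_cmp that by (simp_all add: composable_def)
  have "retr (Pos a) \<otimes>\<^bsub>lgrp G \<gamma>\<^esub> retr (Pos b) =
      retr (Loc (local_tgt Y a) (local_twist G \<gamma> a b)) \<otimes>\<^bsub>lgrp G \<gamma>\<^esub> retr (Pos (local_cmp Y a b))"
    using ab(1,2,6)
    apply (cases a; cases b; simp only: local_scwol_simps local_src.simps local_tgt.simps local_vert.inject
        local_vert.distinct local_cmp.simps local_twist.simps retr.simps; (elim conjE)?)
    subgoal for c d c' d' using co[of c d d'] ci(2)[of c d] by simp
    subgoal by (simp add: twist_in_\<gamma>)
    subgoal by (simp add: twist_in_\<gamma>)
    done
  moreover have "l \<in> lists (fg_letters L LG)" "r \<in> lists (fg_letters L LG)"
    using ab by (simp_all add: rel_twist(1,2))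
  then have "word_val (lgrp G \<gamma>) retr' l = retr (Pos a) \<otimes>\<^bsub>lgrp G \<gamma>\<^esub> retr (Pos b)"
    "word_val (lgrp G \<gamma>) retr' r = retr (Loc (local_tgt Y a) (local_twist G \<gamma> a b)) \<otimes>\<^bsub>lgrp G \<gamma>\<^esub> retr (Pos (local_cmp Y a b))"
    using retr'_in[of "Pos b"] retr'_in[of "Pos (local_cmp Y a b)"] by (simp_all add: rel_twist(1,2) retr'_def)
  ultimately show ?thesis by simp
next
  case (rel_psi a g)
  have g: "local_psi G a g \<in> carrier (local_grp Y G \<gamma> (local_tgt Y a))" "local_src Y a \<in> verts L" "local_tgt Y a \<in> verts L"
    using L.psi_in[OF rel_psi(3,4)] L.src_in[OF rel_psi(3)] L.tgt_in[OF rel_psi(3)] by simp_all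
  have ad: "psi G c (psi G d k) = twist G c d \<otimes>\<^bsub>lgrp G \<gamma>\<^esub> (psi G (cmp Y c d) k \<otimes>\<^bsub>lgrp G \<gamma>\<^esub> inv\<^bsub>lgrp G \<gamma>\<^esub> twist G c d)"
    if "c \<in> edges Y" "d \<in> edges Y" "src Y c = tgt Y d" "tgt Y c = \<gamma>" "k \<in> carrier (lgrp G (src Y d))" for c d k
    using Ad_twist[of c d k] that psi_in_\<gamma>[of "cmp Y c d" k] twist_in_\<gamma>[of c d] cmp_in src_cmp tgt_cmp
    by (simp add: composable_def Ad_def M.m_assoc)
  have ci: "cmp Y c d \<in> edges Y" "src Y (cmp Y c d) = src Y d" "tgt Y (cmp Y c d) = tgt Y c"
    if "c \<in> edges Y" "d \<in> edges Y" "src Y c = tgt Y d" for c d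
    using cmp_in src_cmp tgt_cmp that by (simp_all add: composable_def)
  show ?thesis using rel_psi(3,4) g
    by (cases a) (auto simp: rel_psi(1,2) retr'_def ad ci twist_in_\<gamma> psi_in_\<gamma>)
qed

lemma inj_cone: "inj_on (\<lambda>g. L.cl [Loc Cone g]) (carrier (lgrp G \<gamma>))"
proof (rule inj_onI)
  fix g h assume g: "g \<in> carrier (lgrp G \<gamma>)" "h \<in> carrier (lgrp G \<gamma>)" and "L.cl [Loc Cone g] = L.cl [Loc Cone h]"
  then have eq: "fg_eq L LG [Loc Cone g] [Loc Cone h]" by (simp add: fg_class_eq_iff)
  have "word_val (lgrp G \<gamma>) retr' [Loc Cone g] = word_val (lgrp G \<gamma>) retr' [Loc Cone h]"
    by (rule M.word_val_fg_eq[where f = retr', OF retr'_in retr_rel eq])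
  then show "g = h" using g by (simp add: retr'_def)
qed

text \<open>The class of the direct path from an object to the cone point: against the edge into it,
  the empty path, or the letter \<open>Pos\<close> of the edge out of it, whose path runs from
  target to source.\<close>

fun spoke :: "'e local_vert \<Rightarrow> ('e local_vert, 'e local_edge, 'g) fg" where
  "spoke (Upper c) = L.cl [Neg (ToCone c)]"
| "spoke Cone = \<one>\<^bsub>L.F\<^esub>"
| "spoke (Lower b) = L.cl [Pos (FromCone b)]"

lemma spoke_in: "v \<in> verts L \<Longrightarrow> spoke v \<in> carrier L.F"
  by (cases v) auto

text \<open>Every edge of the local scwol that misses the cone point forms a triangle with it, and
  the composition relation of that triangle, solved for the edge, expresses it by spokes and one
  element of the cone group. Edges through the cone point are spokes themselves, and local elements
  of the links move to the cone by the relation for \<open>psi\<close>.\<close>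

lemma cone_letter:
  assumes l: "l \<in> fg_letters L LG"
  shows "\<exists>g\<in>carrier (lgrp G \<gamma>). L.cl [l] = spoke (letter_start L l) \<otimes>\<^bsub>L.F\<^esub> L.cl [Loc Cone g] \<otimes>\<^bsub>L.F\<^esub> inv\<^bsub>L.F\<^esub> spoke (letter_end L l)"
proof -
  have edge: "\<exists>g\<in>carrier (lgrp G \<gamma>). L.cl [Pos a] = spoke (tgt L a) \<otimes>\<^bsub>L.F\<^esub> L.cl [Loc Cone g] \<otimes>\<^bsub>L.F\<^esub> inv\<^bsub>L.F\<^esub> spoke (src L a)"
    if a: "a \<in> edges L" for a
  proof -
    have one: "L.cl [Loc Cone \<one>\<^bsub>lgrp G \<gamma>\<^esub>] = \<one>\<^bsub>L.F\<^esub>" "L.cl [Loc (Lower b) \<one>\<^bsub>lgrp G \<gamma>\<^esub>] = \<one>\<^bsub>L.F\<^esub>"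
      if "b \<in> edges Y" "src Y b = \<gamma>" for b
      using L.cl_Loc_one[of Cone] L.cl_Loc_one[of "Lower b"] that by simp_all
    have one': "L.cl [Loc Cone \<one>\<^bsub>lgrp G \<gamma>\<^esub>] = \<one>\<^bsub>L.F\<^esub>" using L.cl_Loc_one[of Cone] by simp
    have ci: "cmp Y c d \<in> edges Y" "src Y (cmp Y c d) = src Y d" "tgt Y (cmp Y c d) = tgt Y c"
      if "c \<in> edges Y" "d \<in> edges Y" "src Y c = tgt Y d" for c d
      using cmp_in src_cmp tgt_cmp that by (simp_all add: composable_def)
    show ?thesis
    proof (cases a)
      case (UpperE c d)
      then have cd: "c \<in> edges Y" "d \<in> edges Y" "src Y c = tgt Y d" "tgt Y c = \<gamma>" using a by auto
      have co: "composable L (ToCone c) (UpperE c d)" using cd by (simp add: composable_def)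
      have "L.cl [Pos (ToCone c)] \<otimes>\<^bsub>L.F\<^esub> L.cl [Pos (UpperE c d)] = L.cl [Loc Cone (twist G c d)] \<otimes>\<^bsub>L.F\<^esub> L.cl [Pos (ToCone (cmp Y c d))]"
        using L.cl_twist[OF co] by simp
      moreover have "L.cl [Pos (UpperE c d)] = inv\<^bsub>L.F\<^esub> L.cl [Pos (ToCone c)] \<otimes>\<^bsub>L.F\<^esub> (L.cl [Pos (ToCone c)] \<otimes>\<^bsub>L.F\<^esub> L.cl [Pos (UpperE c d)])"
        using cd by (simp add: L.F.m_assoc[symmetric])
      ultimately have "L.cl [Pos (UpperE c d)] = inv\<^bsub>L.F\<^esub> L.cl [Pos (ToCone c)] \<otimes>\<^bsub>L.F\<^esub> (L.cl [Loc Cone (twist G c d)] \<otimes>\<^bsub>L.F\<^esub> L.cl [Pos (ToCone (cmp Y c d))])"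
        by simp
      then show ?thesis using UpperE cd ci twist_in_\<gamma>[OF cd]
        by (intro bexI[of _ "twist G c d"]) (simp_all add: L.cl_Neg L.F.m_assoc)
    next
      case (ToCone c)
      then show ?thesis using a by (intro bexI[of _ "\<one>\<^bsub>lgrp G \<gamma>\<^esub>"]) (simp_all add: one' L.cl_Neg)
    next
      case (Join b c)
      then have bc: "b \<in> edges Y" "src Y b = \<gamma>" "c \<in> edges Y" "tgt Y c = \<gamma>" using a by auto
      have co: "composable L (FromCone b) (ToCone c)" using bc by (simp add: composable_def)
      have "L.cl [Pos (FromCone b)] \<otimes>\<^bsub>L.F\<^esub> L.cl [Pos (ToCone c)] = L.cl [Pos (Join b c)]"
        using L.cl_twist[OF co] one[OF bc(1,2)] bc by simp
      then show ?thesis using Join bc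
        by (intro bexI[of _ "\<one>\<^bsub>lgrp G \<gamma>\<^esub>"]) (simp_all add: one' L.cl_Neg)
    next
      case (FromCone b)
      then show ?thesis using a by (intro bexI[of _ "\<one>\<^bsub>lgrp G \<gamma>\<^esub>"]) (simp_all add: one')
    next
      case (LowerE a' b)
      then have ab: "a' \<in> edges Y" "b \<in> edges Y" "src Y a' = tgt Y b" "src Y b = \<gamma>" using a by auto
      have co: "composable L (LowerE a' b) (FromCone b)" using ab by (simp add: composable_def)
      have "L.cl [Pos (LowerE a' b)] \<otimes>\<^bsub>L.F\<^esub> L.cl [Pos (FromCone b)] = L.cl [Pos (FromCone (cmp Y a' b))]"
        using L.cl_twist[OF co] one[of "cmp Y a' b"] ci[OF ab(1-3)] ab by simp
      moreover have "L.cl [Pos (LowerE a' b)] = L.cl [Pos (LowerE a' b)] \<otimes>\<^bsub>L.F\<^esub> L.cl [Pos (FromCone b)] \<otimes>\<^bsub>L.F\<^esub> inv\<^bsub>L.F\<^esub> L.cl [Pos (FromCone b)]"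
        using ab by (simp add: L.F.m_assoc)
      ultimately have "L.cl [Pos (LowerE a' b)] = L.cl [Pos (FromCone (cmp Y a' b))] \<otimes>\<^bsub>L.F\<^esub> inv\<^bsub>L.F\<^esub> L.cl [Pos (FromCone b)]"
        by metis
      then show ?thesis using LowerE ab ci[OF ab(1-3)]
        by (intro bexI[of _ "\<one>\<^bsub>lgrp G \<gamma>\<^esub>"]) (simp_all add: one')
    qed
  qed
  show ?thesis
  proof (cases l)
    case (Loc v g)
    show ?thesis
    proof (cases v)
      case (Upper c)
      then have c: "c \<in> edges Y" "tgt Y c = \<gamma>" "g \<in> carrier (lgrp G (src Y c))" using l Loc by auto
      have "L.cl [Loc Cone (psi G c g)] = L.cl [Pos (ToCone c)] \<otimes>\<^bsub>L.F\<^esub> L.cl [Loc (Upper c) g] \<otimes>\<^bsub>L.F\<^esub> inv\<^bsub>L.F\<^esub> L.cl [Pos (ToCone c)]"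
        using L.cl_psi[of "ToCone c" g] c by simp
      then show ?thesis using Loc Upper c psi_in_\<gamma>[OF c]
        by (intro bexI[of _ "psi G c g"]) (simp_all add: L.cl_Neg L.F.m_assoc, simp add: L.F.m_assoc[symmetric])
    next
      case Cone
      then show ?thesis using l Loc by (intro bexI[of _ g]) simp_all
    next
      case (Lower b)
      then have b: "b \<in> edges Y" "src Y b = \<gamma>" "g \<in> carrier (lgrp G \<gamma>)" using l Loc by auto
      then show ?thesis using L.cl_psi[of "FromCone b" g] Loc Lower by (intro bexI[of _ g]) simp_all
    qed
  next
    case (Pos a) then show ?thesis using edge[of a] l by simp
  next
    case (Neg a)
    then have a: "a \<in> edges L" using l by simp
    obtain g where g: "g \<in> carrier (lgrp G \<gamma>)" "L.cl [Pos a] = spoke (tgt L a) \<otimes>\<^bsub>L.F\<^esub> L.cl [Loc Cone g] \<otimes>\<^bsub>L.F\<^esub> inv\<^bsub>L.F\<^esub> spoke (src L a)"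
      using edge[OF a] by blast
    have s: "spoke (tgt L a) \<in> carrier L.F" "spoke (src L a) \<in> carrier L.F" "L.cl [Loc Cone g] \<in> carrier L.F"
      using spoke_in L.src_in[OF a] L.tgt_in[OF a] g by (auto simp del: local_scwol_simps(9,10))
    have "L.cl [Loc Cone (inv\<^bsub>lgrp G \<gamma>\<^esub> g)] = inv\<^bsub>L.F\<^esub> L.cl [Loc Cone g]" using L.cl_Loc_inv[of Cone g] g by simp
    then have "L.cl [Neg a] = spoke (src L a) \<otimes>\<^bsub>L.F\<^esub> L.cl [Loc Cone (inv\<^bsub>lgrp G \<gamma>\<^esub> g)] \<otimes>\<^bsub>L.F\<^esub> inv\<^bsub>L.F\<^esub> spoke (tgt L a)"
      using a g s by (simp add: L.cl_Neg L.F.inv_mult_group L.F.m_assoc del: local_scwol_simps(9,10))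
    then show ?thesis using Neg g(1) by (intro bexI[of _ "inv\<^bsub>lgrp G \<gamma>\<^esub> g"]) simp_all
  qed
qed

text \<open>The spokes at the intermediate objects cancel and the cone elements multiply. For a loop
  at the cone point the two outer spokes are trivial as well.\<close>

lemma cone_word:
  assumes "wpath L LG v w v'"
  shows "\<exists>g\<in>carrier (lgrp G \<gamma>). L.cl w = spoke v \<otimes>\<^bsub>L.F\<^esub> L.cl [Loc Cone g] \<otimes>\<^bsub>L.F\<^esub> inv\<^bsub>L.F\<^esub> spoke v'"
  using assms
proof (induction w arbitrary: v)
  case Nil
  then have "v' = v" and v: "v \<in> verts L" by auto
  have "L.cl [] = spoke v \<otimes>\<^bsub>L.F\<^esub> L.cl [Loc Cone \<one>\<^bsub>lgrp G \<gamma>\<^esub>] \<otimes>\<^bsub>L.F\<^esub> inv\<^bsub>L.F\<^esub> spoke v'"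
    unfolding \<open>v' = v\<close> using L.cl_Loc_one[of Cone] spoke_in[OF v] by (simp add: L.cl_Nil)
  then show ?case using M.one_closed by (rule bexI)
next
  case (Cons l w)
  let ?m = "letter_end L l"
  have l: "l \<in> fg_letters L LG" "letter_start L l = v" "wpath L LG ?m w v'" using Cons.prems by auto
  obtain g where g: "g \<in> carrier (lgrp G \<gamma>)" "L.cl [l] = spoke v \<otimes>\<^bsub>L.F\<^esub> L.cl [Loc Cone g] \<otimes>\<^bsub>L.F\<^esub> inv\<^bsub>L.F\<^esub> spoke ?m"
    using cone_letter[OF l(1)] l(2) by blast
  obtain h where h: "h \<in> carrier (lgrp G \<gamma>)" "L.cl w = spoke ?m \<otimes>\<^bsub>L.F\<^esub> L.cl [Loc Cone h] \<otimes>\<^bsub>L.F\<^esub> inv\<^bsub>L.F\<^esub> spoke v'"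
    using Cons.IH[OF l(3)] by blast
  have s: "spoke v \<in> carrier L.F" "spoke ?m \<in> carrier L.F" "spoke v' \<in> carrier L.F" "L.cl [Loc Cone g] \<in> carrier L.F" "L.cl [Loc Cone h] \<in> carrier L.F"
    using spoke_in L.letter_verts[OF l(1)] l(2) L.wpath_verts[OF l(3)] g h by auto
  have "L.cl (l # w) = spoke v \<otimes>\<^bsub>L.F\<^esub> (L.cl [Loc Cone g] \<otimes>\<^bsub>L.F\<^esub> L.cl [Loc Cone h]) \<otimes>\<^bsub>L.F\<^esub> inv\<^bsub>L.F\<^esub> spoke v'"
    unfolding L.cl_Cons[of l w] g(2) h(2) using s
    by (simp add: L.F.m_assoc) (simp add: L.F.m_assoc[symmetric])
  moreover have "L.cl [Loc Cone g] \<otimes>\<^bsub>L.F\<^esub> L.cl [Loc Cone h] = L.cl [Loc Cone (g \<otimes>\<^bsub>lgrp G \<gamma>\<^esub> h)]"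
    using L.cl_Loc_mult[of Cone g h] g(1) h(1) by simp
  ultimately have "L.cl (l # w) = spoke v \<otimes>\<^bsub>L.F\<^esub> L.cl [Loc Cone (g \<otimes>\<^bsub>lgrp G \<gamma>\<^esub> h)] \<otimes>\<^bsub>L.F\<^esub> inv\<^bsub>L.F\<^esub> spoke v'"
    by metis
  then show ?case using M.m_closed[OF g(1) h(1)] by (rule bexI)
qed

lemma carrier_pi1_cone: "carrier (pi1 L LG Cone) = (\<lambda>g. L.cl [Loc Cone g]) ` carrier (lgrp G \<gamma>)"
proof (intro equalityI subsetI)
  fix x assume "x \<in> carrier (pi1 L LG Cone)"
  then obtain w where w: "x = L.cl w" "gpath L LG Cone w Cone" by (auto simp: pi1_def)
  obtain g where g: "g \<in> carrier (lgrp G \<gamma>)"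
      "L.cl w = spoke Cone \<otimes>\<^bsub>L.F\<^esub> L.cl [Loc Cone g] \<otimes>\<^bsub>L.F\<^esub> inv\<^bsub>L.F\<^esub> spoke Cone"
    using cone_word[OF gpath_imp_wpath[OF L.scwol_axioms w(2)]] by (rule bexE)
  then have "L.cl w = L.cl [Loc Cone g]" by simp
  then show "x \<in> (\<lambda>g. L.cl [Loc Cone g]) ` carrier (lgrp G \<gamma>)" using w(1) g(1) by simp
next
  fix x assume "x \<in> (\<lambda>g. L.cl [Loc Cone g]) ` carrier (lgrp G \<gamma>)"
  then obtain g where g: "x = L.cl [Loc Cone g]" "g \<in> carrier (lgrp G \<gamma>)" by blast
  then have "gpath L LG Cone [Loc Cone g] Cone" by (intro gpath_Loc) simp_all
  then show "x \<in> carrier (pi1 L LG Cone)" using g(1) by (auto simp: pi1_def)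
qed

text \<open>The inclusion of the cone group into \<open>FG\<close> of \<open>Y\<close> is the map
  induced by \<Sigma> after its inclusion into the local fundamental group, and the latter inclusion
  is bijective.\<close>

lemma pi1_injective_iff:
  "pi1_injective L LG Y G (Sigma_mor Y G \<gamma>) Cone \<longleftrightarrow> inj_on (\<lambda>g. cl [Loc \<gamma> g]) (carrier (lgrp G \<gamma>))"
proof -
  have "fg_map Y G (Sigma_mor Y G \<gamma>) (L.cl [Loc Cone g]) = cl [Loc \<gamma> g]" for g
    using fg_map_class[OF L.complex_of_groups_axioms complex_of_groups_axioms cog_morphism_Sigma_mor[OF complex_of_groups_axioms \<gamma>], of "[Loc Cone g]"]
    by (simp add: Sigma_mor_def)
  then have "(\<lambda>g. cl [Loc \<gamma> g]) = fg_map Y G (Sigma_mor Y G \<gamma>) \<circ> (\<lambda>g. L.cl [Loc Cone g])" by (simp add: o_def)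
  then show ?thesis
    unfolding pi1_injective_def carrier_pi1_cone using comp_inj_on_iff[OF inj_cone] by metis
qed

end

theorem corollary1p2:
  fixes Y :: "('v, 'e) scwol" and G :: "('v, 'e, 'g) cog"
  assumes "complex_of_groups Y G"
    and "connected_scwol Y"
  shows "(developable Y G \<longleftrightarrow>
           (\<forall>\<gamma>\<in>verts Y.
              pi1_injective (local_scwol Y \<gamma>) (local_cog Y G \<gamma>) Y G (Sigma_mor Y G \<gamma>) Cone))
         \<and> (developable_over TYPE('h \<times> 'w \<times> 'd) Y G \<longrightarrow> developable Y G)"
proof -
  have iff: "pi1_injective (local_scwol Y \<gamma>) (local_cog Y G \<gamma>) Y G (Sigma_mor Y G \<gamma>) Cone \<longleftrightarrow>
      inj_on (\<lambda>g. fg_class Y G [Loc \<gamma> g]) (carrier (lgrp G \<gamma>))" if "\<gamma> \<in> verts Y" for \<gamma>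
    using cone_cog.pi1_injective_iff[of Y G \<gamma>] assms(1) that
    by (simp add: cone_cog_def cone_cog_axioms_def)
  show ?thesis
  proof (intro conjI iffI impI ballI)
    fix \<gamma> assume "developable Y G" and \<gamma>: "\<gamma> \<in> verts Y"
    then show "pi1_injective (local_scwol Y \<gamma>) (local_cog Y G \<gamma>) Y G (Sigma_mor Y G \<gamma>) Cone"
      unfolding iff[OF \<gamma>] developable_def by (intro developable_over_imp_injective[OF assms(1)])
  next
    assume "\<forall>\<gamma>\<in>verts Y. pi1_injective (local_scwol Y \<gamma>) (local_cog Y G \<gamma>) Y G (Sigma_mor Y G \<gamma>) Cone"
    then show "developable Y G" using iff by (intro developable_if_injective[OF assms]) simp
  next
    \<comment> \<open>The types of the given development disappear in the injectivity of the local
      groups, from which the standard development is rebuilt.\<close>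
    assume "developable_over TYPE('h \<times> 'w \<times> 'd) Y G"
    then show "developable Y G"
      by (intro developable_if_injective[OF assms] developable_over_imp_injective[OF assms(1)])
  qed
qed

end
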